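(* Let $f$ be a real-valued function on pairs $(\rho,\sigma)$ with $\sigma\in\mathcal F$ and $\rho$ a density matrix on the same Hilbert space as $\sigma$, such that $f$ is locally monotonic with respect to $\mathcal C_{\mathcal F}$ and $\rho\mapsto f(\rho,\sigma)$ is continuous for each fixed $\sigma\in\mathcal F$. Then there are constants $a,b$ such that $f(\rho,\sigma)=a\,S(\rho\|\sigma)+b$ for all such pairs.
   Context: $S(\rho\|\sigma)=\mathrm{Tr}(\rho(\log\rho-\log\sigma))$. $\mathcal F$ is the set of all full-rank density matrices on finite-dimensional Hilbert spaces, and $\mathcal C_{\mathcal F}$ is the set of quantum channels (between possibly different finite-dimensional Hilbert spaces) that map full-rank states to full-rank states. $f$ is locally monotonic with respect to $\mathcal C_{\mathcal F}$ if whenever $C\in\mathcal C_{\mathcal F}$ acts on $\mathcal H_1\otimes\mathcal H_2$ with output space $\mathcal H'_1\otimes\mathcal H'_2$, $\sigma_1\otimes\sigma_2\in\mathcal F$ and $C[\sigma_1\otimes\sigma_2]=\sigma'_1\otimes\sigma'_2\in\mathcal F$, then for all density matrices $\rho_1,\rho_2$ on $\mathcal H_1,\mathcal H_2$: $f(\rho_1,\sigma_1)+f(\rho_2,\sigma_2)\ge f(\rho'_1,\sigma'_1)+f(\rho'_2,\sigma'_2)$, where $\rho'_1=\mathrm{Tr}_2[C(\rho_1\otimes\rho_2)]$ and $\rho'_2=\mathrm{Tr}_1[C(\rho_1\otimes\rho_2)]$. *)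

theory Defs
  imports Complex_Main "Jordan_Normal_Form.Matrix" "Jordan_Normal_Form.Determinant"
begin

text \<open>Finite-dimensional Hilbert spaces are modelled as C^n; operators as n x n
complex matrices (type complex mat, the dimension is carried by the matrix).\<close>

definition mtrace :: "complex mat \<Rightarrow> complex" where
  "mtrace A = (\<Sum>i<dim_row A. A $$ (i,i))"

definition adj :: "complex mat \<Rightarrow> complex mat" where
  "adj A = Matrix.mat (dim_col A) (dim_row A) (\<lambda>(i,j). cnj (A $$ (j,i)))"

definition hermitian :: "nat \<Rightarrow> complex mat \<Rightarrow> bool" where
  "hermitian n A \<longleftrightarrow> A \<in> carrier_mat n n \<and> adj A = A"

definition psd :: "nat \<Rightarrow> complex mat \<Rightarrow> bool" where
  "psd n A \<longleftrightarrow> hermitian n A \<and>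
     (\<forall>x :: nat \<Rightarrow> complex. let q = (\<Sum>i<n. \<Sum>j<n. cnj (x i) * A $$ (i,j) * x j)
        in Im q = 0 \<and> 0 \<le> Re q)"

definition density :: "nat \<Rightarrow> complex mat \<Rightarrow> bool" where
  "density n \<rho> \<longleftrightarrow> psd n \<rho> \<and> mtrace \<rho> = 1"

definition fullrank_state :: "nat \<Rightarrow> complex mat \<Rightarrow> bool" where
  "fullrank_state n \<sigma> \<longleftrightarrow> density n \<sigma> \<and> det \<sigma> \<noteq> 0"

definition unitary :: "nat \<Rightarrow> complex mat \<Rightarrow> bool" where
  "unitary n U \<longleftrightarrow> U \<in> carrier_mat n n \<and> adj U * U = 1\<^sub>m n"

definition mat_fun :: "(real \<Rightarrow> real) \<Rightarrow> complex mat \<Rightarrow> complex mat" where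
  "mat_fun g A = (let n = dim_row A;
     (U, d) = (SOME (U, d). unitary n U \<and>
                 A = U * mat_diag n (\<lambda>i. complex_of_real (d i)) * adj U)
   in U * mat_diag n (\<lambda>i. complex_of_real (g (d i))) * adj U)"

text \<open>relative entropy S(rho||sigma) = Tr(rho log rho) - Tr(rho log sigma),
  with the convention 0 log 0 = 0 in Tr(rho log rho)\<close>
definition rel_entropy :: "complex mat \<Rightarrow> complex mat \<Rightarrow> real" where
  "rel_entropy \<rho> \<sigma> = Re (mtrace (mat_fun (\<lambda>x. x * ln x) \<rho>)) - Re (mtrace (\<rho> * mat_fun ln \<sigma>))"

text \<open>tensor (Kronecker) product, C^n1 (x) C^n2 = C^(n1*n2), index (i,b) ~ i*n2+b\<close>
definition kron :: "complex mat \<Rightarrow> complex mat \<Rightarrow> complex mat" where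
  "kron A B = Matrix.mat (dim_row A * dim_row B) (dim_col A * dim_col B)
     (\<lambda>(i,j). A $$ (i div dim_row B, j div dim_col B) * B $$ (i mod dim_row B, j mod dim_col B))"

definition ptrace2 :: "nat \<Rightarrow> nat \<Rightarrow> complex mat \<Rightarrow> complex mat" where
  "ptrace2 n1 n2 X = Matrix.mat n1 n1 (\<lambda>(i,j). \<Sum>b<n2. X $$ (i*n2+b, j*n2+b))"

definition ptrace1 :: "nat \<Rightarrow> nat \<Rightarrow> complex mat \<Rightarrow> complex mat" where
  "ptrace1 n1 n2 X = Matrix.mat n2 n2 (\<lambda>(a,b). \<Sum>i<n1. X $$ (i*n2+a, i*n2+b))"

definition id_tensor :: "nat \<Rightarrow> nat \<Rightarrow> nat \<Rightarrow> (complex mat \<Rightarrow> complex mat) \<Rightarrow> complex mat \<Rightarrow> complex mat" where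
  "id_tensor k n m C X = Matrix.mat (k*m) (k*m)
     (\<lambda>(p,q). C (Matrix.mat n n (\<lambda>(i,j). X $$ ((p div m)*n + i, (q div m)*n + j))) $$ (p mod m, q mod m))"

definition channel :: "nat \<Rightarrow> nat \<Rightarrow> (complex mat \<Rightarrow> complex mat) \<Rightarrow> bool" where
  "channel n m C \<longleftrightarrow>
     (\<forall>X \<in> carrier_mat n n. C X \<in> carrier_mat m m) \<and>
     (\<forall>X \<in> carrier_mat n n. \<forall>Y \<in> carrier_mat n n. C (X + Y) = C X + C Y) \<and>
     (\<forall>X \<in> carrier_mat n n. \<forall>c. C (c \<cdot>\<^sub>m X) = c \<cdot>\<^sub>m C X) \<and>
     (\<forall>X \<in> carrier_mat n n. mtrace (C X) = mtrace X) \<and>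
     (\<forall>k X. psd (k*n) X \<longrightarrow> psd (k*m) (id_tensor k n m C X))"

definition channel_F :: "nat \<Rightarrow> nat \<Rightarrow> (complex mat \<Rightarrow> complex mat) \<Rightarrow> bool" where
  "channel_F n m C \<longleftrightarrow> channel n m C \<and>
     (\<forall>\<sigma>. fullrank_state n \<sigma> \<longrightarrow> fullrank_state m (C \<sigma>))"

definition locally_monotonic :: "(complex mat \<Rightarrow> complex mat \<Rightarrow> real) \<Rightarrow> bool" where
  "locally_monotonic f \<longleftrightarrow>
     (\<forall>n1 n2 m1 m2 C \<sigma>1 \<sigma>2 \<sigma>1' \<sigma>2' \<rho>1 \<rho>2.
        channel_F (n1*n2) (m1*m2) C \<and>
        fullrank_state n1 \<sigma>1 \<and> fullrank_state n2 \<sigma>2 \<and>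
        fullrank_state m1 \<sigma>1' \<and> fullrank_state m2 \<sigma>2' \<and>
        C (kron \<sigma>1 \<sigma>2) = kron \<sigma>1' \<sigma>2' \<and>
        density n1 \<rho>1 \<and> density n2 \<rho>2 \<longrightarrow>
        f \<rho>1 \<sigma>1 + f \<rho>2 \<sigma>2 \<ge>
          f (ptrace2 m1 m2 (C (kron \<rho>1 \<rho>2))) \<sigma>1' + f (ptrace1 m1 m2 (C (kron \<rho>1 \<rho>2))) \<sigma>2')"

definition continuous_first :: "(complex mat \<Rightarrow> complex mat \<Rightarrow> real) \<Rightarrow> bool" where
  "continuous_first f \<longleftrightarrow>
     (\<forall>n \<sigma> \<rho> X. fullrank_state n \<sigma> \<and> density n \<rho> \<and> (\<forall>k. density n (X k)) \<and>
        (\<forall>i<n. \<forall>j<n. (\<lambda>k. X k $$ (i,j)) \<longlonglongrightarrow> \<rho> $$ (i,j)) \<longrightarrow>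
        (\<lambda>k. f (X k) \<sigma>) \<longlonglongrightarrow> f \<rho> \<sigma>)"

end

theory Submission
  imports Defs "Jordan_Normal_Form.Spectral_Radius"
begin

text \<open>
  After subtracting the value of \<open>f\<close> on the one-dimensional pair, \<open>f\<close> is nonnegative, satisfies the data
  processing inequality, is additive on tensor powers, and is superadditive with respect to a product
  second argument. Let \<open>\<phi>(l)\<close> (\<open>calib l\<close> in the code) be the value of \<open>f\<close> on the classical pair \<open>(1,0)\<close>, \<open>(1/l, 1 - 1/l)\<close>;
  monotonicity and additivity force \<open>\<phi> = a ln\<close>.

  Upper bound: compressing \<open>\<rho>\<^sup>k\<close> by typical projections of \<open>\<rho>\<^sup>k\<close> and of \<open>\<sigma>\<^sup>k\<close> gives a state
  \<open>R \<le> exp (k (S + 2\<epsilon>)) \<sigma>\<^sup>k\<close> up to a constant factor, all of whose one-copy marginals are close to \<open>\<rho>\<close>. The pair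
  \<open>(R, \<sigma>\<^sup>k)\<close> is prepared by a channel from a classical pair, so \<open>f(R, \<sigma>\<^sup>k) \<le> a k (S + 2\<epsilon>) + O(1)\<close>, while
  superadditivity and continuity give \<open>f(R, \<sigma>\<^sup>k) \<ge> k (f(\<rho>, \<sigma>) - \<epsilon>)\<close>.

  Lower bound: the same projections yield a test of \<open>\<rho>\<^sup>k\<close> against \<open>\<sigma>\<^sup>k\<close> with error exponent \<open>S - 2\<epsilon>\<close>. Preparing
  \<open>k\<close> copies of the classical pair with \<open>ln l = S - 3\<epsilon>\<close> according to its outcome keeps the second argument
  of the output fixed per copy, so continuity in the first argument alone suffices.
\<close>

section \<open>Spectral theorem\<close>

text \<open>All structure comes from choosing dimensions in local monotonicity: with trivial second
  systems it is data processing, and the identity on a product space, read with a trivial second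
  system on one side only, gives sub- and superadditivity. The obstacle is that admissible channels
  must keep full-rank states full rank. A two-outcome preparation can therefore produce an arbitrary
  state on one outcome only if the other outcome prepares a full-rank state and actually occurs.
  This is paid for by strict inequalities such as \<open>l0 < l\<close> and by a little slack in
  every exponent. Closeness of marginals is measured without a trace norm, by entrywise bounds
  \<open>\<alpha> y + \<beta> y'\<close>: they can be summed over a traced-out index, and their
  total does not grow under partial traces. Unitary invariance makes sigma diagonal, so the typical
  projection of its powers is a coordinate projection, and the diagonal of a power of rho is a
  product law. Both typical sets then come from the classical law of large numbers, although rho and
  sigma need not commute.\<close>

lemma mult_mat_entry:
  assumes "A \<in> carrier_mat n m" "B \<in> carrier_mat m l" "i < n" "j < l"
  shows "(A * B) $$ (i,j) = (\<Sum>k<m. A $$ (i,k) * B $$ (k,j))"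
  using assms by (auto simp: scalar_prod_def lessThan_atLeast0)

lemma square_mult_carrier [simp]:
  "A \<in> carrier_mat n n \<Longrightarrow> B \<in> carrier_mat n n \<Longrightarrow> A * B \<in> carrier_mat n n"
  by (rule mult_carrier_mat)

lemma adj_carrier [simp]: "A \<in> carrier_mat n m \<Longrightarrow> adj A \<in> carrier_mat m n"
  by (auto simp: adj_def)

lemma adj_entry [simp]: "A \<in> carrier_mat n m \<Longrightarrow> i < m \<Longrightarrow> j < n \<Longrightarrow> adj A $$ (i,j) = cnj (A $$ (j,i))"
  by (auto simp: adj_def)

lemma adj_adj [simp]: "adj (adj A) = A"
  by (rule eq_matI) (auto simp: adj_def)

lemma adj_mult:
  assumes "A \<in> carrier_mat n m" "B \<in> carrier_mat m l"
  shows "adj (A * B) = adj B * adj A"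
proof (rule eq_matI)
  fix i j assume "i < dim_row (adj B * adj A)" "j < dim_col (adj B * adj A)"
  then have ij: "i < l" "j < n" using assms by (auto simp: adj_def)
  have AB: "A * B \<in> carrier_mat n l" using assms by auto
  show "adj (A * B) $$ (i,j) = (adj B * adj A) $$ (i,j)"
    unfolding adj_entry[OF AB ij]
    using assms ij by (simp add: mult_mat_entry[of _ n m _ l] mult_mat_entry[of _ l m _ n] mult.commute
        del: index_mult_mat)
qed (use assms in \<open>auto simp: adj_def\<close>)

lemma adj_one [simp]: "adj (1\<^sub>m n) = 1\<^sub>m n"
  by (rule eq_matI) (auto simp: adj_def)

lemma unitary_carrier: "unitary n U \<Longrightarrow> U \<in> carrier_mat n n"
  by (simp add: unitary_def)

lemma unitary_right: "unitary n U \<Longrightarrow> U * adj U = 1\<^sub>m n"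
  using mat_mult_left_right_inverse[of "adj U" n U] by (simp add: unitary_def)

lemma unitary_adj: "unitary n U \<Longrightarrow> unitary n (adj U)"
  using unitary_right[of n U] by (simp add: unitary_def)

lemma unitary_mult:
  assumes "unitary n U" "unitary n V"
  shows "unitary n (U * V)"
proof -
  have c: "U \<in> carrier_mat n n" "V \<in> carrier_mat n n" using assms unitary_carrier by auto
  have "adj (U * V) * (U * V) = adj V * (adj U * U) * V"
    using c by (simp add: adj_mult[of _ n n _ n] assoc_mult_mat[of _ n n _ n _ n])
  then show ?thesis using assms c right_mult_one_mat[of "adj V" n n] by (simp add: unitary_def)
qed

lemma unitary_col_sum:
  assumes "unitary n U" "i < n" "j < n"
  shows "(\<Sum>k<n. cnj (U $$ (k,i)) * U $$ (k,j)) = (if i = j then 1 else 0)"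
proof -
  have U: "U \<in> carrier_mat n n" using assms unitary_carrier by auto
  have "(adj U * U) $$ (i,j) = (\<Sum>k<n. cnj (U $$ (k,i)) * U $$ (k,j))"
    using U assms by (simp add: mult_mat_entry[of _ n n _ n] del: index_mult_mat)
  then show ?thesis using assms by (simp add: unitary_def)
qed

lemma unitary_row_sum:
  assumes "unitary n U" "i < n" "j < n"
  shows "(\<Sum>k<n. U $$ (i,k) * cnj (U $$ (j,k))) = (if i = j then 1 else 0)"
  using unitary_col_sum[OF unitary_adj[OF assms(1)] assms(2,3)] assms unitary_carrier[OF assms(1)]
  by simp

lemma unitaryI:
  assumes "U \<in> carrier_mat n n"
    "\<And>i j. i < n \<Longrightarrow> j < n \<Longrightarrow> (\<Sum>k<n. cnj (U $$ (k,i)) * U $$ (k,j)) = (if i = j then 1 else 0)"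
  shows "unitary n U"
  unfolding unitary_def
proof (intro conjI assms(1), rule eq_matI)
  fix i j assume "i < dim_row (1\<^sub>m n :: complex mat)" "j < dim_col (1\<^sub>m n :: complex mat)"
  then show "(adj U * U) $$ (i,j) = (1\<^sub>m n :: complex mat) $$ (i,j)"
    using assms by (simp add: mult_mat_entry[of _ n n _ n] del: index_mult_mat)
qed (use assms in \<open>auto simp: adj_def\<close>)

lemma conj_diag_entry:
  assumes "U \<in> carrier_mat n n" "i < n" "j < n"
  shows "(U * mat_diag n d * adj U) $$ (i,j) = (\<Sum>k<n. d k * (U $$ (i,k) * cnj (U $$ (j,k))))"
proof -
  have "U * mat_diag n d = Matrix.mat n n (\<lambda>(i,j). U $$ (i,j) * d j)"
    using assms by (simp add: mat_diag_mult_right)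
  then show ?thesis
    using assms by (subst mult_mat_entry[of _ n n _ n]) (auto simp: mult_ac intro!: sum.cong)
qed

lemma hermitian_entry:
  assumes "hermitian n A" "i < n" "j < n"
  shows "cnj (A $$ (i,j)) = A $$ (j,i)"
  using assms adj_entry[of A n n j i] by (auto simp: hermitian_def)

text \<open>The witness is a Householder reflection.\<close>
lemma unitary_first_column:
  fixes v :: "nat \<Rightarrow> complex"
  assumes n: "n > 0" and v: "(\<Sum>i<n. cnj (v i) * v i) = 1" and v0: "v 0 \<in> \<real>"
  shows "\<exists>H. unitary n H \<and> (\<forall>i<n. H $$ (i,0) = v i)"
proof -
  define w where "w i = v i - (if i = 0 then 1 else 0)" for i
  define s where "s = (\<Sum>i<n. cnj (w i) * w i)"
  have cv0: "cnj (v 0) = v 0" using v0 by (auto simp: complex_is_Real_iff complex_eq_iff)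
  \<comment> \<open>Realness of \<open>v 0\<close> gives this value, and exactly this value makes
    the reflection along \<open>w\<close> carry the first unit vector to that vector plus
    \<open>w\<close>, which is \<open>v\<close>.\<close>
  have s: "s = 2 - 2 * v 0"
  proof -
    have "s = (\<Sum>i<n. cnj (v i) * v i - (if i = 0 then cnj (v i) else 0) - (if i = 0 then v i else 0)
        + (if i = 0 then 1 else 0))"
      unfolding s_def w_def by (intro sum.cong) (auto simp: algebra_simps)
    also have "\<dots> = 2 - 2 * v 0"
      using n v cv0 by (simp add: sum.distrib sum_subtractf)
    finally show ?thesis .
  qed
  show ?thesis
  proof (cases "s = 0")
    case True
    then have v01: "v 0 = 1" using s by simp
    have "(\<Sum>i<n. (cmod (w i))^2) = 0"
    proof -
      have "complex_of_real (\<Sum>i<n. (cmod (w i))^2) = s"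
        unfolding s_def of_real_sum by (intro sum.cong refl) (simp only: complex_norm_square mult.commute)
      then show ?thesis using True by (metis of_real_eq_0_iff)
    qed
    then have "\<forall>i<n. w i = 0" by (subst (asm) sum_nonneg_eq_0_iff) auto
    then have "\<forall>i<n. v i = (if i = 0 then 1 else 0)" unfolding w_def by auto
    then show ?thesis using n
      by (intro exI[of _ "1\<^sub>m n"]) (auto simp: unitary_def)
  next
    case False
    define H where "H = Matrix.mat n n (\<lambda>(i,j). (if i = j then 1 else 0) - 2 * w i * cnj (w j) / s)"
    have cs: "cnj s = s" unfolding s using cv0 by simp
    have w0: "cnj (w 0) = v 0 - 1" unfolding w_def using cv0 by simp
    have "unitary n H"
    proof (rule unitaryI)
      fix i j assume ij: "i < n" "j < n"
      have "(\<Sum>k<n. cnj (H $$ (k,i)) * H $$ (k,j)) =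
        (\<Sum>k<n. (if k = i then (if i = j then 1 else 0) else 0) - (if k = i then 2 * w i * cnj (w j) / s else 0)
          - (if k = j then 2 * w i * cnj (w j) / s else 0) + (4 * w i * cnj (w j) / s^2) * (cnj (w k) * w k))"
        using ij False cs by (intro sum.cong) (auto simp: H_def field_simps power2_eq_square)
      also have "\<dots> = (if i = j then 1 else 0)"
        unfolding sum.distrib sum_subtractf sum_distrib_left[symmetric] s_def[symmetric]
        using ij False by (simp add: power2_eq_square field_simps)
      finally show "(\<Sum>k<n. cnj (H $$ (k,i)) * H $$ (k,j)) = (if i = j then 1 else 0)" .
    qed (simp add: H_def)
    moreover have "H $$ (i,0) = v i" if "i < n" for i
    proof -
      have "H $$ (i,0) = (if i = 0 then 1 else 0) - 2 * w i * (v 0 - 1) / s"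
        using that n w0 by (simp add: H_def)
      also have "2 * w i * (v 0 - 1) = - (w i * s)" unfolding s by (simp add: algebra_simps)
      finally show ?thesis using False by (simp add: w_def)
    qed
    ultimately show ?thesis by blast
  qed
qed

lemma eigenvector_unit_exists:
  fixes A :: "complex mat"
  assumes A: "A \<in> carrier_mat n n" and n: "n > 0"
  shows "\<exists>k v. (\<Sum>i<n. cnj (v i) * v i) = 1 \<and> v 0 \<in> \<real> \<and> (\<forall>i<n. (\<Sum>j<n. A $$ (i,j) * v j) = k * v i)"
proof -
  obtain k where "k \<in> spectrum A" using spectrum_non_empty[OF A] n by auto
  then obtain u where u: "eigenvector A u k" by (auto simp: spectrum_def eigenvalue_def)
  then have uc: "u \<in> carrier_vec n" and u0: "u \<noteq> 0\<^sub>v n" and uk: "A *\<^sub>v u = k \<cdot>\<^sub>v u"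
    using A by (auto simp: eigenvector_def)
  define r where "r = (\<Sum>i<n. (cmod (u $ i))^2)"
  obtain i0 where "i0 < n" "u $ i0 \<noteq> 0"
    using u0 uc by (metis carrier_vecD eq_vecI index_zero_vec)
  then have r: "r > 0" unfolding r_def
    by (intro sum_pos2[of _ i0]) auto
  \<comment> \<open>A phase that makes the first coordinate real, as the Householder reflection
    requires.\<close>
  define \<alpha> where "\<alpha> = (if u $ 0 = 0 then 1 else cnj (u $ 0) / cmod (u $ 0))"
  have al: "cmod \<alpha> = 1" unfolding \<alpha>_def by (auto simp: norm_divide)
  define v where "v i = \<alpha> * u $ i / sqrt r" for i
  have "(\<Sum>i<n. cnj (v i) * v i) = (\<Sum>i<n. complex_of_real ((cmod (u $ i))^2 / r))"
  proof (intro sum.cong refl)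
    fix i
    have "cnj (v i) * v i = complex_of_real ((cmod (v i))^2)"
      by (simp only: complex_norm_square mult.commute)
    also have "(cmod (v i))^2 = (cmod (u $ i))^2 / r"
      using r al by (simp add: v_def norm_mult norm_divide power_divide)
    finally show "cnj (v i) * v i = complex_of_real ((cmod (u $ i))^2 / r)" .
  qed
  also have "\<dots> = complex_of_real (r / r)" by (simp only: of_real_sum[symmetric] r_def sum_divide_distrib)
  finally have 1: "(\<Sum>i<n. cnj (v i) * v i) = 1" using r by simp
  have "\<alpha> * u $ 0 = of_real (cmod (u $ 0))"
    unfolding \<alpha>_def using complex_norm_square[of "u $ 0"]
    by (auto simp: field_simps power2_eq_square)
  then have 2: "v 0 \<in> \<real>" unfolding v_def by simp
  have "(\<Sum>j<n. A $$ (i,j) * v j) = k * v i" if "i < n" for i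
  proof -
    have "(\<Sum>j<n. A $$ (i,j) * u $ j) = k * u $ i"
      using arg_cong[OF uk, of "\<lambda>x. x $ i"] that A uc by (auto simp: scalar_prod_def lessThan_atLeast0)
    then have "(\<Sum>j<n. \<alpha> / sqrt r * (A $$ (i,j) * u $ j)) = \<alpha> / sqrt r * (k * u $ i)"
      by (simp only: sum_distrib_left[symmetric])
    then show ?thesis by (simp add: v_def mult_ac)
  qed
  then show ?thesis using 1 2 by blast
qed

text \<open>Deflation: after conjugation by a unitary whose first column is a unit eigenvector, the
  first column of the matrix is a multiple of the first unit vector; hermiticity gives the same for
  the first row, and the remaining block is smaller.\<close>

theorem hermitian_spectral:
  assumes "hermitian n A"
  shows "\<exists>U d. unitary n U \<and> A = U * mat_diag n (\<lambda>i. complex_of_real (d i)) * adj U"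
  using assms
proof (induction n arbitrary: A)
  case 0
  then show ?case by (intro exI[of _ A] exI) (auto simp: hermitian_def unitary_def)
next
  case (Suc n A)
  then have A: "A \<in> carrier_mat (Suc n) (Suc n)" by (simp add: hermitian_def)
  obtain k v where v: "(\<Sum>i<Suc n. cnj (v i) * v i) = 1" "v 0 \<in> \<real>"
    "\<And>i. i < Suc n \<Longrightarrow> (\<Sum>j<Suc n. A $$ (i,j) * v j) = k * v i"
    using eigenvector_unit_exists[OF A] by blast
  obtain H where H: "unitary (Suc n) H" and H0: "\<And>i. i < Suc n \<Longrightarrow> H $$ (i,0) = v i"
    using unitary_first_column[OF _ v(1,2)] by blast
  have Hc: "H \<in> carrier_mat (Suc n) (Suc n)" using H unitary_carrier by blast
  define M where "M = adj H * (A * H)"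
  have Mc: "M \<in> carrier_mat (Suc n) (Suc n)" unfolding M_def using A Hc by auto
  have Mh: "hermitian (Suc n) M"
    using Suc(2) A Hc Mc unfolding M_def hermitian_def
    by (simp add: adj_mult[of _ "Suc n" "Suc n" _ "Suc n"] assoc_mult_mat[of _ "Suc n" "Suc n" _ "Suc n" _ "Suc n"])
  have M0: "M $$ (i,0) = (if i = 0 then k else 0)" if i: "i < Suc n" for i
  proof -
    have "(A * H) $$ (l,0) = k * H $$ (l,0)" if "l < Suc n" for l
      using that A Hc v(3)[OF that] H0
      by (subst mult_mat_entry[of _ "Suc n" "Suc n" _ "Suc n"]) (auto simp del: sum.lessThan_Suc)
    then have "M $$ (i,0) = (\<Sum>l<Suc n. k * (cnj (H $$ (l,i)) * H $$ (l,0)))"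
      unfolding M_def using A Hc i
      by (subst mult_mat_entry[of _ "Suc n" "Suc n" _ "Suc n"])
        (auto simp del: sum.lessThan_Suc index_mult_mat intro!: sum.cong)
    also have "\<dots> = k * (if i = 0 then 1 else 0)"
      using unitary_col_sum[OF H i, of 0] by (simp only: sum_distrib_left[symmetric])
    finally show ?thesis by simp
  qed
  have M0': "M $$ (0,i) = (if i = 0 then k else 0)" if i: "i < Suc n" for i
  proof (cases "i = 0")
    case False
    then show ?thesis using hermitian_entry[OF Mh i, of 0] M0[OF i] by simp
  qed (use M0 in auto)
  have kr: "complex_of_real (Re k) = k"
    using hermitian_entry[OF Mh, of 0 0] M0[of 0] by (simp add: complex_eq_iff)
  define B where "B = Matrix.mat n n (\<lambda>(i,j). M $$ (Suc i, Suc j))"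
  have "hermitian n B" unfolding hermitian_def
    by (auto simp: B_def adj_def hermitian_entry[OF Mh])
  then obtain V d where V: "unitary n V" and B: "B = V * mat_diag n (\<lambda>i. complex_of_real (d i)) * adj V"
    using Suc(1) by blast
  have Vc: "V \<in> carrier_mat n n" using V unitary_carrier by blast
  define W where "W = Matrix.mat (Suc n) (Suc n)
    (\<lambda>(i,j). if i = 0 \<or> j = 0 then (if i = j then 1 else 0) else V $$ (i-1,j-1))"
  have W: "unitary (Suc n) W"
  proof (rule unitaryI)
    fix i j assume ij: "i < Suc n" "j < Suc n"
    show "(\<Sum>l<Suc n. cnj (W $$ (l,i)) * W $$ (l,j)) = (if i = j then 1 else 0)"
      unfolding sum.lessThan_Suc_shift using ij unitary_col_sum[OF V, of "i-1" "j-1"]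
      by (cases i; cases j) (auto simp: W_def)
  qed (simp add: W_def)
  define e where "e i = (case i of 0 \<Rightarrow> Re k | Suc i \<Rightarrow> d i)" for i
  have MW: "M = W * mat_diag (Suc n) (\<lambda>i. complex_of_real (e i)) * adj W"
  proof (rule eq_matI)
    fix i j assume "i < dim_row (W * mat_diag (Suc n) (\<lambda>i. complex_of_real (e i)) * adj W)"
      "j < dim_col (W * mat_diag (Suc n) (\<lambda>i. complex_of_real (e i)) * adj W)"
    then have ij: "i < Suc n" "j < Suc n" using unitary_carrier[OF W] by (auto simp: adj_def)
    have Bij: "M $$ (Suc a, Suc b) = (\<Sum>k<n. complex_of_real (d k) * (V $$ (a,k) * cnj (V $$ (b,k))))"
      if "a < n" "b < n" for a b
      using conj_diag_entry[OF Vc that, of "\<lambda>i. complex_of_real (d i)"] that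
      unfolding B[symmetric] by (simp add: B_def)
    show "M $$ (i,j) = (W * mat_diag (Suc n) (\<lambda>i. complex_of_real (e i)) * adj W) $$ (i,j)"
      unfolding conj_diag_entry[OF unitary_carrier[OF W] ij] sum.lessThan_Suc_shift
      using ij M0 M0' kr Bij
      by (cases i; cases j) (auto simp: W_def e_def)
  qed (use Mc unitary_carrier[OF W] in \<open>auto simp: adj_def\<close>)
  have "A = H * M * adj H"
  proof -
    have "H * M * adj H = (H * adj H) * A * (H * adj H)"
      unfolding M_def using A Hc
      by (simp add: assoc_mult_mat[of _ "Suc n" "Suc n" _ "Suc n" _ "Suc n"])
    then show ?thesis using unitary_right[OF H] A by simp
  qed
  also have "\<dots> = (H * W) * mat_diag (Suc n) (\<lambda>i. complex_of_real (e i)) * adj (H * W)"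
    unfolding MW using Hc unitary_carrier[OF W]
    by (simp add: adj_mult[of _ "Suc n" "Suc n" _ "Suc n"] assoc_mult_mat[of _ "Suc n" "Suc n" _ "Suc n" _ "Suc n"])
  finally show ?case using unitary_mult[OF H W] by blast
qed

section \<open>Positive semidefinite matrices and channels\<close>

lemma sum_rotate: "(\<Sum>i\<in>A. \<Sum>j\<in>B. \<Sum>s\<in>C. g i j s) = (\<Sum>s\<in>C. \<Sum>i\<in>A. \<Sum>j\<in>B. g i j s)"
  by (simp only: sum.swap[of _ C B] sum.swap[of _ C A])

section \<open>Quadratic forms and Gram decompositions\<close>

definition qform :: "nat \<Rightarrow> complex mat \<Rightarrow> (nat \<Rightarrow> complex) \<Rightarrow> complex" where
  "qform n A x = (\<Sum>i<n. \<Sum>j<n. cnj (x i) * A $$ (i,j) * x j)"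

lemma psd_alt: "psd n A \<longleftrightarrow> hermitian n A \<and> (\<forall>x. Im (qform n A x) = 0 \<and> 0 \<le> Re (qform n A x))"
  by (simp add: psd_def qform_def Let_def)

lemma hermitianI:
  "A \<in> carrier_mat n n \<Longrightarrow> (\<And>i j. i < n \<Longrightarrow> j < n \<Longrightarrow> cnj (A $$ (j,i)) = A $$ (i,j)) \<Longrightarrow> hermitian n A"
  unfolding hermitian_def by (auto simp: adj_def)

lemma hermitian_qform_real:
  assumes "hermitian n A"
  shows "Im (qform n A x) = 0"
proof -
  have "cnj (qform n A x) = (\<Sum>i<n. \<Sum>j<n. cnj (x j) * A $$ (j,i) * x i)"
    unfolding qform_def cnj_sum using hermitian_entry[OF assms]
    by (intro sum.cong) (auto simp: mult_ac)
  also have "\<dots> = qform n A x" unfolding qform_def by (rule sum.swap)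
  finally show ?thesis by (simp add: complex_eq_iff)
qed

lemma psdI:
  assumes "A \<in> carrier_mat n n" "\<And>i j. i < n \<Longrightarrow> j < n \<Longrightarrow> cnj (A $$ (j,i)) = A $$ (i,j)"
    "\<And>x. 0 \<le> Re (qform n A x)"
  shows "psd n A"
  using assms hermitianI[of A n] hermitian_qform_real by (simp add: psd_alt)

lemma psd_carrier [simp]: "psd n A \<Longrightarrow> A \<in> carrier_mat n n"
  by (simp add: psd_def hermitian_def)

lemma psd_cnj: "psd n A \<Longrightarrow> i < n \<Longrightarrow> j < n \<Longrightarrow> cnj (A $$ (i,j)) = A $$ (j,i)"
  using hermitian_entry by (auto simp only: psd_def)

lemma psd_qform_nonneg: "psd n A \<Longrightarrow> 0 \<le> Re (qform n A x)"
  by (simp add: psd_alt)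

lemma qform_gram:
  assumes "finite I" "\<And>i j. i < n \<Longrightarrow> j < n \<Longrightarrow> A $$ (i,j) = (\<Sum>l\<in>I. u l i * cnj (u l j))"
  shows "qform n A x = complex_of_real (\<Sum>l\<in>I. (cmod (\<Sum>i<n. cnj (x i) * u l i))^2)"
proof -
  have "qform n A x = (\<Sum>i<n. \<Sum>j<n. \<Sum>l\<in>I. (cnj (x i) * u l i) * (cnj (u l j) * x j))"
    unfolding qform_def by (intro sum.cong) (auto simp: assms sum_distrib_left sum_distrib_right mult_ac)
  also have "\<dots> = (\<Sum>l\<in>I. \<Sum>i<n. \<Sum>j<n. (cnj (x i) * u l i) * (cnj (u l j) * x j))"
    by (rule sum_rotate)
  also have "\<dots> = (\<Sum>l\<in>I. (\<Sum>i<n. cnj (x i) * u l i) * cnj (\<Sum>i<n. cnj (x i) * u l i))"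
    unfolding cnj_sum sum_product by (intro sum.cong refl) simp
  also have "\<dots> = complex_of_real (\<Sum>l\<in>I. (cmod (\<Sum>i<n. cnj (x i) * u l i))^2)"
    by (simp only: of_real_sum complex_norm_square)
  finally show ?thesis .
qed

text \<open>With the converse \<open>psd_gramE\<close> this is the standard route to positivity
  here: for tensor products, partial traces and channels one exhibits Gram vectors of the output in
  terms of those of the input.\<close>

lemma psd_gramI:
  assumes "A \<in> carrier_mat n n" "finite I"
    and "\<And>i j. i < n \<Longrightarrow> j < n \<Longrightarrow> A $$ (i,j) = (\<Sum>l\<in>I. u l i * cnj (u l j))"
  shows "psd n A"
  using assms by (intro psdI) (auto simp: mult_ac qform_gram[where I=I and u=u] intro!: sum_nonneg)

lemma unitary_diagonalise:
  assumes U: "unitary n U" and A: "A = U * mat_diag n d * adj U"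
  shows "adj U * A * U = mat_diag n d"
proof -
  have c: "U \<in> carrier_mat n n" "mat_diag n d \<in> carrier_mat n n" using unitary_carrier[OF U] by auto
  have "adj U * A * U = (adj U * U) * mat_diag n d * (adj U * U)"
    unfolding A using c by (simp add: assoc_mult_mat[of _ n n _ n _ n])
  then show ?thesis using U right_mult_one_mat[OF c(2)] left_mult_one_mat[OF c(2)] by (simp add: unitary_def)
qed

lemma qform_column:
  assumes "U \<in> carrier_mat n n" "A \<in> carrier_mat n n" "k < n"
  shows "qform n A (\<lambda>i. U $$ (i,k)) = (adj U * A * U) $$ (k,k)"
proof -
  have "(adj U * A * U) $$ (k,k) = (\<Sum>j<n. (\<Sum>i<n. cnj (U $$ (i,k)) * A $$ (i,j)) * U $$ (j,k))"
    using assms by (simp add: mult_mat_entry[of _ n n _ n] del: index_mult_mat)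
  also have "\<dots> = qform n A (\<lambda>i. U $$ (i,k))"
    unfolding qform_def sum_distrib_right by (rule sum.swap)
  finally show ?thesis by (rule sym)
qed

lemma psd_eigenvalue_nonneg:
  assumes "psd n A" and U: "unitary n U" and A: "A = U * mat_diag n (\<lambda>i. complex_of_real (d i)) * adj U"
    and k: "k < n"
  shows "d k \<ge> 0"
proof -
  have "qform n A (\<lambda>i. U $$ (i,k)) = complex_of_real (d k)"
    using qform_column[OF unitary_carrier[OF U] psd_carrier[OF assms(1)] k] k
    by (simp add: unitary_diagonalise[OF U A] mat_diag_def)
  then show ?thesis using psd_qform_nonneg[OF assms(1), of "\<lambda>i. U $$ (i,k)"] by simp
qed

text \<open>The vectors are eigenvectors scaled by the roots of their eigenvalues.\<close>

lemma psd_gramE: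
  assumes "psd n A"
  obtains u where "\<And>i j. i < n \<Longrightarrow> j < n \<Longrightarrow> A $$ (i,j) = (\<Sum>l<n. u l i * cnj (u l j))"
proof -
  obtain U d where U: "unitary n U" and A: "A = U * mat_diag n (\<lambda>i. complex_of_real (d i)) * adj U"
    using hermitian_spectral[of n A] assms unfolding psd_alt by blast
  have "A $$ (i,j) = (\<Sum>l<n. (sqrt (d l) * U $$ (i,l)) * cnj (sqrt (d l) * U $$ (j,l)))" if "i < n" "j < n" for i j
    unfolding A conj_diag_entry[OF unitary_carrier[OF U] that]
  proof (intro sum.cong refl)
    fix l assume "l \<in> {..<n}"
    then have "complex_of_real (d l) = complex_of_real (sqrt (d l)) * complex_of_real (sqrt (d l))"
      using psd_eigenvalue_nonneg[OF assms U A, of l] by (simp flip: of_real_mult)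
    then show "complex_of_real (d l) * (U $$ (i,l) * cnj (U $$ (j,l))) =
        (sqrt (d l) * U $$ (i,l)) * cnj (sqrt (d l) * U $$ (j,l))" by (simp add: mult_ac)
  qed
  then show ?thesis by (rule that)
qed

lemma qform_add:
  assumes "A \<in> carrier_mat n n" "B \<in> carrier_mat n n"
  shows "qform n (A + B) x = qform n A x + qform n B x"
  unfolding qform_def sum.distrib[symmetric]
  using assms by (intro sum.cong refl) (auto simp: algebra_simps)

lemma qform_smult:
  assumes "A \<in> carrier_mat n n"
  shows "qform n (c \<cdot>\<^sub>m A) x = c * qform n A x"
  using assms by (auto simp: qform_def sum_distrib_left mult_ac intro!: sum.cong)

lemma psd_add:
  assumes "psd n A" "psd n B"
  shows "psd n (A + B)"
  using assms carrier_matD[OF psd_carrier[OF assms(1)]] carrier_matD[OF psd_carrier[OF assms(2)]]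
  by (intro psdI) (auto simp: qform_add psd_qform_nonneg psd_cnj)

lemma psd_smult:
  assumes "psd n A" "c \<ge> 0"
  shows "psd n (complex_of_real c \<cdot>\<^sub>m A)"
  using assms carrier_matD[OF psd_carrier[OF assms(1)]]
  by (intro psdI) (auto simp: qform_smult psd_qform_nonneg psd_cnj)

lemma mtrace_carrier: "A \<in> carrier_mat n n \<Longrightarrow> mtrace A = (\<Sum>i<n. A $$ (i,i))"
  by (auto simp: mtrace_def)

lemma mtrace_add: "A \<in> carrier_mat n n \<Longrightarrow> B \<in> carrier_mat n n \<Longrightarrow> mtrace (A + B) = mtrace A + mtrace B"
  by (auto simp: mtrace_def sum.distrib)

lemma mtrace_smult: "mtrace (c \<cdot>\<^sub>m A) = c * mtrace A" if "A \<in> carrier_mat n n"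
  using that by (auto simp: mtrace_def sum_distrib_left)

lemma mtrace_mult:
  assumes "A \<in> carrier_mat n n" "B \<in> carrier_mat n n"
  shows "mtrace (A * B) = (\<Sum>i<n. \<Sum>j<n. A $$ (i,j) * B $$ (j,i))"
  using assms by (simp add: mtrace_carrier[of _ n] mult_mat_entry[of _ n n _ n] del: index_mult_mat)

lemma mtrace_comm:
  assumes "A \<in> carrier_mat n n" "B \<in> carrier_mat n n"
  shows "mtrace (A * B) = mtrace (B * A)"
  unfolding mtrace_mult[OF assms] mtrace_mult[OF assms(2,1)] by (subst sum.swap) (simp add: mult.commute)

text \<open>Reduces the trace of a product to quadratic forms, so that positivity of
  \<open>X\<close> yields reality and nonnegativity of outcome probabilities.\<close>

lemma mtrace_mult_gram:
  assumes "T \<in> carrier_mat n n" "X \<in> carrier_mat n n"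
    "\<And>i j. i < n \<Longrightarrow> j < n \<Longrightarrow> T $$ (i,j) = (\<Sum>l<N. t l i * cnj (t l j))"
  shows "mtrace (T * X) = (\<Sum>l<N. qform n X (t l))"
proof -
  have "mtrace (T * X) = (\<Sum>i<n. \<Sum>j<n. \<Sum>l<N. cnj (t l j) * X $$ (j,i) * t l i)"
    unfolding mtrace_mult[OF assms(1,2)] using assms(3)
    by (intro sum.cong) (auto simp: sum_distrib_left mult_ac)
  also have "\<dots> = (\<Sum>l<N. \<Sum>i<n. \<Sum>j<n. cnj (t l j) * X $$ (j,i) * t l i)"
    by (rule sum_rotate)
  also have "\<dots> = (\<Sum>l<N. qform n X (t l))"
    unfolding qform_def by (intro sum.cong refl sum.swap)
  finally show ?thesis .
qed

lemma mtrace_psd_mult: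
  assumes "psd n T" "psd n X"
  shows "complex_of_real (Re (mtrace (T * X))) = mtrace (T * X)" "Re (mtrace (T * X)) \<ge> 0"
proof -
  obtain t where t: "\<And>i j. i < n \<Longrightarrow> j < n \<Longrightarrow> T $$ (i,j) = (\<Sum>l<n. t l i * cnj (t l j))"
    using psd_gramE[OF assms(1)] by blast
  have e: "mtrace (T * X) = (\<Sum>l<n. qform n X (t l))"
    by (rule mtrace_mult_gram) (use assms t in auto)
  show "Re (mtrace (T * X)) \<ge> 0"
    unfolding e using assms by (auto simp: psd_alt intro!: sum_nonneg)
  show "complex_of_real (Re (mtrace (T * X))) = mtrace (T * X)"
    unfolding e using assms by (auto simp: psd_alt complex_eq_iff)
qed

text \<open>The form is a sum of squares over Gram vectors. If it vanishes at \<open>x\<close>,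
  every Gram vector is orthogonal to \<open>x\<close>, so \<open>x\<close> lies in the kernel,
  against the nonzero determinant. Together with \<open>fullrank_stateI\<close> this replaces
  determinants by definiteness.\<close>

lemma fullrank_qform_pos:
  assumes "fullrank_state n \<sigma>" "i < n" "x i \<noteq> 0"
  shows "Re (qform n \<sigma> x) > 0"
proof (rule ccontr)
  assume neg: "\<not> Re (qform n \<sigma> x) > 0"
  have p: "psd n \<sigma>" and d: "det \<sigma> \<noteq> 0" using assms by (auto simp: fullrank_state_def density_def)
  obtain u where u: "\<And>i j. i < n \<Longrightarrow> j < n \<Longrightarrow> \<sigma> $$ (i,j) = (\<Sum>l<n. u l i * cnj (u l j))"
    using psd_gramE[OF p] by blast
  have "(\<Sum>l<n. (cmod (\<Sum>i<n. cnj (x i) * u l i))^2) \<le> 0"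
    using neg qform_gram[of "{..<n}" n \<sigma> u x] u by simp
  then have "(\<Sum>l<n. (cmod (\<Sum>i<n. cnj (x i) * u l i))^2) = 0"
    by (intro antisym sum_nonneg) auto
  then have "\<forall>l<n. (\<Sum>i<n. cnj (x i) * u l i) = 0"
    by (subst (asm) sum_nonneg_eq_0_iff) auto
  then have "cnj (\<Sum>i<n. cnj (x i) * u l i) = 0" if "l < n" for l
    using that by (simp del: cnj_sum)
  then have z: "(\<Sum>i<n. cnj (u l i) * x i) = 0" if "l < n" for l
    using that by (simp add: mult.commute[of "x _"])
  have "(\<Sum>k<n. \<sigma> $$ (j,k) * x k) = 0" if j: "j < n" for j
  proof -
    have "(\<Sum>k<n. \<sigma> $$ (j,k) * x k) = (\<Sum>k<n. \<Sum>l<n. u l j * (cnj (u l k) * x k))"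
      using u j by (intro sum.cong) (auto simp: sum_distrib_left mult_ac)
    also have "\<dots> = (\<Sum>l<n. u l j * (\<Sum>k<n. cnj (u l k) * x k))"
      by (subst sum.swap) (simp add: sum_distrib_left)
    finally show ?thesis using z by simp
  qed
  then have "\<sigma> *\<^sub>v vec n x = 0\<^sub>v n"
    using psd_carrier[OF p] by (intro eq_vecI) (auto simp: scalar_prod_def lessThan_atLeast0)
  moreover have "vec n x \<noteq> 0\<^sub>v n" using assms(2,3) by (auto simp: vec_eq_iff)
  ultimately show False
    using d det_0_iff_vec_prod_zero_field[OF psd_carrier[OF p]] by (metis vec_carrier)
qed

lemma fullrank_stateI:
  assumes "density n \<sigma>" and pos: "\<And>x i. i < n \<Longrightarrow> x i \<noteq> 0 \<Longrightarrow> Re (qform n \<sigma> x) > 0"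
  shows "fullrank_state n \<sigma>"
proof -
  have c: "\<sigma> \<in> carrier_mat n n" using assms by (simp add: density_def)
  have False if "v \<in> carrier_vec n" "v \<noteq> 0\<^sub>v n" "\<sigma> *\<^sub>v v = 0\<^sub>v n" for v
  proof -
    obtain i where i: "i < n" "v $ i \<noteq> 0"
      using \<open>v \<in> _\<close> \<open>v \<noteq> _\<close> by (auto simp: vec_eq_iff)
    have z: "(\<Sum>k<n. \<sigma> $$ (j,k) * v $ k) = 0" if "j < n" for j
      using arg_cong[OF \<open>\<sigma> *\<^sub>v v = 0\<^sub>v n\<close>, of "\<lambda>w. w $ j"] that c \<open>v \<in> _\<close>
      by (auto simp: scalar_prod_def lessThan_atLeast0)
    have "qform n \<sigma> (\<lambda>i. v $ i) = (\<Sum>j<n. cnj (v $ j) * (\<Sum>k<n. \<sigma> $$ (j,k) * v $ k))"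
      unfolding qform_def by (simp add: sum_distrib_left mult_ac)
    then show False using z pos[OF i(1), of "\<lambda>i. v $ i"] i(2) by simp
  qed
  then have "det \<sigma> \<noteq> 0" using det_0_iff_vec_prod_zero_field[OF c] by blast
  then show ?thesis using assms by (simp add: fullrank_state_def)
qed

text \<open>A full-rank state is faithful: a nonzero effect has a nonzero Gram vector, and the state
  is definite on it.\<close>

lemma mtrace_fullrank_pos:
  assumes T: "psd n T" and X: "fullrank_state n X" and nz: "mtrace T \<noteq> 0"
  shows "Re (mtrace (T * X)) > 0"
proof -
  have pX: "psd n X" using X by (auto simp: fullrank_state_def density_def)
  obtain t where t: "\<And>i j. i < n \<Longrightarrow> j < n \<Longrightarrow> T $$ (i,j) = (\<Sum>l<n. t l i * cnj (t l j))"
    using psd_gramE[OF T] by blast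
  have e: "mtrace (T * X) = (\<Sum>l<n. qform n X (t l))"
    by (rule mtrace_mult_gram) (use T pX t in auto)
  obtain i where i: "i < n" "T $$ (i,i) \<noteq> 0"
    using nz mtrace_carrier[OF psd_carrier[OF T]] by (metis (no_types, lifting) lessThan_iff sum.neutral)
  then obtain l where l: "l < n" "t l i \<noteq> 0"
    using t[OF i(1) i(1)] by (metis (no_types, lifting) lessThan_iff mult_zero_left sum.neutral)
  have "(\<Sum>l<n. Re (qform n X (t l))) > 0"
    using l i fullrank_qform_pos[where x="t l", OF X i(1) l(2)] psd_qform_nonneg[OF pX]
    by (intro sum_pos2[of _ l]) auto
  then show ?thesis unfolding e by simp
qed

text \<open>Measure-and-prepare channels for the two-outcome measurement \<open>(T, 1 - T)\<close>.\<close>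
definition meas_prep :: "nat \<Rightarrow> complex mat \<Rightarrow> complex mat \<Rightarrow> complex mat \<Rightarrow> complex mat \<Rightarrow> complex mat" where
  "meas_prep n T \<tau> \<tau>' X = mtrace (T * X) \<cdot>\<^sub>m \<tau> + mtrace ((1\<^sub>m n - T) * X) \<cdot>\<^sub>m \<tau>'"

lemma sum_split_mult:
  fixes g :: "nat \<Rightarrow> 'a::comm_monoid_add"
  shows "(\<Sum>p<m*n. g p) = (\<Sum>i<m. \<Sum>j<n. g (i*n+j))"
proof -
  have "(\<Sum>j<n. g (i*n+j)) = sum g {i*n..<i*n+n}" for i
    using sum.shift_bounds_nat_ivl[of g 0 "i*n" n] by (simp add: lessThan_atLeast0 add.commute)
  then show ?thesis by (simp add: sum.nat_group)
qed

lemma div_mod_less: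
  fixes p :: nat
  assumes "p < m * n"
  shows "p div n < m" "p mod n < n" "p div n * n + p mod n = p"
  using assms by (auto simp: less_mult_imp_div_less intro!: mod_less_divisor gr0I)

lemma mult_add_less:
  fixes i :: nat
  assumes "i < m" "j < n"
  shows "i * n + j < m * n"
proof -
  have "i * n + j < Suc i * n" using assms by simp
  also have "\<dots> \<le> m * n" using assms by (intro mult_le_mono1) simp
  finally show ?thesis .
qed

text \<open>Complete positivity of one branch. The traces of \<open>T\<close> against the blocks of
  \<open>X\<close> form a Gram matrix in the block indices, with vectors \<open>h l s\<close>;
  tensoring these with the Gram vectors of \<open>\<tau>\<close> gives Gram vectors of the
  output.\<close>

lemma psd_id_tensor_prep:
  assumes T: "psd n T" and \<tau>: "psd m \<tau>" and X: "psd (k*n) X"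
  shows "psd (k*m) (id_tensor k n m (\<lambda>Y. mtrace (T * Y) \<cdot>\<^sub>m \<tau>) X)"
proof -
  obtain t where t: "\<And>i j. i < n \<Longrightarrow> j < n \<Longrightarrow> T $$ (i,j) = (\<Sum>l<n. t l i * cnj (t l j))"
    using psd_gramE[OF T] by blast
  obtain g where g: "\<And>i j. i < m \<Longrightarrow> j < m \<Longrightarrow> \<tau> $$ (i,j) = (\<Sum>l<m. g l i * cnj (g l j))"
    using psd_gramE[OF \<tau>] by blast
  obtain x where x: "\<And>i j. i < k*n \<Longrightarrow> j < k*n \<Longrightarrow> X $$ (i,j) = (\<Sum>l<k*n. x l i * cnj (x l j))"
    using psd_gramE[OF X] by blast
  define h where "h l s a = (\<Sum>c<n. cnj (t l c) * x s (a*n+c))" for l s a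
  have tr: "mtrace (T * Matrix.mat n n (\<lambda>(i,j). X $$ (a*n+i, b*n+j))) =
      (\<Sum>l<n. \<Sum>s<k*n. h l s a * cnj (h l s b))" if ab: "a < k" "b < k" for a b
  proof -
    let ?Y = "Matrix.mat n n (\<lambda>(i,j). X $$ (a*n+i, b*n+j))"
    have "mtrace (T * ?Y) = (\<Sum>l<n. qform n ?Y (t l))"
      by (rule mtrace_mult_gram) (use T t in auto)
    also have "\<dots> = (\<Sum>l<n. \<Sum>s<k*n. h l s a * cnj (h l s b))"
    proof (intro sum.cong refl)
      fix l
      have "qform n ?Y (t l) = (\<Sum>i<n. \<Sum>j<n. \<Sum>s<k*n. (cnj (t l i) * x s (a*n+i)) * cnj (cnj (t l j) * x s (b*n+j)))"
        unfolding qform_def using ab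
        by (intro sum.cong) (auto simp: x mult_add_less sum_distrib_left sum_distrib_right mult_ac)
      also have "\<dots> = (\<Sum>s<k*n. \<Sum>i<n. \<Sum>j<n. (cnj (t l i) * x s (a*n+i)) * cnj (cnj (t l j) * x s (b*n+j)))"
        by (rule sum_rotate)
      also have "\<dots> = (\<Sum>s<k*n. h l s a * cnj (h l s b))"
        unfolding h_def by (simp add: sum_product)
      finally show "qform n ?Y (t l) = (\<Sum>s<k*n. h l s a * cnj (h l s b))" .
    qed
    finally show ?thesis .
  qed
  define v where "v = (\<lambda>((l,s),r) p. h l s (p div m) * g r (p mod m))"
  show ?thesis
  proof (rule psd_gramI[where I="({..<n} \<times> {..<k*n}) \<times> {..<m}" and u=v])
    fix p q assume pq: "p < k*m" "q < k*m"
    note d = div_mod_less[OF pq(1)] div_mod_less[OF pq(2)]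
    have "id_tensor k n m (\<lambda>Y. mtrace (T * Y) \<cdot>\<^sub>m \<tau>) X $$ (p,q) =
      (\<Sum>l<n. \<Sum>s<k*n. h l s (p div m) * cnj (h l s (q div m))) * (\<Sum>r<m. g r (p mod m) * cnj (g r (q mod m)))"
      using pq d carrier_matD[OF psd_carrier[OF \<tau>]] by (simp add: id_tensor_def tr g)
    also have "\<dots> = (\<Sum>l\<in>({..<n} \<times> {..<k*n}) \<times> {..<m}. v l p * cnj (v l q))"
      unfolding sum.cartesian_product sum_product
      by (intro sum.cong) (auto simp: v_def mult_ac)
    finally show "id_tensor k n m (\<lambda>Y. mtrace (T * Y) \<cdot>\<^sub>m \<tau>) X $$ (p,q) =
      (\<Sum>l\<in>({..<n} \<times> {..<k*n}) \<times> {..<m}. v l p * cnj (v l q))" .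
  qed (auto simp: id_tensor_def)
qed

lemma meas_prep_density:
  assumes T: "psd n T" "psd n (1\<^sub>m n - T)" and \<tau>: "density m \<tau>" "density m \<tau>'" and X: "density n X"
  shows "density m (meas_prep n T \<tau> \<tau>' X)"
proof -
  have pX: "psd n X" using X by (simp add: density_def)
  have c: "T \<in> carrier_mat n n" "X \<in> carrier_mat n n" "\<tau> \<in> carrier_mat m m" "\<tau>' \<in> carrier_mat m m"
    using T \<tau> X by (auto simp: density_def)
  have t: "mtrace (T * X) + mtrace ((1\<^sub>m n - T) * X) = 1"
  proof -
    have "mtrace (T * X) + mtrace ((1\<^sub>m n - T) * X) = mtrace ((T + (1\<^sub>m n - T)) * X)"
      using c by (subst add_mult_distrib_mat[of _ n n _ _ n]) (auto intro!: mtrace_add[of _ n, symmetric])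
    also have "T + (1\<^sub>m n - T) = 1\<^sub>m n" using c by (intro eq_matI) auto
    finally show ?thesis using X c by (simp add: density_def)
  qed
  have "psd m (meas_prep n T \<tau> \<tau>' X)"
    unfolding meas_prep_def
    using psd_smult[of m \<tau> "Re (mtrace (T * X))"] psd_smult[of m \<tau>' "Re (mtrace ((1\<^sub>m n - T) * X))"]
      mtrace_psd_mult[OF T(1) pX] mtrace_psd_mult[OF T(2) pX] \<tau>
    by (intro psd_add) (auto simp: density_def)
  moreover have "mtrace (meas_prep n T \<tau> \<tau>' X) = 1"
    unfolding meas_prep_def using c \<tau> t
    by (simp add: mtrace_add[of _ m] mtrace_smult[of _ m] density_def)
  ultimately show ?thesis by (simp add: density_def)
qed

lemma meas_prep_channel:
  assumes T: "psd n T" "psd n (1\<^sub>m n - T)" and \<tau>: "density m \<tau>" "density m \<tau>'"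
  shows "channel n m (meas_prep n T \<tau> \<tau>')"
proof -
  have c: "T \<in> carrier_mat n n" "1\<^sub>m n - T \<in> carrier_mat n n" "\<tau> \<in> carrier_mat m m" "\<tau>' \<in> carrier_mat m m"
    using T \<tau> by (auto simp: density_def)
  have TT: "T + (1\<^sub>m n - T) = 1\<^sub>m n" using c by (intro eq_matI) auto
  show ?thesis unfolding channel_def
  proof (intro conjI ballI allI impI)
    fix X :: "complex mat" assume X: "X \<in> carrier_mat n n"
    show "meas_prep n T \<tau> \<tau>' X \<in> carrier_mat m m" using c by (simp add: meas_prep_def)
    have "mtrace (T * X) + mtrace ((1\<^sub>m n - T) * X) = mtrace X"
      using c X TT by (subst mtrace_add[symmetric, of _ n], auto simp flip: add_mult_distrib_mat)
    then show "mtrace (meas_prep n T \<tau> \<tau>' X) = mtrace X"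
      unfolding meas_prep_def using c \<tau> by (simp add: mtrace_add[of _ m] mtrace_smult[of _ m] density_def)
    show "meas_prep n T \<tau> \<tau>' (z \<cdot>\<^sub>m X) = z \<cdot>\<^sub>m meas_prep n T \<tau> \<tau>' X" for z
      unfolding meas_prep_def using c X
      by (intro eq_matI)
        (auto simp: mult_smult_distrib[of _ n n _ n] mtrace_smult[of _ n] algebra_simps)
    fix Y :: "complex mat" assume Y: "Y \<in> carrier_mat n n"
    show "meas_prep n T \<tau> \<tau>' (X + Y) = meas_prep n T \<tau> \<tau>' X + meas_prep n T \<tau> \<tau>' Y"
      unfolding meas_prep_def using c X Y
      by (intro eq_matI)
        (auto simp: mult_add_distrib_mat[of _ n n _ n] mtrace_add[of _ n] algebra_simps)
  next
    fix k X assume X: "psd (k*n) X"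
    have "id_tensor k n m (meas_prep n T \<tau> \<tau>') X = id_tensor k n m (\<lambda>Y. mtrace (T * Y) \<cdot>\<^sub>m \<tau>) X
      + id_tensor k n m (\<lambda>Y. mtrace ((1\<^sub>m n - T) * Y) \<cdot>\<^sub>m \<tau>') X"
      using c by (intro eq_matI) (auto simp: id_tensor_def meas_prep_def dest: div_mod_less)
    then show "psd (k*m) (id_tensor k n m (meas_prep n T \<tau> \<tau>') X)"
      using psd_id_tensor_prep[OF T(1) _ X, of m \<tau>] psd_id_tensor_prep[OF T(2) _ X, of m \<tau>'] \<tau>
      by (auto simp: density_def intro: psd_add)
  qed
qed

text \<open>The trace condition says that \<open>1 - T\<close> is nonzero, so on a full-rank input
  the second outcome has positive probability and contributes a positive multiple of the full-rank
  \<open>\<tau>'\<close>. The state \<open>\<tau>\<close> may then be arbitrary, in particular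
  pure.\<close>

lemma meas_prep_channel_F:
  assumes T: "psd n T" "psd n (1\<^sub>m n - T)" and nz: "mtrace T \<noteq> of_nat n"
    and \<tau>: "density m \<tau>" "fullrank_state m \<tau>'"
  shows "channel_F n m (meas_prep n T \<tau> \<tau>')"
  unfolding channel_F_def
proof (intro conjI allI impI)
  have \<tau>': "density m \<tau>'" using \<tau> by (simp add: fullrank_state_def)
  show "channel n m (meas_prep n T \<tau> \<tau>')" using meas_prep_channel[OF T \<tau>(1) \<tau>'] .
  fix \<sigma> assume \<sigma>: "fullrank_state n \<sigma>"
  then have d: "density n \<sigma>" and p: "psd n \<sigma>" by (auto simp: fullrank_state_def density_def)
  have "mtrace (1\<^sub>m n - T) = of_nat n - mtrace T"
    using psd_carrier[OF T(1)] by (auto simp: mtrace_def sum_subtractf)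
  then have pos: "Re (mtrace ((1\<^sub>m n - T) * \<sigma>)) > 0"
    using mtrace_fullrank_pos[OF T(2) \<sigma>] nz by simp
  show "fullrank_state m (meas_prep n T \<tau> \<tau>' \<sigma>)"
  proof (rule fullrank_stateI[OF meas_prep_density[OF T \<tau>(1) \<tau>' d]])
    fix x :: "nat \<Rightarrow> complex" and i assume i: "i < m" "x i \<noteq> 0"
    have "qform m (meas_prep n T \<tau> \<tau>' \<sigma>) x =
      complex_of_real (Re (mtrace (T * \<sigma>))) * qform m \<tau> x + complex_of_real (Re (mtrace ((1\<^sub>m n - T) * \<sigma>))) * qform m \<tau>' x"
      unfolding meas_prep_def mtrace_psd_mult[OF T(1) p] mtrace_psd_mult[OF T(2) p]
      using \<tau>(1) \<tau>' by (simp add: qform_add qform_smult density_def)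
    moreover have "0 \<le> Re (mtrace (T * \<sigma>)) * Re (qform m \<tau> x)"
      using mtrace_psd_mult(2)[OF T(1) p] psd_qform_nonneg \<tau>(1) by (simp add: density_def)
    moreover have "0 < Re (mtrace ((1\<^sub>m n - T) * \<sigma>)) * Re (qform m \<tau>' x)"
      using pos fullrank_qform_pos[where x=x, OF \<tau>(2) i] by simp
    ultimately show "Re (qform m (meas_prep n T \<tau> \<tau>' \<sigma>) x) > 0" by simp
  qed
qed

section \<open>Unitary conjugation\<close>

lemma conj_entry:
  assumes "U \<in> carrier_mat n n" "X \<in> carrier_mat n n" "i < n" "j < n"
  shows "(U * X * adj U) $$ (i,j) = (\<Sum>b<n. \<Sum>a<n. U $$ (i,a) * X $$ (a,b) * cnj (U $$ (j,b)))"
  using assms by (simp add: mult_mat_entry[of _ n n _ n] sum_distrib_right del: index_mult_mat)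

lemma psd_conj:
  assumes U: "U \<in> carrier_mat n n" and X: "psd n X"
  shows "psd n (U * X * adj U)"
proof -
  obtain x where x: "\<And>i j. i < n \<Longrightarrow> j < n \<Longrightarrow> X $$ (i,j) = (\<Sum>l<n. x l i * cnj (x l j))"
    using psd_gramE[OF X] by blast
  show ?thesis
  proof (rule psd_gramI[where I="{..<n}" and u="\<lambda>s i. \<Sum>a<n. U $$ (i,a) * x s a"])
    fix i j assume ij: "i < n" "j < n"
    have "(U * X * adj U) $$ (i,j) = (\<Sum>b<n. \<Sum>a<n. \<Sum>s<n. (U $$ (i,a) * x s a) * cnj (U $$ (j,b) * x s b))"
      unfolding conj_entry[OF U psd_carrier[OF X] ij]
      by (intro sum.cong) (auto simp: x sum_distrib_left sum_distrib_right mult_ac)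
    also have "\<dots> = (\<Sum>s<n. \<Sum>b<n. \<Sum>a<n. (U $$ (i,a) * x s a) * cnj (U $$ (j,b) * x s b))"
      by (rule sum_rotate)
    also have "\<dots> = (\<Sum>s<n. (\<Sum>a<n. U $$ (i,a) * x s a) * cnj (\<Sum>b<n. U $$ (j,b) * x s b))"
      by (intro sum.cong refl, subst sum.swap) (simp add: sum_product)
    finally show "(U * X * adj U) $$ (i,j) = \<dots>" .
  qed (use U X in auto)
qed

text \<open>Serves twice: for the passage to the eigenbasis of sigma, and with \<open>U\<close> the
  identity as the channel that regroups one system into two or two into one.\<close>

lemma unitary_conj_channel_F:
  assumes U: "unitary n U"
  shows "channel_F n n (\<lambda>X. U * X * adj U)"
proof -
  have Uc: "U \<in> carrier_mat n n" using unitary_carrier[OF U] .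
  have tr: "mtrace (U * X * adj U) = mtrace X" if X: "X \<in> carrier_mat n n" for X
  proof -
    have "mtrace (U * X * adj U) = mtrace (adj U * (U * X))" using Uc X by (intro mtrace_comm) auto
    also have "adj U * (U * X) = (adj U * U) * X" using Uc X by (simp add: assoc_mult_mat[of _ n n _ n _ n])
    finally show ?thesis using U X by (simp add: unitary_def)
  qed
  show ?thesis unfolding channel_F_def channel_def
  proof (intro conjI ballI allI impI)
    fix X :: "complex mat" assume X: "X \<in> carrier_mat n n"
    show "U * X * adj U \<in> carrier_mat n n" using Uc X by simp
    show "mtrace (U * X * adj U) = mtrace X" using tr[OF X] .
    show "U * (z \<cdot>\<^sub>m X) * adj U = z \<cdot>\<^sub>m (U * X * adj U)" for z
      using Uc X by (simp add: mult_smult_distrib[of _ n n _ n] mult_smult_assoc_mat[of _ n n _ n])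
    fix Y :: "complex mat" assume Y: "Y \<in> carrier_mat n n"
    show "U * (X + Y) * adj U = U * X * adj U + U * Y * adj U"
      using Uc X Y by (simp add: mult_add_distrib_mat[of _ n n _ n] add_mult_distrib_mat[of _ n n _ _ n])
  next
    fix k X assume X: "psd (k*n) X"
    obtain x where x: "\<And>i j. i < k*n \<Longrightarrow> j < k*n \<Longrightarrow> X $$ (i,j) = (\<Sum>l<k*n. x l i * cnj (x l j))"
      using psd_gramE[OF X] by blast
    show "psd (k*n) (id_tensor k n n (\<lambda>X. U * X * adj U) X)"
    proof (rule psd_gramI[where I="{..<k*n}" and u="\<lambda>s p. \<Sum>a<n. U $$ (p mod n,a) * x s (p div n * n + a)"])
      fix p q assume pq: "p < k*n" "q < k*n"
      note d = div_mod_less[OF pq(1)] div_mod_less[OF pq(2)]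
      have "id_tensor k n n (\<lambda>X. U * X * adj U) X $$ (p,q) = (\<Sum>b<n. \<Sum>a<n. \<Sum>s<k*n.
          (U $$ (p mod n,a) * x s (p div n * n + a)) * cnj (U $$ (q mod n,b) * x s (q div n * n + b)))"
        using pq d by (simp add: id_tensor_def conj_entry[OF Uc] del: index_mult_mat)
          (intro sum.cong refl, simp add: x mult_add_less, simp add: sum_distrib_left mult_ac)
      also have "\<dots> = (\<Sum>s<k*n. \<Sum>b<n. \<Sum>a<n.
          (U $$ (p mod n,a) * x s (p div n * n + a)) * cnj (U $$ (q mod n,b) * x s (q div n * n + b)))"
        by (rule sum_rotate)
      also have "\<dots> = (\<Sum>s<k*n. (\<Sum>a<n. U $$ (p mod n,a) * x s (p div n * n + a)) *
          cnj (\<Sum>b<n. U $$ (q mod n,b) * x s (q div n * n + b)))"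
        by (intro sum.cong refl, subst sum.swap) (simp add: sum_product)
      finally show "id_tensor k n n (\<lambda>X. U * X * adj U) X $$ (p,q) = \<dots>" .
    qed (auto simp: id_tensor_def)
  next
    fix \<sigma> assume \<sigma>: "fullrank_state n \<sigma>"
    then have p: "psd n \<sigma>" and c: "\<sigma> \<in> carrier_mat n n" by (auto simp: fullrank_state_def density_def)
    have "det U * det (adj U) = 1"
      using det_mult[OF Uc adj_carrier[OF Uc]] unitary_right[OF U] by simp
    then have "det U \<noteq> 0" "det (adj U) \<noteq> 0" by auto
    then show "fullrank_state n (U * \<sigma> * adj U)"
      using \<sigma> psd_conj[OF Uc p] tr[OF c] Uc c
      by (simp add: fullrank_state_def density_def det_mult[of _ n])
  qed
qed

section \<open>Tensor powers and typical sets\<close>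

lemma kron_carrier [simp]:
  "A \<in> carrier_mat n1 m1 \<Longrightarrow> B \<in> carrier_mat n2 m2 \<Longrightarrow> kron A B \<in> carrier_mat (n1*n2) (m1*m2)"
  by (auto simp: kron_def)

lemma kron_entry:
  assumes "A \<in> carrier_mat n1 m1" "B \<in> carrier_mat n2 m2" "i < n1*n2" "j < m1*m2"
  shows "kron A B $$ (i,j) = A $$ (i div n2, j div m2) * B $$ (i mod n2, j mod m2)"
  using assms by (auto simp: kron_def)

lemma kron_entry':
  assumes "A \<in> carrier_mat n1 m1" "B \<in> carrier_mat n2 m2" "i < n1" "j < m1" "a < n2" "b < m2"
  shows "kron A B $$ (i*n2+a, j*m2+b) = A $$ (i,j) * B $$ (a,b)"
  using assms by (subst kron_entry[OF assms(1,2)]) (auto simp: mult_add_less)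

lemma kron_mult:
  assumes c: "A \<in> carrier_mat n n" "C \<in> carrier_mat n n" "B \<in> carrier_mat m m" "D \<in> carrier_mat m m"
  shows "kron A B * kron C D = kron (A * C) (B * D)"
proof (rule eq_matI)
  have c': "kron A B \<in> carrier_mat (n*m) (n*m)" "kron C D \<in> carrier_mat (n*m) (n*m)" using c by auto
  fix i j assume "i < dim_row (kron (A * C) (B * D))" "j < dim_col (kron (A * C) (B * D))"
  then have ij: "i < n*m" "j < n*m" using c by (auto simp: kron_def)
  note d = div_mod_less[OF ij(1)] div_mod_less[OF ij(2)]
  have "(kron A B * kron C D) $$ (i,j) = (\<Sum>k<n*m. kron A B $$ (i,k) * kron C D $$ (k,j))"
    by (rule mult_mat_entry[OF c' ij])
  also have "\<dots> = (\<Sum>a<n. \<Sum>b<m. (A $$ (i div m, a) * C $$ (a, j div m)) * (B $$ (i mod m, b) * D $$ (b, j mod m)))"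
    unfolding sum_split_mult
  proof (intro sum.cong refl)
    fix a b assume "a \<in> {..<n}" "b \<in> {..<m}"
    then show "kron A B $$ (i, a * m + b) * kron C D $$ (a * m + b, j) =
      (A $$ (i div m, a) * C $$ (a, j div m)) * (B $$ (i mod m, b) * D $$ (b, j mod m))"
      using kron_entry[OF c(1,3) ij(1), of "a*m+b"] kron_entry[OF c(2,4) _ ij(2), of "a*m+b"]
      by (simp add: mult_add_less)
  qed
  also have "\<dots> = (\<Sum>a<n. A $$ (i div m, a) * C $$ (a, j div m)) * (\<Sum>b<m. B $$ (i mod m, b) * D $$ (b, j mod m))"
    by (simp add: sum_product)
  also have "\<dots> = kron (A * C) (B * D) $$ (i,j)"
    using c ij d by (simp add: kron_entry[of _ n n _ m m] mult_mat_entry[of _ n n _ n] mult_mat_entry[of _ m m _ m] del: index_mult_mat)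
  finally show "(kron A B * kron C D) $$ (i,j) = kron (A * C) (B * D) $$ (i,j)" .
qed (use c in \<open>auto simp: kron_def\<close>)

lemma adj_kron: "adj (kron A B) = kron (adj A) (adj B)"
proof (rule eq_matI)
  fix i j assume "i < dim_row (kron (adj A) (adj B))" "j < dim_col (kron (adj A) (adj B))"
  then have ij: "i < dim_col A * dim_col B" "j < dim_row A * dim_row B" by (auto simp: kron_def adj_def)
  then show "adj (kron A B) $$ (i,j) = kron (adj A) (adj B) $$ (i,j)"
    using div_mod_less[OF ij(1)] div_mod_less[OF ij(2)] by (simp add: kron_def adj_def)
qed (auto simp: kron_def adj_def)

lemma kron_diag:
  "kron (mat_diag n f) (mat_diag m g) = mat_diag (n*m) (\<lambda>p. f (p div m) * g (p mod m))"
proof (rule eq_matI)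
  fix i j assume "i < dim_row (mat_diag (n*m) (\<lambda>p. f (p div m) * g (p mod m)))"
    "j < dim_col (mat_diag (n*m) (\<lambda>p. f (p div m) * g (p mod m)))"
  then have ij: "i < n*m" "j < n*m" by (auto simp: mat_diag_def)
  have "i = j \<longleftrightarrow> i div m = j div m \<and> i mod m = j mod m"
    by (metis div_mult_mod_eq)
  then show "kron (mat_diag n f) (mat_diag m g) $$ (i,j) = mat_diag (n*m) (\<lambda>p. f (p div m) * g (p mod m)) $$ (i,j)"
    using ij div_mod_less[OF ij(1)] div_mod_less[OF ij(2)]
    by (auto simp: kron_entry[of _ n n _ m m] mat_diag_def)
qed (auto simp: kron_def mat_diag_def)

lemma mtrace_kron:
  assumes "A \<in> carrier_mat n n" "B \<in> carrier_mat m m"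
  shows "mtrace (kron A B) = mtrace A * mtrace B"
  using assms kron_carrier[OF assms] unfolding mtrace_carrier[OF assms(1)] mtrace_carrier[OF assms(2)]
  by (subst mtrace_carrier[of _ "n*m"], simp)
    (simp add: sum_split_mult sum_product kron_entry'[OF assms])

lemma density_carrier: "density n \<rho> \<Longrightarrow> \<rho> \<in> carrier_mat n n"
  by (simp add: density_def)

lemma psd_kron:
  assumes "psd n A" "psd m B"
  shows "psd (n*m) (kron A B)"
proof -
  obtain u where u: "\<And>i j. i < n \<Longrightarrow> j < n \<Longrightarrow> A $$ (i,j) = (\<Sum>l<n. u l i * cnj (u l j))"
    using psd_gramE[OF assms(1)] by blast
  obtain v where v: "\<And>i j. i < m \<Longrightarrow> j < m \<Longrightarrow> B $$ (i,j) = (\<Sum>l<m. v l i * cnj (v l j))"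
    using psd_gramE[OF assms(2)] by blast
  define w where "w = (\<lambda>(l,r) p. u l (p div m) * v r (p mod m))"
  show ?thesis
  proof (rule psd_gramI[where I="{..<n} \<times> {..<m}" and u=w])
    fix i j assume ij: "i < n*m" "j < n*m"
    have "kron A B $$ (i,j) = (\<Sum>l<n. u l (i div m) * cnj (u l (j div m))) * (\<Sum>l<m. v l (i mod m) * cnj (v l (j mod m)))"
      using assms div_mod_less[OF ij(1)] div_mod_less[OF ij(2)] ij by (simp add: kron_entry[of _ n n _ m m] u v)
    also have "\<dots> = (\<Sum>l\<in>{..<n} \<times> {..<m}. w l i * cnj (w l j))"
      unfolding sum_product sum.cartesian_product by (intro sum.cong) (auto simp: w_def mult_ac)
    finally show "kron A B $$ (i,j) = (\<Sum>l\<in>{..<n} \<times> {..<m}. w l i * cnj (w l j))" .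
  qed (use assms in auto)
qed

lemma density_kron: "density n A \<Longrightarrow> density m B \<Longrightarrow> density (n*m) (kron A B)"
  by (simp add: density_def psd_kron mtrace_kron[of _ n _ m])

lemma kron_one_right:
  assumes "A \<in> carrier_mat n n"
  shows "kron A (1\<^sub>m 1) = A"
  by (rule eq_matI) (use assms in \<open>auto simp: kron_def\<close>)

lemma ptrace2_one: "X \<in> carrier_mat n n \<Longrightarrow> ptrace2 n 1 X = X"
  by (rule eq_matI) (auto simp: ptrace2_def)

lemma ptrace1_one:
  assumes "X \<in> carrier_mat n n" "mtrace X = 1"
  shows "ptrace1 n 1 X = 1\<^sub>m 1"
  by (rule eq_matI) (use assms in \<open>auto simp: ptrace1_def mtrace_carrier\<close>)

lemma ptrace_carrier [simp]:
  "ptrace2 n m X \<in> carrier_mat n n" "ptrace1 n m X \<in> carrier_mat m m"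
  by (auto simp: ptrace1_def ptrace2_def)

lemma ptrace2_kron:
  assumes "A \<in> carrier_mat n n" "B \<in> carrier_mat m m" "mtrace B = 1"
  shows "ptrace2 n m (kron A B) = A"
  by (rule eq_matI)
    (use assms in \<open>auto simp: ptrace2_def kron_entry'[of _ n n _ m m] mtrace_carrier[of _ m] simp flip: sum_distrib_left\<close>)

lemma ptrace1_kron:
  assumes "A \<in> carrier_mat n n" "B \<in> carrier_mat m m" "mtrace A = 1"
  shows "ptrace1 n m (kron A B) = B"
  by (rule eq_matI)
    (use assms in \<open>auto simp: ptrace1_def kron_entry'[of _ n n _ m m] mtrace_carrier[of _ n] simp flip: sum_distrib_right\<close>)

lemma density_ptrace2:
  assumes "density (n*m) X"
  shows "density n (ptrace2 n m X)"
proof -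
  have X: "psd (n*m) X" "X \<in> carrier_mat (n*m) (n*m)" using assms by (auto simp: density_def)
  obtain u where u: "\<And>i j. i < n*m \<Longrightarrow> j < n*m \<Longrightarrow> X $$ (i,j) = (\<Sum>l<n*m. u l i * cnj (u l j))"
    using psd_gramE[OF X(1)] by blast
  have "psd n (ptrace2 n m X)"
    by (rule psd_gramI[where I="{..<m} \<times> {..<n*m}" and u="\<lambda>x i. u (snd x) (i*m + fst x)"])
      (auto simp: ptrace2_def u mult_add_less sum.cartesian_product case_prod_beta)
  moreover have "mtrace (ptrace2 n m X) = mtrace X"
    by (simp add: mtrace_carrier[OF X(2)] sum_split_mult) (simp add: ptrace2_def mtrace_def)
  ultimately show ?thesis using assms by (simp add: density_def)
qed

lemma density_ptrace1:
  assumes "density (n*m) X"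
  shows "density m (ptrace1 n m X)"
proof -
  have X: "psd (n*m) X" "X \<in> carrier_mat (n*m) (n*m)" using assms by (auto simp: density_def)
  obtain u where u: "\<And>i j. i < n*m \<Longrightarrow> j < n*m \<Longrightarrow> X $$ (i,j) = (\<Sum>l<n*m. u l i * cnj (u l j))"
    using psd_gramE[OF X(1)] by blast
  have "psd m (ptrace1 n m X)"
    by (rule psd_gramI[where I="{..<n} \<times> {..<n*m}" and u="\<lambda>x i. u (snd x) (fst x * m + i)"])
      (auto simp: ptrace1_def u mult_add_less sum.cartesian_product case_prod_beta)
  moreover have "mtrace (ptrace1 n m X) = mtrace X"
    by (simp add: mtrace_carrier[OF X(2)] sum_split_mult sum.swap[of _ "{..<m}"]) (simp add: ptrace1_def mtrace_def sum.swap[of _ "{..<m}"])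
  ultimately show ?thesis using assms by (simp add: density_def)
qed

section \<open>Tensor powers and product weights on words\<close>

primrec kpow :: "complex mat \<Rightarrow> nat \<Rightarrow> complex mat" where
  "kpow A 0 = 1\<^sub>m 1"
| "kpow A (Suc k) = kron A (kpow A k)"

text \<open>An index below \<open>n^k\<close> is a word of k letters, namely its base-n digits with
  the leading digit first, which is the index convention of \<open>kron\<close>.
  \<open>tprod\<close> multiplies the values of \<open>g\<close> along the word and
  \<open>tsum\<close> adds them.\<close>

primrec tprod :: "nat \<Rightarrow> (nat \<Rightarrow> 'a::comm_semiring_1) \<Rightarrow> nat \<Rightarrow> nat \<Rightarrow> 'a" where
  "tprod n g 0 p = 1"
| "tprod n g (Suc k) p = g (p div n^k) * tprod n g k (p mod n^k)"

primrec tsum :: "nat \<Rightarrow> (nat \<Rightarrow> real) \<Rightarrow> nat \<Rightarrow> nat \<Rightarrow> real" where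
  "tsum n g 0 p = 0"
| "tsum n g (Suc k) p = g (p div n^k) + tsum n g k (p mod n^k)"

lemma kpow_carrier [simp]: "A \<in> carrier_mat n n \<Longrightarrow> kpow A k \<in> carrier_mat (n^k) (n^k)"
  by (induction k) auto

lemma kpow_mult:
  assumes "A \<in> carrier_mat n n" "B \<in> carrier_mat n n"
  shows "kpow (A * B) k = kpow A k * kpow B k"
proof (induction k)
  case (Suc k)
  then show ?case using assms by (simp add: kron_mult[of _ n _ _ "n^k"])
qed simp

lemma adj_kpow: "adj (kpow A k) = kpow (adj A) k"
  by (induction k) (simp_all add: adj_kron)

lemma kpow_diag: "kpow (mat_diag n g) k = mat_diag (n^k) (tprod n g k)"
proof (induction k)
  case 0
  then show ?case by (auto simp: mat_diag_def)
qed (simp add: kron_diag)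

lemma tprod_one: "tprod n (\<lambda>_. 1) k p = 1"
  by (induction k arbitrary: p) auto

lemma unitary_kpow:
  assumes "unitary n U"
  shows "unitary (n^k) (kpow U k)"
proof -
  have "kpow (1\<^sub>m n) k = 1\<^sub>m (n^k)"
    using kpow_diag[of n "\<lambda>_. 1" k] by (simp add: tprod_one[abs_def])
  then show ?thesis
    using assms by (simp add: unitary_def adj_kpow flip: kpow_mult[of _ n])
qed

lemma density_kpow: "density n A \<Longrightarrow> density (n^k) (kpow A k)"
proof (induction k)
  case 0
  have "density 1 (1\<^sub>m 1)" unfolding density_def
    by (auto simp: mtrace_def intro!: psd_gramI[where I="{..<1::nat}" and u="\<lambda>_ _. 1"])
  then show ?case by simp
qed (simp add: density_kron)

lemma of_real_tprod: "complex_of_real (tprod n g k p) = tprod n (\<lambda>i. complex_of_real (g i)) k p"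
  by (induction k arbitrary: p) auto

text \<open>The spectrum of the k-th power is the product law of \<open>d\<close> on words, so
  statements about independent letters apply to eigenvalues.\<close>

lemma kpow_conj_diag:
  assumes U: "unitary n U"
  shows "kpow (U * mat_diag n (\<lambda>i. complex_of_real (d i)) * adj U) k =
    kpow U k * mat_diag (n^k) (\<lambda>p. complex_of_real (tprod n d k p)) * adj (kpow U k)"
  using unitary_carrier[OF U]
  by (simp add: kpow_mult[of _ n] kpow_diag adj_kpow of_real_tprod del: mat_diag_diag)

lemma tprod_nonneg:
  fixes g :: "nat \<Rightarrow> real"
  assumes "\<And>i. i < n \<Longrightarrow> g i \<ge> 0" "p < n^k"
  shows "tprod n g k p \<ge> 0"
  using assms(2)
proof (induction k arbitrary: p)
  case (Suc k)
  then show ?case using assms(1) div_mod_less[of p n "n^k"] by simp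
qed simp

lemma tprod_pos:
  fixes g :: "nat \<Rightarrow> real"
  assumes "\<And>i. i < n \<Longrightarrow> g i > 0" "p < n^k"
  shows "tprod n g k p > 0"
  using assms(2)
proof (induction k arbitrary: p)
  case (Suc k)
  then show ?case using assms(1) div_mod_less[of p n "n^k"] by simp
qed simp

lemma sum_tprod_Suc:
  fixes g :: "nat \<Rightarrow> 'a::comm_semiring_1"
  shows "(\<Sum>p<n^Suc k. tprod n g (Suc k) p * F (p div n^k) (p mod n^k)) =
    (\<Sum>i<n. \<Sum>b<n^k. g i * tprod n g k b * F i b)"
  unfolding power_Suc sum_split_mult by (intro sum.cong refl) simp

lemma sum_tprod:
  fixes g :: "nat \<Rightarrow> 'a::comm_semiring_1"
  shows "(\<Sum>p<n^k. tprod n g k p) = (\<Sum>i<n. g i)^k"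
proof (induction k)
  case (Suc k)
  show ?case using sum_tprod_Suc[of n g k "\<lambda>_ _. 1"] Suc
    by (simp add: sum_product[symmetric] mult.commute del: tprod.simps)
qed simp

text \<open>Positivity is asked of the product of the whole word only, because eigenvalues of rho
  may vanish; with nonnegative factors it forces every letter of this word to have positive
  weight.\<close>

lemma ln_tprod:
  assumes "tprod n g k p > 0" "\<And>i. i < n \<Longrightarrow> g i \<ge> 0" "p < n^k"
  shows "ln (tprod n g k p) = tsum n (\<lambda>i. ln (g i)) k p"
  using assms
proof (induction k arbitrary: p)
  case (Suc k)
  note d = div_mod_less[of p n "n^k"]
  have g: "g (p div n^k) \<ge> 0" "tprod n g k (p mod n^k) \<ge> 0"
    using Suc.prems d tprod_nonneg[of n g "p mod n^k" k] by auto
  then have "g (p div n^k) > 0" "tprod n g k (p mod n^k) > 0"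
    using Suc.prems(1) by (auto simp: zero_less_mult_iff)
  then show ?case using Suc.IH[of "p mod n^k"] Suc.prems d by (simp add: ln_mult)
qed simp

lemma tsum_shift: "tsum n (\<lambda>i. g i - c) k p = tsum n g k p - real k * c"
  by (induction k arbitrary: p) (auto simp: algebra_simps)

lemma sum_tprod_tsum:
  fixes w :: "nat \<Rightarrow> real"
  assumes "(\<Sum>i<n. w i) = 1" "(\<Sum>i<n. w i * g i) = 0"
  shows "(\<Sum>p<n^k. tprod n w k p * tsum n g k p) = 0"
proof (induction k)
  case (Suc k)
  have "(\<Sum>p<n^Suc k. tprod n w (Suc k) p * tsum n g (Suc k) p) =
    (\<Sum>i<n. \<Sum>b<n^k. w i * tprod n w k b * (g i + tsum n g k b))"
    using sum_tprod_Suc[of n w k "\<lambda>i b. g i + tsum n g k b"] by simp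
  also have "\<dots> = (\<Sum>i<n. w i * g i) * (\<Sum>b<n^k. tprod n w k b)
      + (\<Sum>i<n. w i) * (\<Sum>b<n^k. tprod n w k b * tsum n g k b)"
    unfolding sum_product sum.distrib[symmetric] by (intro sum.cong refl) (simp add: algebra_simps)
  finally show ?case using Suc assms by simp
qed simp

text \<open>Additivity of the variance: the cross term vanishes by \<open>sum_tprod_tsum\<close>, as
  the letters are independent and centred.\<close>

lemma sum_tprod_tsum_sq:
  fixes w :: "nat \<Rightarrow> real"
  assumes "(\<Sum>i<n. w i) = 1" "(\<Sum>i<n. w i * g i) = 0"
  shows "(\<Sum>p<n^k. tprod n w k p * (tsum n g k p)\<^sup>2) = real k * (\<Sum>i<n. w i * (g i)\<^sup>2)"
proof (induction k)
  case (Suc k)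
  have "(\<Sum>p<n^Suc k. tprod n w (Suc k) p * (tsum n g (Suc k) p)\<^sup>2) =
    (\<Sum>i<n. \<Sum>b<n^k. w i * tprod n w k b * (g i + tsum n g k b)\<^sup>2)"
    using sum_tprod_Suc[of n w k "\<lambda>i b. (g i + tsum n g k b)\<^sup>2"] by simp
  also have "\<dots> = (\<Sum>i<n. w i * (g i)\<^sup>2) * (\<Sum>b<n^k. tprod n w k b)
      + (\<Sum>i<n. 2 * (w i * g i)) * (\<Sum>b<n^k. tprod n w k b * tsum n g k b)
      + (\<Sum>i<n. w i) * (\<Sum>b<n^k. tprod n w k b * (tsum n g k b)\<^sup>2)"
    unfolding sum_product sum.distrib[symmetric]
    by (intro sum.cong refl) (simp add: algebra_simps power2_eq_square)
  finally show ?case using Suc assms sum_tprod_tsum[OF assms] sum_tprod[of n w k]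
    by (simp add: algebra_simps)
qed simp

section \<open>Weak law of large numbers\<close>

lemma chebyshev_tprod:
  fixes w g :: "nat \<Rightarrow> real" and \<mu> \<delta> :: real
  assumes w: "\<And>i. i < n \<Longrightarrow> w i \<ge> 0" "(\<Sum>i<n. w i) = 1" and \<mu>: "\<mu> = (\<Sum>i<n. w i * g i)"
    and \<delta>: "\<delta> > 0" and k: "k > 0"
  shows "(\<Sum>p | p < n^k \<and> \<bar>tsum n g k p - k * \<mu>\<bar> > k * \<delta>. tprod n w k p)
    \<le> (\<Sum>i<n. w i * (g i - \<mu>)\<^sup>2) / (k * \<delta>\<^sup>2)"
proof -
  let ?B = "{p. p < n^k \<and> \<bar>tsum n g k p - k * \<mu>\<bar> > k * \<delta>}"
  let ?g = "\<lambda>i. g i - \<mu>"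
  have c: "(\<Sum>i<n. w i * ?g i) = 0"
    using w(2) by (simp add: right_diff_distrib sum_subtractf \<mu> flip: sum_distrib_right)
  have "(k * \<delta>)\<^sup>2 * (\<Sum>p\<in>?B. tprod n w k p) \<le> (\<Sum>p\<in>?B. tprod n w k p * (tsum n ?g k p)\<^sup>2)"
    unfolding sum_distrib_left
  proof (intro sum_mono)
    fix p assume p: "p \<in> ?B"
    then have "(k * \<delta>)\<^sup>2 \<le> (tsum n ?g k p)\<^sup>2"
      using \<delta> unfolding tsum_shift by (subst abs_le_square_iff[symmetric]) auto
    moreover have "tprod n w k p \<ge> 0" using p w by (intro tprod_nonneg) auto
    ultimately show "(k * \<delta>)\<^sup>2 * tprod n w k p \<le> tprod n w k p * (tsum n ?g k p)\<^sup>2"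
      by (simp add: mult.commute mult_left_mono)
  qed
  also have "\<dots> \<le> (\<Sum>p<n^k. tprod n w k p * (tsum n ?g k p)\<^sup>2)"
    using tprod_nonneg[of n w] w by (intro sum_mono2) auto
  also have "\<dots> = k * (\<Sum>i<n. w i * (?g i)\<^sup>2)" by (rule sum_tprod_tsum_sq[OF w(2) c])
  finally show ?thesis using \<delta> k by (simp add: field_simps power2_eq_square)
qed

text \<open>The Chebyshev bound has the fixed single-letter variance over
  \<open>k * \<delta>\<^sup>2\<close> and hence tends to zero.\<close>

lemma typical_set:
  fixes w g :: "nat \<Rightarrow> real" and \<mu> \<delta> \<eta> :: real
  assumes w: "\<And>i. i < n \<Longrightarrow> w i \<ge> 0" "(\<Sum>i<n. w i) = 1" and \<mu>: "\<mu> = (\<Sum>i<n. w i * g i)"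
    and \<delta>: "\<delta> > 0" and \<eta>: "\<eta> > 0"
  shows "\<forall>\<^sub>F k in sequentially. (\<Sum>p | p < n^k \<and> \<bar>tsum n g k p - k * \<mu>\<bar> > k * \<delta>. tprod n w k p) \<le> \<eta>"
proof -
  let ?v = "\<Sum>i<n. w i * (g i - \<mu>)\<^sup>2"
  have "(\<lambda>k. ?v / (real k * \<delta>\<^sup>2)) \<longlonglongrightarrow> 0"
    using tendsto_mult[OF tendsto_const[of "?v / \<delta>\<^sup>2"] lim_inverse_n] by (simp add: field_simps)
  then have "\<forall>\<^sub>F k in sequentially. ?v / (real k * \<delta>\<^sup>2) < \<eta>"
    using \<eta> by (auto simp: order_tendsto_iff)
  then show ?thesis using eventually_gt_at_top[of 0]
  proof eventually_elim
    case (elim k)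
    then show ?case using chebyshev_tprod[OF w \<mu> \<delta>, of k] by (meson less_le_trans less_imp_le order_trans)
  qed
qed

lemma qform_diag: "qform n (mat_diag n (\<lambda>i. complex_of_real (e i))) x = complex_of_real (\<Sum>i<n. e i * (cmod (x i))\<^sup>2)"
proof -
  have "qform n (mat_diag n (\<lambda>i. complex_of_real (e i))) x =
    (\<Sum>i<n. \<Sum>j<n. if j = i then complex_of_real (e i) * (x i * cnj (x i)) else 0)"
    unfolding qform_def by (intro sum.cong refl) (auto simp: mat_diag_def mult_ac)
  also have "\<dots> = complex_of_real (\<Sum>i<n. e i * (cmod (x i))\<^sup>2)"
    by (simp add: complex_norm_square del: of_real_power)
  finally show ?thesis .
qed

lemma density_diag:
  assumes "\<And>i. i < n \<Longrightarrow> e i \<ge> 0" "(\<Sum>i<n. e i) = 1"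
  shows "density n (mat_diag n (\<lambda>i. complex_of_real (e i)))"
proof -
  have "mtrace (mat_diag n (\<lambda>i. complex_of_real (e i))) = complex_of_real (\<Sum>i<n. e i)"
    by (simp add: mtrace_def mat_diag_def)
  then show ?thesis unfolding density_def using assms
    by (auto simp: qform_diag intro!: psdI sum_nonneg) (auto simp: mat_diag_def)
qed

lemma fullrank_diag:
  assumes "\<And>i. i < n \<Longrightarrow> e i > 0" "(\<Sum>i<n. e i) = 1"
  shows "fullrank_state n (mat_diag n (\<lambda>i. complex_of_real (e i)))"
proof (rule fullrank_stateI)
  show "density n (mat_diag n (\<lambda>i. complex_of_real (e i)))"
    using assms by (intro density_diag) (auto intro: less_imp_le)
  fix x :: "nat \<Rightarrow> complex" and i assume "i < n" "x i \<noteq> 0"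
  then show "Re (qform n (mat_diag n (\<lambda>i. complex_of_real (e i))) x) > 0"
    unfolding qform_diag using assms by (auto intro!: sum_pos2[of _ i] simp: less_imp_le)
qed

section \<open>One-shot compression and testing\<close>

lemma wgram_sqrt:
  fixes u :: "nat \<Rightarrow> nat \<Rightarrow> complex"
  assumes "\<And>l. l \<in> I \<Longrightarrow> c l \<ge> 0"
  shows "(\<Sum>l\<in>I. complex_of_real (c l) * (u l i * cnj (u l j))) =
    (\<Sum>l\<in>I. (sqrt (c l) * u l i) * cnj (sqrt (c l) * u l j))"
proof (intro sum.cong refl)
  fix l assume "l \<in> I"
  then have "complex_of_real (c l) = complex_of_real (sqrt (c l)) * complex_of_real (sqrt (c l))"
    using assms by (simp flip: of_real_mult)
  then show "complex_of_real (c l) * (u l i * cnj (u l j)) = (sqrt (c l) * u l i) * cnj (sqrt (c l) * u l j)"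
    by simp
qed

text \<open>Keeping the weights outside the squares allows eigenvalues to be replaced by a uniform
  bound termwise.\<close>

lemma qform_wgram:
  fixes u :: "nat \<Rightarrow> nat \<Rightarrow> complex"
  assumes "finite I" "\<And>l. l \<in> I \<Longrightarrow> c l \<ge> 0"
    "\<And>i j. i < n \<Longrightarrow> j < n \<Longrightarrow> A $$ (i,j) = (\<Sum>l\<in>I. complex_of_real (c l) * (u l i * cnj (u l j)))"
  shows "Re (qform n A x) = (\<Sum>l\<in>I. c l * (cmod (\<Sum>i<n. cnj (x i) * u l i))\<^sup>2)"
proof -
  have "qform n A x = complex_of_real (\<Sum>l\<in>I. (cmod (\<Sum>i<n. cnj (x i) * (sqrt (c l) * u l i)))\<^sup>2)"
    using qform_gram[OF assms(1) trans[OF assms(3) wgram_sqrt[OF assms(2)]]] .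
  also have "(\<Sum>l\<in>I. (cmod (\<Sum>i<n. cnj (x i) * (sqrt (c l) * u l i)))\<^sup>2) =
      (\<Sum>l\<in>I. c l * (cmod (\<Sum>i<n. cnj (x i) * u l i))\<^sup>2)"
  proof (intro sum.cong refl)
    fix l assume l: "l \<in> I"
    have "(\<Sum>i<n. cnj (x i) * (sqrt (c l) * u l i)) = sqrt (c l) * (\<Sum>i<n. cnj (x i) * u l i)"
      by (simp add: sum_distrib_left mult_ac)
    then show "(cmod (\<Sum>i<n. cnj (x i) * (sqrt (c l) * u l i)))\<^sup>2 = c l * (cmod (\<Sum>i<n. cnj (x i) * u l i))\<^sup>2"
      using assms(2)[OF l] by (simp add: norm_mult power_mult_distrib)
  qed
  finally show ?thesis by simp
qed

lemma psd_wgramI: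
  fixes u :: "nat \<Rightarrow> nat \<Rightarrow> complex"
  assumes "A \<in> carrier_mat n n" "finite I" "\<And>l. l \<in> I \<Longrightarrow> c l \<ge> 0"
    "\<And>i j. i < n \<Longrightarrow> j < n \<Longrightarrow> A $$ (i,j) = (\<Sum>l\<in>I. complex_of_real (c l) * (u l i * cnj (u l j)))"
  shows "psd n A"
  using psd_gramI[OF assms(1,2) trans[OF assms(4) wgram_sqrt[OF assms(3)]]] .

lemma qform_one: "qform n (1\<^sub>m n) x = complex_of_real (\<Sum>i<n. (cmod (x i))\<^sup>2)"
  using qform_diag[of n "\<lambda>_. 1" x] by (simp del: of_real_sum of_real_power)

text \<open>The identity matrix has the columns of \<open>U\<close> as Gram vectors; both sides
  compute its quadratic form.\<close>

lemma parseval: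
  assumes "unitary n U"
  shows "(\<Sum>k<n. (cmod (\<Sum>i<n. cnj (x i) * U $$ (i,k)))\<^sup>2) = (\<Sum>i<n. (cmod (x i))\<^sup>2)"
proof -
  have "qform n (1\<^sub>m n) x = complex_of_real (\<Sum>k<n. (cmod (\<Sum>i<n. cnj (x i) * U $$ (i,k)))\<^sup>2)"
    by (rule qform_gram) (auto simp: unitary_row_sum[OF assms])
  then show ?thesis unfolding qform_one of_real_eq_iff by (rule sym)
qed

lemma unitary_col_norm:
  assumes "unitary n U" "k < n"
  shows "(\<Sum>i<n. (cmod (U $$ (i,k)))\<^sup>2) = 1"
proof -
  have "complex_of_real (\<Sum>i<n. (cmod (U $$ (i,k)))\<^sup>2) = (\<Sum>i<n. cnj (U $$ (i,k)) * U $$ (i,k))"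
    by (simp only: of_real_sum complex_norm_square mult.commute)
  also have "\<dots> = 1" using unitary_col_sum[OF assms(1) assms(2) assms(2)] by simp
  finally show ?thesis by (simp only: of_real_eq_1_iff)
qed

lemma conj_diag_wgram:
  assumes "U \<in> carrier_mat n n" "i < n" "j < n"
  shows "(U * mat_diag n (\<lambda>k. complex_of_real (p k)) * adj U) $$ (i,j) =
    (\<Sum>k<n. complex_of_real (p k) * ((\<lambda>k i. U $$ (i,k)) k i * cnj ((\<lambda>k i. U $$ (i,k)) k j)))"
  using conj_diag_entry[OF assms, of "\<lambda>k. complex_of_real (p k)"] by simp

lemma Re_conj_diag:
  assumes "U \<in> carrier_mat n n" "i < n"
  shows "Re ((U * mat_diag n (\<lambda>k. complex_of_real (p k)) * adj U) $$ (i,i)) =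
    (\<Sum>k<n. p k * (cmod (U $$ (i,k)))\<^sup>2)"
  unfolding conj_diag_wgram[OF assms assms(2)]
  by (simp add: complex_norm_square[symmetric] del: of_real_power flip: of_real_mult)

lemma am_gm_weighted:
  fixes a b t :: real
  assumes "t > 0"
  shows "a * b \<le> (a\<^sup>2 / t + t * b\<^sup>2) / 2"
proof -
  have "0 \<le> (a - t * b)\<^sup>2 / t" using assms by simp
  also have "\<dots> = a\<^sup>2 / t + t * b\<^sup>2 - 2 * (a * b)" using assms by (simp add: field_simps power2_eq_square)
  finally show ?thesis by simp
qed

text \<open>With \<open>Q\<close> the coordinate projection onto \<open>S\<close> and \<open>M'\<close> the part of \<open>M\<close> spanned by the eigenvectors
  in \<open>A\<close>, the witness is \<open>R = Q M' Q / mtrace (Q M' Q)\<close>.\<close>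
lemma oneshot_state:
  fixes p e :: "nat \<Rightarrow> real" and N :: nat
  defines "\<sigma> \<equiv> mat_diag N (\<lambda>i. complex_of_real (e i))"
  assumes W: "unitary N W" and p: "\<And>x. x < N \<Longrightarrow> p x \<ge> 0" "(\<Sum>x<N. p x) = 1"
    and M: "M = W * mat_diag N (\<lambda>x. complex_of_real (p x)) * adj W"
    and A: "A \<subseteq> {..<N}" "(\<Sum>x\<in>{..<N}-A. p x) \<le> \<eta>" "\<And>x. x \<in> A \<Longrightarrow> p x \<le> P"
    and S: "S \<subseteq> {..<N}" "(\<Sum>y\<in>{..<N}-S. Re (M $$ (y,y))) \<le> \<eta>" "\<And>y. y \<in> S \<Longrightarrow> 1 \<le> L * e y"
    and e: "\<And>y. y < N \<Longrightarrow> e y \<ge> 0" and P: "P \<ge> 0" and L: "L \<ge> 0" and \<eta>: "\<eta> < 1/2" and t: "t > 0"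
  shows "\<exists>R \<alpha>. density N R \<and> (\<forall>z. Re (qform N R z) \<le> P * L / (1 - 2*\<eta>) * Re (qform N \<sigma> z)) \<and>
    (\<forall>y<N. \<alpha> y \<ge> 0) \<and> (\<forall>y<N. \<forall>y'<N. cmod (R $$ (y,y') - M $$ (y,y')) \<le> \<alpha> y + \<alpha> y') \<and>
    2 * (\<Sum>y<N. \<alpha> y) \<le> 3 * \<eta> + \<eta> / t + t"
proof -
  have Wc: "W \<in> carrier_mat N N" using unitary_carrier[OF W] .
  define w where "w x y = (cmod (W $$ (y,x)))\<^sup>2" for x y
  have w0: "w x y \<ge> 0" for x y unfolding w_def by simp
  \<comment> \<open>\<open>w x y\<close> is the overlap of eigenvector \<open>x\<close> with basis
    vector \<open>y\<close>; \<open>p x * w x y\<close> is thus a joint law whose y-marginal is the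
    diagonal of \<open>M\<close>, and both tail hypotheses are read as events under it.\<close>
  have w1: "(\<Sum>y<N. w x y) = 1" if "x < N" for x unfolding w_def using unitary_col_norm[OF W that] .
  have Mdiag: "Re (M $$ (y,y)) = (\<Sum>x<N. p x * w x y)" if "y < N" for y
    unfolding M w_def using Re_conj_diag[OF Wc that] .
  define a where "a x = (if x \<in> A then 1 else 0 :: real)" for x
  define s where "s y = (if y \<in> S then 1 else 0 :: real)" for y
  have as: "0 \<le> a x" "a x \<le> 1" "0 \<le> s x" "s x \<le> 1" "s x * s x = s x" for x by (auto simp: a_def s_def)
  define u where "u x y = complex_of_real (s y) * W $$ (y,x)" for x y
  \<comment> \<open>\<open>r\<close> is Q M' Q before normalisation, \<open>g\<close> is its
    diagonal and \<open>c\<close> its trace.\<close>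
  define r where "r y y' = (\<Sum>x<N. complex_of_real (p x * a x) * (u x y * cnj (u x y')))" for y y'
  define g where "g y = (\<Sum>x<N. p x * a x * (s y * w x y))" for y
  have pa: "p x * a x \<ge> 0" if "x < N" for x using p(1)[OF that] as by simp
  have g0: "g y \<ge> 0" for y unfolding g_def using as w0 by (intro sum_nonneg mult_nonneg_nonneg[OF pa]) auto
  have rdiag: "r y y = complex_of_real (g y)" for y
  proof -
    have "u x y * cnj (u x y) = complex_of_real (s y * w x y)" for x
    proof -
      have "u x y * cnj (u x y) = complex_of_real ((cmod (u x y))\<^sup>2)" by (simp only: complex_norm_square)
      also have "(cmod (u x y))\<^sup>2 = s y * w x y" using as(5)[of y]
        by (simp add: u_def w_def norm_mult power_mult_distrib power2_eq_square)
      finally show ?thesis .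
    qed
    then show ?thesis unfolding r_def g_def by simp
  qed
  define c where "c = (\<Sum>y<N. g y)"
  have total: "(\<Sum>y<N. \<Sum>x<N. p x * w x y) = 1"
  proof -
    have "(\<Sum>y<N. \<Sum>x<N. p x * w x y) = (\<Sum>x<N. p x * (\<Sum>y<N. w x y))"
      by (subst sum.swap) (simp add: sum_distrib_left)
    then show ?thesis using w1 p(2) by simp
  qed
  have badA: "(\<Sum>y<N. \<Sum>x<N. p x * w x y * (1 - a x)) \<le> \<eta>"
  proof -
    have "(\<Sum>y<N. \<Sum>x<N. p x * w x y * (1 - a x)) = (\<Sum>x<N. p x * (1 - a x) * (\<Sum>y<N. w x y))"
      by (subst sum.swap) (simp add: sum_distrib_left mult_ac)
    also have "\<dots> = (\<Sum>x<N. if x \<in> {..<N} - A then p x else 0)"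
      using w1 by (intro sum.cong) (auto simp: a_def)
    also have "\<dots> = (\<Sum>x\<in>{..<N} - A. p x)" by (rule sum.mono_neutral_cong_right) auto
    finally show ?thesis using A(2) by simp
  qed
  have badS: "(\<Sum>y<N. \<Sum>x<N. p x * w x y * (1 - s y)) \<le> \<eta>"
  proof -
    have "(\<Sum>y<N. \<Sum>x<N. p x * w x y * (1 - s y)) = (\<Sum>y<N. if y \<in> {..<N} - S then Re (M $$ (y,y)) else 0)"
      by (intro sum.cong refl) (auto simp: s_def Mdiag)
    also have "\<dots> = (\<Sum>y\<in>{..<N} - S. Re (M $$ (y,y)))" by (rule sum.mono_neutral_cong_right) auto
    finally show ?thesis using S(2) by simp
  qed
  \<comment> \<open>A union bound: the discarded weight is at most the sum of the weights outside
    \<open>A\<close> and outside \<open>S\<close>.\<close>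
  have c1: "c \<ge> 1 - 2*\<eta>"
  proof -
    have "1 - c = (\<Sum>y<N. \<Sum>x<N. p x * w x y * (1 - a x * s y))"
    proof -
      have "(\<Sum>y<N. \<Sum>x<N. p x * w x y * (1 - a x * s y)) = (\<Sum>y<N. \<Sum>x<N. p x * w x y) - c"
        unfolding c_def g_def sum_subtractf[symmetric] by (intro sum.cong refl) (simp add: algebra_simps)
      then show ?thesis using total by simp
    qed
    also have "\<dots> \<le> (\<Sum>y<N. \<Sum>x<N. p x * w x y * (1 - a x) + p x * w x y * (1 - s y))"
    proof (intro sum_mono)
      fix y x assume "x \<in> {..<N}"
      have "1 - a x * s y \<le> (1 - a x) + (1 - s y)" by (auto simp: a_def s_def)
      then show "p x * w x y * (1 - a x * s y) \<le> p x * w x y * (1 - a x) + p x * w x y * (1 - s y)"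
        using p(1) w0 \<open>x \<in> _\<close> unfolding distrib_left[symmetric] by (intro mult_left_mono) auto
    qed
    also have "\<dots> \<le> \<eta> + \<eta>" using badA badS by (simp add: sum.distrib)
    finally show ?thesis by simp
  qed
  then have cpos: "c > 0" using \<eta> by simp
  have c2: "c \<le> 1"
  proof -
    have "c \<le> (\<Sum>y<N. \<Sum>x<N. p x * w x y)" unfolding c_def g_def
    proof (intro sum_mono)
      fix y x assume "x \<in> {..<N}"
      have "p x * w x y * (a x * s y) \<le> p x * w x y * 1"
        using p(1) w0 \<open>x \<in> _\<close> by (intro mult_left_mono) (auto simp: a_def s_def)
      then show "p x * a x * (s y * w x y) \<le> p x * w x y" by (simp add: mult_ac)
    qed
    then show ?thesis using total by simp
  qed
  define R where "R = Matrix.mat N N (\<lambda>(y,y'). r y y' / complex_of_real c)"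
  have Rent: "R $$ (y,y') = (\<Sum>x<N. complex_of_real (p x * a x / c) * (u x y * cnj (u x y')))"
    if "y < N" "y' < N" for y y' using that by (simp add: R_def r_def sum_divide_distrib)
  have Rc: "R \<in> carrier_mat N N" by (simp add: R_def)
  have pac: "p x * a x / c \<ge> 0" if "x < N" for x using pa[OF that] cpos by simp
  have "psd N R" by (rule psd_wgramI[OF Rc _ _ Rent]) (use pac in auto)
  moreover have "mtrace R = 1"
  proof -
    have "mtrace R = (\<Sum>y<N. complex_of_real (g y) / complex_of_real c)"
      unfolding mtrace_carrier[OF Rc] by (intro sum.cong refl) (simp add: R_def rdiag)
    also have "\<dots> = complex_of_real c / complex_of_real c"
      by (simp only: sum_divide_distrib[symmetric] of_real_sum[symmetric] c_def)
    finally show ?thesis using cpos by simp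
  qed
  ultimately have 1: "density N R" by (simp add: density_def)
  have 2: "Re (qform N R z) \<le> P * L / (1 - 2*\<eta>) * Re (qform N \<sigma> z)" for z
  proof -
    have "Re (qform N R z) = (\<Sum>x<N. p x * a x / c * (cmod (\<Sum>y<N. cnj (z y) * u x y))\<^sup>2)"
      by (rule qform_wgram[OF _ _ Rent]) (use pac in auto)
    also have "\<dots> \<le> (\<Sum>x<N. P / c * (cmod (\<Sum>y<N. cnj (s y * z y) * W $$ (y,x)))\<^sup>2)"
    proof (intro sum_mono)
      fix x assume x: "x \<in> {..<N}"
      have "p x * a x \<le> P" using A(3) P by (auto simp: a_def)
      then have "p x * a x / c \<le> P / c" using cpos by (simp add: divide_right_mono)
      moreover have "(\<Sum>y<N. cnj (z y) * u x y) = (\<Sum>y<N. cnj (s y * z y) * W $$ (y,x))"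
        unfolding u_def by (intro sum.cong refl) simp
      ultimately show "p x * a x / c * (cmod (\<Sum>y<N. cnj (z y) * u x y))\<^sup>2
        \<le> P / c * (cmod (\<Sum>y<N. cnj (s y * z y) * W $$ (y,x)))\<^sup>2"
        by (simp only: mult_right_mono zero_le_power2)
    qed
    also have "\<dots> = P / c * (\<Sum>y<N. (cmod (s y * z y))\<^sup>2)"
      using parseval[OF W, of "\<lambda>y. complex_of_real (s y) * z y"] by (simp only: sum_distrib_left[symmetric])
    also have "\<dots> \<le> P / c * (\<Sum>y<N. L * (e y * (cmod (z y))\<^sup>2))"
    proof (intro mult_left_mono sum_mono)
      fix y assume y: "y \<in> {..<N}"
      show "(cmod (s y * z y))\<^sup>2 \<le> L * (e y * (cmod (z y))\<^sup>2)"
      proof (cases "y \<in> S")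
        case True
        then have "1 * (cmod (z y))\<^sup>2 \<le> (L * e y) * (cmod (z y))\<^sup>2" using S(3) by (intro mult_right_mono) auto
        then show ?thesis using True by (simp add: s_def mult_ac)
      qed (use L e y in \<open>auto simp: s_def\<close>)
    qed (use P cpos in auto)
    also have "\<dots> = P * L / c * Re (qform N \<sigma> z)"
      unfolding \<sigma>_def qform_diag by (simp flip: sum_distrib_left)
    also have "\<dots> \<le> P * L / (1 - 2*\<eta>) * Re (qform N \<sigma> z)"
    proof (rule mult_right_mono)
      show "P * L / c \<le> P * L / (1 - 2*\<eta>)" using c1 \<eta> P L by (intro divide_left_mono) auto
      show "0 \<le> Re (qform N \<sigma> z)" unfolding \<sigma>_def qform_diag using e by (auto intro!: sum_nonneg)
    qed
    finally show ?thesis .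
  qed
  \<comment> \<open>The first term pays for the normalisation, \<open>1 - a x\<close> for the
    eigenvectors dropped, and the rest for the coordinates dropped. An off-diagonal entry with only
    one index outside \<open>S\<close> is a product of a small and a large amplitude; AM-GM with
    weight \<open>t\<close> splits it into \<open>1/t\<close> times the small and \<open>t\<close>
    times the large probability. Its total \<open>\<eta> / t + t\<close> is of order
    \<open>sqrt \<eta>\<close> at the best \<open>t\<close>, as in gentle measurement.\<close>
  define \<alpha> where "\<alpha> y = (1/c - 1) / 2 * g y + (\<Sum>x<N. p x * w x y * ((1 - a x) + (1 - s y) / t + t)) / 2" for y
  have c3: "1/c - 1 \<ge> 0" using c2 cpos by simp
  have 3: "\<alpha> y \<ge> 0" for y
    unfolding \<alpha>_def using c3 g0 p(1) w0 as t by (intro add_nonneg_nonneg mult_nonneg_nonneg divide_nonneg_nonneg sum_nonneg) auto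
  have amgm1: "cmod (z * cnj z') \<le> ((cmod z)\<^sup>2 + (cmod z')\<^sup>2) / 2" for z z'
    using am_gm_weighted[of 1 "cmod z" "cmod z'"] by (simp add: norm_mult)
  have 4: "cmod (R $$ (y,y') - M $$ (y,y')) \<le> \<alpha> y + \<alpha> y'" if y: "y < N" "y' < N" for y y'
  proof -
    have usq: "(cmod (u x z))\<^sup>2 = s z * w x z" for x z using as(5)[of z]
        by (simp add: u_def w_def norm_mult power_mult_distrib power2_eq_square)
    have "cmod (R $$ (y,y') - r y y') = (1/c - 1) * cmod (r y y')"
    proof -
      have "R $$ (y,y') - r y y' = complex_of_real (1/c - 1) * r y y'"
        using y cpos by (simp add: R_def field_simps)
      then show ?thesis using c3 by (simp only: norm_mult norm_of_real abs_of_nonneg)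
    qed
    also have "\<dots> \<le> (1/c - 1) * ((g y + g y') / 2)"
    proof (rule mult_left_mono[OF _ c3])
      have "cmod (r y y') \<le> (\<Sum>x<N. cmod (complex_of_real (p x * a x) * (u x y * cnj (u x y'))))"
        unfolding r_def by (rule norm_sum)
      also have "\<dots> \<le> (\<Sum>x<N. p x * a x * ((s y * w x y + s y' * w x y') / 2))"
      proof (intro sum_mono)
        fix x assume "x \<in> {..<N}"
        then have "cmod (complex_of_real (p x * a x) * (u x y * cnj (u x y'))) = p x * a x * cmod (u x y * cnj (u x y'))"
          using pa by (simp only: norm_mult norm_of_real lessThan_iff abs_of_nonneg)
        also have "\<dots> \<le> p x * a x * ((s y * w x y + s y' * w x y') / 2)"
          using amgm1[of "u x y" "u x y'"] pa \<open>x \<in> _\<close> by (intro mult_left_mono) (auto simp: usq)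
        finally show "cmod (complex_of_real (p x * a x) * (u x y * cnj (u x y'))) \<le> \<dots>" .
      qed
      also have "\<dots> = (g y + g y') / 2"
        unfolding g_def sum.distrib[symmetric] sum_divide_distrib by (intro sum.cong refl) (simp add: algebra_simps)
      finally show "cmod (r y y') \<le> (g y + g y') / 2" .
    qed
    also have "\<dots> = (1/c - 1) / 2 * g y + (1/c - 1) / 2 * g y'"
    proof -
      have "z * ((b + b') / 2) = z / 2 * b + z / 2 * b'" for z b b' :: real by (simp add: field_simps)
      then show ?thesis .
    qed
    finally have b1: "cmod (R $$ (y,y') - r y y') \<le> (1/c - 1) / 2 * g y + (1/c - 1) / 2 * g y'" .
    let ?h = "\<lambda>x y. p x * w x y * ((1 - a x) + (1 - s y) / t + t)"
    have "r y y' - M $$ (y,y') =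
      (\<Sum>x<N. complex_of_real (- (p x * (1 - a x * s y * s y'))) * (W $$ (y,x) * cnj (W $$ (y',x))))"
      unfolding r_def M conj_diag_wgram[OF Wc y] sum_subtractf[symmetric]
      by (intro sum.cong refl) (simp add: u_def algebra_simps)
    also have "cmod \<dots> \<le> (\<Sum>x<N. cmod (complex_of_real (- (p x * (1 - a x * s y * s y'))) * (W $$ (y,x) * cnj (W $$ (y',x)))))"
      by (rule norm_sum)
    also have "\<dots> \<le> (\<Sum>x<N. ?h x y / 2 + ?h x y' / 2)"
    proof (intro sum_mono)
      fix x assume x: "x \<in> {..<N}"
      let ?k = "1 - a x * s y * s y'" and ?m = "cmod (W $$ (y,x)) * cmod (W $$ (y',x))"
      have k0: "?k \<ge> 0" by (auto simp: a_def s_def)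
      \<comment> \<open>The factor \<open>?k\<close> is 0 or 1. When it is 1, the three bounds serve
        respectively the cases \<open>x\<close> outside \<open>A\<close>, \<open>y\<close> outside
        \<open>S\<close>, and \<open>y'\<close> outside \<open>S\<close>.\<close>
      have m: "?m \<le> (w x y + w x y') / 2" "?m \<le> (w x y / t + t * w x y') / 2" "?m \<le> (w x y' / t + t * w x y) / 2"
        using am_gm_weighted[of 1 "cmod (W $$ (y,x))" "cmod (W $$ (y',x))"]
          am_gm_weighted[OF t, of "cmod (W $$ (y,x))" "cmod (W $$ (y',x))"]
          am_gm_weighted[OF t, of "cmod (W $$ (y',x))" "cmod (W $$ (y,x))"] by (simp_all add: w_def mult_ac)
      have nn: "w x y / t \<ge> 0" "w x y' / t \<ge> 0" "t * w x y \<ge> 0" "t * w x y' \<ge> 0" "w x y \<ge> 0" "w x y' \<ge> 0"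
        using t w0 by auto
      have "?k * ?m \<le> (w x y * ((1 - a x) + (1 - s y) / t + t) + w x y' * ((1 - a x) + (1 - s y') / t + t)) / 2"
        using m nn by (auto simp: a_def s_def algebra_simps)
      then have "p x * (?k * ?m) \<le> p x * ((w x y * ((1 - a x) + (1 - s y) / t + t) + w x y' * ((1 - a x) + (1 - s y') / t + t)) / 2)"
        using p(1) x by (intro mult_left_mono) auto
      moreover have "cmod (complex_of_real (- (p x * ?k)) * (W $$ (y,x) * cnj (W $$ (y',x)))) = p x * (?k * ?m)"
        using p(1) x k0 by (simp only: norm_mult norm_of_real complex_mod_cnj abs_minus_cancel abs_mult abs_of_nonneg lessThan_iff mult.assoc)
      moreover have "q * ((b * h + b' * h') / 2) = q * b * h / 2 + q * b' * h' / 2" for q b h b' h' :: real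
        by (simp add: field_simps)
      ultimately show "cmod (complex_of_real (- (p x * ?k)) * (W $$ (y,x) * cnj (W $$ (y',x)))) \<le> ?h x y / 2 + ?h x y' / 2"
        by (simp only:)
    qed
    also have "\<dots> = (\<Sum>x<N. ?h x y) / 2 + (\<Sum>x<N. ?h x y') / 2"
      by (simp only: sum.distrib sum_divide_distrib)
    finally have b2: "cmod (r y y' - M $$ (y,y')) \<le> (\<Sum>x<N. ?h x y) / 2 + (\<Sum>x<N. ?h x y') / 2" .
    have "cmod (R $$ (y,y') - M $$ (y,y')) \<le> cmod (R $$ (y,y') - r y y') + cmod (r y y' - M $$ (y,y'))"
      using norm_triangle_ineq[of "R $$ (y,y') - r y y'" "r y y' - M $$ (y,y')"] by simp
    then show ?thesis using b1 b2 unfolding \<alpha>_def by linarith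
  qed
  have 5: "2 * (\<Sum>y<N. \<alpha> y) \<le> 3 * \<eta> + \<eta> / t + t"
  proof -
    have "2 * (\<Sum>y<N. \<alpha> y) = (\<Sum>y<N. (1/c - 1) * g y + ((\<Sum>x<N. p x * w x y * (1 - a x)) +
       (\<Sum>x<N. p x * w x y * (1 - s y)) / t + (\<Sum>x<N. p x * w x y) * t))"
      unfolding sum_distrib_left
    proof (intro sum.cong refl)
      fix y
      have h: "(\<Sum>x<N. p x * w x y * ((1 - a x) + (1 - s y) / t + t)) = (\<Sum>x<N. p x * w x y * (1 - a x)) +
       (\<Sum>x<N. p x * w x y * (1 - s y)) / t + (\<Sum>x<N. p x * w x y) * t"
        unfolding sum_divide_distrib sum_distrib_right sum.distrib[symmetric]
        by (intro sum.cong refl) (simp only: distrib_left times_divide_eq_right)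
      have "2 * (z / 2 * b + k / 2) = z * b + k" for z b k :: real by (simp add: field_simps)
      then show "2 * \<alpha> y = (1/c - 1) * g y + ((\<Sum>x<N. p x * w x y * (1 - a x)) +
       (\<Sum>x<N. p x * w x y * (1 - s y)) / t + (\<Sum>x<N. p x * w x y) * t)"
        unfolding \<alpha>_def h .
    qed
    also have "\<dots> = (1/c - 1) * c + ((\<Sum>y<N. \<Sum>x<N. p x * w x y * (1 - a x)) +
       (\<Sum>y<N. \<Sum>x<N. p x * w x y * (1 - s y)) / t + (\<Sum>y<N. \<Sum>x<N. p x * w x y) * t)"
      by (simp only: sum.distrib c_def sum_distrib_left sum_distrib_right sum_divide_distrib)
    also have "\<dots> \<le> 2 * \<eta> + (\<eta> + \<eta> / t + 1 * t)"
    proof (intro add_mono)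
      have "(1/c - 1) * c = 1 - c" using cpos by (simp add: left_diff_distrib)
      then show "(1/c - 1) * c \<le> 2 * \<eta>" using c1 by linarith
      show "(\<Sum>y<N. \<Sum>x<N. p x * w x y * (1 - s y)) / t \<le> \<eta> / t" using badS t by (intro divide_right_mono) auto
    qed (use badA total in auto)
    finally show ?thesis by simp
  qed
  show ?thesis using 1 2 3 4 5 by blast
qed

text \<open>The witness is \<open>T = Q E Q\<close>, where \<open>E\<close> projects onto the span of the eigenvectors in \<open>A\<close>.\<close>
lemma oneshot_test:
  fixes p e :: "nat \<Rightarrow> real" and N :: nat
  defines "\<sigma> \<equiv> mat_diag N (\<lambda>i. complex_of_real (e i))"
  assumes W: "unitary N W" and p: "\<And>x. x < N \<Longrightarrow> p x \<ge> 0" "(\<Sum>x<N. p x) = 1"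
    and M: "M = W * mat_diag N (\<lambda>x. complex_of_real (p x)) * adj W"
    and A: "A \<subseteq> {..<N}" "(\<Sum>x\<in>{..<N}-A. p x) \<le> \<eta>" "\<And>x. x \<in> A \<Longrightarrow> 1 \<le> P * p x"
    and S: "S \<subseteq> {..<N}" "(\<Sum>y\<in>{..<N}-S. Re (M $$ (y,y))) \<le> \<eta>" "\<And>y. y \<in> S \<Longrightarrow> e y \<le> L"
    and P: "P \<ge> 0" and L: "L \<ge> 0"
  shows "\<exists>T. psd N T \<and> psd N (1\<^sub>m N - T) \<and> Re (mtrace (T * M)) \<ge> 1 - 4 * \<eta> \<and>
    Re (mtrace (T * \<sigma>)) \<le> P * L"
proof -
  have Wc: "W \<in> carrier_mat N N" using unitary_carrier[OF W] .
  have Mc: "M \<in> carrier_mat N N" unfolding M using Wc by auto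
  define w where "w x y = (cmod (W $$ (y,x)))\<^sup>2" for x y
  have w0: "w x y \<ge> 0" for x y unfolding w_def by simp
  have w1: "(\<Sum>y<N. w x y) = 1" if "x < N" for x unfolding w_def using unitary_col_norm[OF W that] .
  have Mdiag: "Re (M $$ (y,y)) = (\<Sum>x<N. p x * w x y)" if "y < N" for y
    unfolding M w_def using Re_conj_diag[OF Wc that] .
  have finA: "finite A" using A(1) finite_subset by blast
  \<comment> \<open>The Gram vectors of Q E Q: the eigenvectors in \<open>A\<close>, each cut down
    to the coordinates in \<open>S\<close>.\<close>
  define t where "t x y = (if x \<in> A \<and> y \<in> S then W $$ (y,x) else 0)" for x y
  define T where "T = Matrix.mat N N (\<lambda>(i,j). \<Sum>x<N. t x i * cnj (t x j))"
  have Tc: "T \<in> carrier_mat N N" by (simp add: T_def)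
  have Tent: "T $$ (i,j) = (\<Sum>x<N. t x i * cnj (t x j))" if "i < N" "j < N" for i j
    using that by (simp add: T_def)
  have 1: "psd N T" by (rule psd_gramI[OF Tc _ Tent]) auto
  \<comment> \<open>Cutting coordinates can be moved from the eigenvector to \<open>z\<close>;
    extending the sum from \<open>A\<close> to all eigenvectors then gives the squared norm of Q z
    by Parseval.\<close>
  have qT: "Re (qform N T z) \<le> (\<Sum>y<N. (cmod (z y))\<^sup>2)" for z
  proof -
    have "qform N T z = complex_of_real (\<Sum>x<N. (cmod (\<Sum>y<N. cnj (z y) * t x y))\<^sup>2)"
      by (rule qform_gram[OF _ Tent]) auto
    then have "Re (qform N T z) = (\<Sum>x<N. (cmod (\<Sum>y<N. cnj (z y) * t x y))\<^sup>2)" by simp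
    also have "\<dots> \<le> (\<Sum>x<N. (cmod (\<Sum>y<N. cnj (if y \<in> S then z y else 0) * W $$ (y,x)))\<^sup>2)"
    proof (intro sum_mono)
      fix x assume "x \<in> {..<N}"
      show "(cmod (\<Sum>y<N. cnj (z y) * t x y))\<^sup>2 \<le> (cmod (\<Sum>y<N. cnj (if y \<in> S then z y else 0) * W $$ (y,x)))\<^sup>2"
      proof (cases "x \<in> A")
        case True
        then have "(\<Sum>y<N. cnj (z y) * t x y) = (\<Sum>y<N. cnj (if y \<in> S then z y else 0) * W $$ (y,x))"
          by (intro sum.cong refl) (auto simp: t_def)
        then show ?thesis by simp
      qed (simp add: t_def)
    qed
    also have "\<dots> = (\<Sum>y<N. (cmod (if y \<in> S then z y else 0))\<^sup>2)" by (rule parseval[OF W])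
    also have "\<dots> \<le> (\<Sum>y<N. (cmod (z y))\<^sup>2)" by (intro sum_mono) auto
    finally show ?thesis .
  qed
  have 2: "psd N (1\<^sub>m N - T)"
  proof (rule psdI)
    fix z
    have "qform N (1\<^sub>m N) z = qform N (1\<^sub>m N - T) z + qform N T z"
      using Tc by (subst qform_add[symmetric]) (auto intro!: arg_cong[of _ _ "\<lambda>A. qform N A z"])
    then have "Re (qform N (1\<^sub>m N - T) z) = (\<Sum>y<N. (cmod (z y))\<^sup>2) - Re (qform N T z)"
      unfolding qform_one by (metis Re_complex_of_real add_diff_cancel_right' minus_complex.simps(1))
    then show "0 \<le> Re (qform N (1\<^sub>m N - T) z)" using qT[of z] by simp
  qed (use Tc psd_cnj[OF 1] in auto)
  have 3: "Re (mtrace (T * M)) \<ge> 1 - 4 * \<eta>"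
  proof -
    \<comment> \<open>\<open>b x\<close> is the squared norm of Q applied to eigenvector
      \<open>x\<close>. In the form of \<open>M\<close> at this cut vector only the term of the same
      \<open>x\<close> is kept, which is \<open>p x * (b x)\<^sup>2\<close>; the bound
      \<open>(b x)\<^sup>2 \<ge> 2 * b x - 1\<close> makes it linear. The two tails cost \<eta>
      each, and the factor 2 makes this \<open>4 * \<eta>\<close>.\<close>
    define b where "b x = (\<Sum>y\<in>S. w x y)" for x
    have "mtrace (T * M) = (\<Sum>x<N. qform N M (t x))"
      by (rule mtrace_mult_gram[OF Tc Mc Tent])
    then have "Re (mtrace (T * M)) = (\<Sum>x<N. Re (qform N M (t x)))" by simp
    moreover have "(\<Sum>x\<in>A. p x * (2 * b x - 1)) \<le> (\<Sum>x<N. Re (qform N M (t x)))"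
    proof -
      have q0: "Re (qform N M z) = (\<Sum>x<N. p x * (cmod (\<Sum>y<N. cnj (z y) * W $$ (y,x)))\<^sup>2)" for z
        unfolding M by (rule qform_wgram[OF _ _ conj_diag_wgram[OF Wc]]) (use p in auto)
      have "p x * (2 * b x - 1) \<le> Re (qform N M (t x))" if x: "x \<in> A" for x
      proof -
        have xN: "x < N" using x A(1) by auto
        have "(\<Sum>y<N. cnj (t x y) * W $$ (y,x)) = (\<Sum>y<N. if y \<in> S then complex_of_real (w x y) else 0)"
          using x by (intro sum.cong refl) (simp add: t_def w_def complex_norm_square mult.commute del: of_real_power)
        also have "\<dots> = complex_of_real (b x)" unfolding b_def using S(1)
          by (simp add: sum.If_cases Int_absorb1)
        finally have eq: "(\<Sum>y<N. cnj (t x y) * W $$ (y,x)) = complex_of_real (b x)" .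
        have "0 \<le> (b x - 1)\<^sup>2" by simp
        then have "2 * b x - 1 \<le> (b x)\<^sup>2" by (simp add: power2_eq_square algebra_simps)
        then have "p x * (2 * b x - 1) \<le> p x * (cmod (\<Sum>y<N. cnj (t x y) * W $$ (y,x)))\<^sup>2"
          using p(1)[OF xN] unfolding eq by (intro mult_left_mono) auto
        also have "\<dots> \<le> Re (qform N M (t x))" unfolding q0
          using xN p by (intro member_le_sum[of x "{..<N}"]) auto
        finally show ?thesis .
      qed
      then have "(\<Sum>x\<in>A. p x * (2 * b x - 1)) \<le> (\<Sum>x\<in>A. Re (qform N M (t x)))" by (intro sum_mono)
      also have "\<dots> \<le> (\<Sum>x<N. Re (qform N M (t x)))"
        using A(1) q0 p by (intro sum_mono2) (auto intro!: sum_nonneg)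
      finally show ?thesis .
    qed
    moreover have "1 - 4 * \<eta> \<le> (\<Sum>x\<in>A. p x * (2 * b x - 1))"
    proof -
      have b1: "b x \<le> 1" if "x < N" for x
        unfolding b_def w1[OF that, symmetric] using S(1) w0 by (intro sum_mono2) auto
      have pA: "(\<Sum>x\<in>A. p x) + (\<Sum>x\<in>{..<N}-A. p x) = 1"
        using p(2) sum.subset_diff[OF A(1), of p] by simp
      have "(\<Sum>x<N. p x * b x) = (\<Sum>y\<in>S. \<Sum>x<N. p x * w x y)"
        unfolding b_def sum_distrib_left by (rule sum.swap)
      also have "\<dots> = (\<Sum>y\<in>S. Re (M $$ (y,y)))" using S(1) by (intro sum.cong) (auto simp: Mdiag)
      also have "\<dots> = (\<Sum>y<N. Re (M $$ (y,y))) - (\<Sum>y\<in>{..<N}-S. Re (M $$ (y,y)))"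
        using sum.subset_diff[OF S(1), of "\<lambda>y. Re (M $$ (y,y))"] by simp
      also have "(\<Sum>y<N. Re (M $$ (y,y))) = 1"
      proof -
        have "(\<Sum>y<N. Re (M $$ (y,y))) = (\<Sum>x<N. p x * (\<Sum>y<N. w x y))"
          by (simp add: Mdiag sum_distrib_left) (rule sum.swap)
        then show ?thesis using w1 p(2) by simp
      qed
      finally have pb: "(\<Sum>x<N. p x * b x) \<ge> 1 - \<eta>" using S(2) by simp
      have "(\<Sum>x<N. p x * b x) = (\<Sum>x\<in>A. p x * b x) + (\<Sum>x\<in>{..<N}-A. p x * b x)"
        using sum.subset_diff[OF A(1), of "\<lambda>x. p x * b x"] by simp
      moreover have "(\<Sum>x\<in>{..<N}-A. p x * b x) \<le> (\<Sum>x\<in>{..<N}-A. p x)"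
        using b1 p(1) by (intro sum_mono) (auto intro: mult_left_le)
      ultimately have "(\<Sum>x\<in>A. p x * b x) \<ge> 1 - 2 * \<eta>" using pb A(2) by simp
      moreover have "(\<Sum>x\<in>A. p x) \<le> 1" using pA sum_nonneg[of "{..<N}-A" p] p(1) by auto
      moreover have "(\<Sum>x\<in>A. p x * (2 * b x - 1)) = 2 * (\<Sum>x\<in>A. p x * b x) - (\<Sum>x\<in>A. p x)"
        by (simp add: sum_subtractf sum_distrib_left algebra_simps)
      ultimately show ?thesis by simp
    qed
    ultimately show ?thesis by simp
  qed
  have 4: "Re (mtrace (T * \<sigma>)) \<le> P * L"
  proof -
    have \<sigma>c: "\<sigma> \<in> carrier_mat N N" by (simp add: \<sigma>_def)
    have "mtrace (T * \<sigma>) = (\<Sum>x<N. qform N \<sigma> (t x))"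
      by (rule mtrace_mult_gram[OF Tc \<sigma>c Tent])
    then have "Re (mtrace (T * \<sigma>)) = (\<Sum>x<N. \<Sum>y<N. e y * (cmod (t x y))\<^sup>2)"
      unfolding \<sigma>_def qform_diag by simp
    also have "\<dots> \<le> (\<Sum>x<N. if x \<in> A then L else 0)"
    proof (intro sum_mono)
      fix x assume x: "x \<in> {..<N}"
      show "(\<Sum>y<N. e y * (cmod (t x y))\<^sup>2) \<le> (if x \<in> A then L else 0)"
      proof (cases "x \<in> A")
        case True
        have "(\<Sum>y<N. e y * (cmod (t x y))\<^sup>2) \<le> (\<Sum>y<N. L * w x y)"
          using True S(3) L w0[of x] by (intro sum_mono) (auto simp: t_def w_def intro!: mult_right_mono)
        also have "\<dots> = L" using w1[of x] x by (simp flip: sum_distrib_left)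
        finally show ?thesis using True by simp
      qed (simp add: t_def)
    qed
    also have "\<dots> = real (card A) * L" using A(1) by (simp add: sum.If_cases Int_absorb1)
    \<comment> \<open>Each eigenvalue indexed by \<open>A\<close> is at least \<open>1/P\<close> and
      they sum to at most one, so \<open>P\<close> bounds the number of Gram vectors.\<close>
    also have "\<dots> \<le> P * L"
    proof (rule mult_right_mono[OF _ L])
      have "real (card A) = (\<Sum>x\<in>A. 1)" by simp
      also have "\<dots> \<le> (\<Sum>x\<in>A. P * p x)" using A(3) by (intro sum_mono)
      also have "\<dots> \<le> (\<Sum>x<N. P * p x)" using A(1) P p(1) by (intro sum_mono2) auto
      finally show "real (card A) \<le> P" using p(2) by (simp flip: sum_distrib_left)
    qed
    finally show ?thesis .
  qed
  show ?thesis using 1 2 3 4 by blast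
qed

section \<open>Locally monotonic functionals\<close>

abbreviation dg :: "nat \<Rightarrow> (nat \<Rightarrow> real) \<Rightarrow> complex mat" where
  "dg n e \<equiv> mat_diag n (\<lambda>i. complex_of_real (e i))"

section \<open>Diagonal states and spectra of powers\<close>

lemma fullrank_one: "fullrank_state 1 (1\<^sub>m 1)"
  using fullrank_diag[of 1 "\<lambda>_. 1"] by simp

lemma density_one: "density 1 (1\<^sub>m 1)"
  using fullrank_one by (simp add: fullrank_state_def)

lemma fullrank_density: "fullrank_state n \<sigma> \<Longrightarrow> density n \<sigma>"
  by (simp add: fullrank_state_def)

lemma density_pos_dim: "density n \<rho> \<Longrightarrow> n > 0"
  by (cases n) (auto simp: density_def mtrace_carrier[of _ 0])

lemma kpow_dg: "kpow (dg n e) k = dg (n^k) (tprod n e k)"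
  by (simp add: kpow_diag of_real_tprod)

lemma fullrank_kpow_dg:
  assumes "\<And>i. i < n \<Longrightarrow> e i > 0" "(\<Sum>i<n. e i) = 1"
  shows "fullrank_state (n^k) (kpow (dg n e) k)"
  unfolding kpow_dg using assms tprod_pos[of n e] by (intro fullrank_diag) (auto simp: sum_tprod)

lemma tprod_at_0: "tprod n g k 0 = g 0 ^ k"
  by (induction k) auto

lemma tprod_indicator:
  assumes "p < n^k"
  shows "tprod n (\<lambda>i. if i = 0 then 1 else 0) k p = (if p = 0 then 1 else 0)"
  using assms
proof (induction k arbitrary: p)
  case (Suc k)
  have "p = 0 \<longleftrightarrow> p div n^k = 0 \<and> p mod n^k = 0" by (metis div_mult_mod_eq add_0 mult_0 div_0 mod_0)
  then show ?case using Suc div_mod_less[of p n "n^k"] by auto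
qed auto

lemma tprod_cong:
  assumes "\<And>i. i < n \<Longrightarrow> g i = h i" "p < n^k"
  shows "tprod n g k p = tprod n h k p"
  using assms(2)
proof (induction k arbitrary: p)
  case (Suc k)
  then show ?case using assms(1) div_mod_less[of p n "n^k"] by simp
qed simp

lemma mtrace_mult_diag:
  assumes "T \<in> carrier_mat n n"
  shows "mtrace (T * mat_diag n e) = (\<Sum>i<n. T $$ (i,i) * e i)"
proof -
  have "mtrace (T * mat_diag n e) = (\<Sum>i<n. \<Sum>j<n. if j = i then T $$ (i,i) * e i else 0)"
    unfolding mtrace_mult[OF assms mat_diag_dim] by (intro sum.cong refl) (auto simp: mat_diag_def)
  then show ?thesis by simp
qed

lemma qform_unit:
  assumes "i < n"
  shows "qform n A (\<lambda>j. if j = i then 1 else 0) = A $$ (i,i)"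
proof -
  have "qform n A (\<lambda>j. if j = i then 1 else 0) = (\<Sum>k<n. \<Sum>j<n. if j = i then (if k = i then A $$ (i,i) else 0) else 0)"
    unfolding qform_def by (intro sum.cong refl) auto
  then show ?thesis using assms by simp
qed

lemma mtrace_psd_zero:
  assumes E: "psd n E" and Y: "Y \<in> carrier_mat n n" and "mtrace (E * Y) \<noteq> 0"
  shows "mtrace E \<noteq> 0"
proof
  assume z: "mtrace E = 0"
  obtain u where u: "\<And>i j. i < n \<Longrightarrow> j < n \<Longrightarrow> E $$ (i,j) = (\<Sum>l<n. u l i * cnj (u l j))"
    using psd_gramE[OF E] by blast
  have "mtrace E = (\<Sum>i<n. \<Sum>l<n. complex_of_real ((cmod (u l i))\<^sup>2))"
    unfolding mtrace_carrier[OF psd_carrier[OF E]] by (intro sum.cong refl) (simp add: u complex_norm_square del: of_real_power)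
  then have "complex_of_real (\<Sum>i<n. \<Sum>l<n. (cmod (u l i))\<^sup>2) = 0" using z by (simp del: of_real_power)
  then have "(\<Sum>i<n. \<Sum>l<n. (cmod (u l i))\<^sup>2) = 0" by (simp only: of_real_eq_0_iff)
  then have "\<forall>i<n. (\<Sum>l<n. (cmod (u l i))\<^sup>2) = 0"
    by (subst (asm) sum_nonneg_eq_0_iff) (auto intro!: sum_nonneg)
  then have "u l i = 0" if "i < n" "l < n" for i l
    using that by (auto simp: sum_nonneg_eq_0_iff)
  then have "E $$ (i,j) = 0" if "i < n" "j < n" for i j using u that by simp
  then show False using assms(3) unfolding mtrace_mult[OF psd_carrier[OF E] Y] by simp
qed

lemma kpow_diag_entry:
  assumes "A \<in> carrier_mat n n" "p < n^k"
  shows "kpow A k $$ (p,p) = tprod n (\<lambda>i. A $$ (i,i)) k p"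
  using assms(2)
proof (induction k arbitrary: p)
  case (Suc k)
  then show ?case using div_mod_less[of p n "n^k"] assms(1)
    by (simp add: kron_entry[of _ n n _ "n^k" "n^k"])
qed simp

lemma density_diag_entry:
  assumes "density n \<rho>"
  shows "\<And>i. i < n \<Longrightarrow> \<rho> $$ (i,i) = complex_of_real (Re (\<rho> $$ (i,i)))"
    "\<And>i. i < n \<Longrightarrow> Re (\<rho> $$ (i,i)) \<ge> 0" "(\<Sum>i<n. Re (\<rho> $$ (i,i))) = 1"
proof -
  have p: "psd n \<rho>" using assms by (simp add: density_def)
  show "\<rho> $$ (i,i) = complex_of_real (Re (\<rho> $$ (i,i)))" if "i < n" for i
    using psd_cnj[OF p that that] by (simp add: complex_eq_iff)
  show "Re (\<rho> $$ (i,i)) \<ge> 0" if "i < n" for i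
    using psd_qform_nonneg[OF p, of "\<lambda>j. if j = i then 1 else 0"] qform_unit[OF that] by simp
  show "(\<Sum>i<n. Re (\<rho> $$ (i,i))) = 1"
    using assms mtrace_carrier[OF density_carrier[OF assms]]
    by (simp add: density_def) (metis Re_sum one_complex.simps(1))
qed

text \<open>Measuring the power of rho in a product basis gives independent letters distributed as
  the diagonal of rho. Applied in the eigenbasis of sigma, this is what makes
  \<open>ln (e i)\<close> obey the law of large numbers without commutation.\<close>

lemma Re_kpow_diag_entry:
  assumes "density n \<rho>" "p < n^k"
  shows "Re (kpow \<rho> k $$ (p,p)) = tprod n (\<lambda>i. Re (\<rho> $$ (i,i))) k p"
proof -
  have "kpow \<rho> k $$ (p,p) = tprod n (\<lambda>i. complex_of_real (Re (\<rho> $$ (i,i)))) k p"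
    unfolding kpow_diag_entry[OF density_carrier[OF assms(1)] assms(2)]
    using density_diag_entry(1)[OF assms(1)] assms(2) by (intro tprod_cong) auto
  then show ?thesis by (simp flip: of_real_tprod)
qed

lemma eigenvalues_distribution:
  assumes "density n \<rho>" "unitary n U" "\<rho> = U * dg n d * adj U"
  shows "\<And>i. i < n \<Longrightarrow> d i \<ge> 0" "(\<Sum>i<n. d i) = 1"
proof -
  show "d i \<ge> 0" if "i < n" for i
    using assms psd_eigenvalue_nonneg[OF _ assms(2,3) that] by (simp add: density_def)
  have U: "U \<in> carrier_mat n n" using unitary_carrier[OF assms(2)] .
  have "mtrace \<rho> = mtrace (adj U * (U * dg n d))"
    unfolding assms(3) using U by (intro mtrace_comm[of _ n]) auto
  also have "adj U * (U * dg n d) = (adj U * U) * dg n d"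
    using U by (simp add: assoc_mult_mat[of _ n n _ n _ n])
  also have "\<dots> = dg n d" using assms(2) by (simp add: unitary_def left_mult_one_mat[of _ n n])
  also have "mtrace (dg n d) = complex_of_real (\<Sum>i<n. d i)" by (simp add: mtrace_def mat_diag_def)
  finally show "(\<Sum>i<n. d i) = 1" using assms(1) by (metis density_def of_real_eq_1_iff)
qed

text \<open>The junk value \<open>ln 0 = 0\<close> is harmless: eigenvalues \<open>d i = 0\<close> carry no weight.\<close>
lemma typical_power:
  fixes e d :: "nat \<Rightarrow> real" and \<mu>d \<mu>e \<epsilon> \<eta> :: real
  assumes \<rho>: "density n \<rho>" and U: "unitary n U" "\<rho> = U * dg n d * adj U"
    and e: "\<forall>i<n. e i > 0"
    and \<mu>d: "\<mu>d = (\<Sum>i<n. d i * ln (d i))" and \<mu>e: "\<mu>e = (\<Sum>i<n. Re (\<rho> $$ (i,i)) * ln (e i))"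
    and \<epsilon>: "\<epsilon> > 0" and \<eta>: "\<eta> > 0"
  shows "\<forall>\<^sub>F k in sequentially. \<exists>A S. A \<subseteq> {..<n^k} \<and> (\<Sum>x\<in>{..<n^k}-A. tprod n d k x) \<le> \<eta> \<and>
      (\<forall>x\<in>A. exp (k * (\<mu>d - \<epsilon>)) \<le> tprod n d k x \<and> tprod n d k x \<le> exp (k * (\<mu>d + \<epsilon>))) \<and>
      S \<subseteq> {..<n^k} \<and> (\<Sum>y\<in>{..<n^k}-S. Re (kpow \<rho> k $$ (y,y))) \<le> \<eta> \<and>
      (\<forall>y\<in>S. exp (k * (\<mu>e - \<epsilon>)) \<le> tprod n e k y \<and> tprod n e k y \<le> exp (k * (\<mu>e + \<epsilon>)))"
proof -
  note d = eigenvalues_distribution[OF \<rho> U]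
  note w = density_diag_entry[OF \<rho>]
  note e = e[rule_format]
  have "\<forall>\<^sub>F k in sequentially. (\<Sum>x | x < n^k \<and> \<bar>tsum n (\<lambda>i. ln (d i)) k x - k * \<mu>d\<bar> > k * \<epsilon>. tprod n d k x) \<le> \<eta>"
    by (rule typical_set) (use d \<mu>d \<epsilon> \<eta> in auto)
  moreover have "\<forall>\<^sub>F k in sequentially. (\<Sum>y | y < n^k \<and> \<bar>tsum n (\<lambda>i. ln (e i)) k y - k * \<mu>e\<bar> > k * \<epsilon>.
      tprod n (\<lambda>i. Re (\<rho> $$ (i,i))) k y) \<le> \<eta>"
    by (rule typical_set) (use w \<mu>e \<epsilon> \<eta> in auto)
  ultimately show ?thesis
  proof eventually_elim
    case (elim k)
    \<comment> \<open>Positivity is demanded separately: since \<open>ln 0 = 0\<close>, a word of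
      weight zero can have a typical \<open>tsum\<close> and would violate the exponential lower
      bound. Excluding such words removes no weight.\<close>
    define A where "A = {x. x < n^k \<and> tprod n d k x > 0 \<and> \<bar>tsum n (\<lambda>i. ln (d i)) k x - k * \<mu>d\<bar> \<le> k * \<epsilon>}"
    define S where "S = {y. y < n^k \<and> \<bar>tsum n (\<lambda>i. ln (e i)) k y - k * \<mu>e\<bar> \<le> k * \<epsilon>}"
    let ?B = "{x. x < n^k \<and> \<bar>tsum n (\<lambda>i. ln (d i)) k x - k * \<mu>d\<bar> > k * \<epsilon>}"
    have t0: "tprod n d k x \<ge> 0" if "x < n^k" for x using d(1) that by (intro tprod_nonneg) auto
    have "(\<Sum>x\<in>{..<n^k}-A. tprod n d k x) = (\<Sum>x\<in>({..<n^k}-A) \<inter> {x. tprod n d k x > 0}. tprod n d k x)"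
      using t0 by (intro sum.mono_neutral_right) (auto simp: less_le)
    also have "\<dots> \<le> (\<Sum>x\<in>?B. tprod n d k x)"
      using t0 by (intro sum_mono2) (auto simp: A_def)
    finally have 1: "(\<Sum>x\<in>{..<n^k}-A. tprod n d k x) \<le> \<eta>" using elim(1) by simp
    have "(\<Sum>y\<in>{..<n^k}-S. Re (kpow \<rho> k $$ (y,y))) =
      (\<Sum>y | y < n^k \<and> \<bar>tsum n (\<lambda>i. ln (e i)) k y - k * \<mu>e\<bar> > k * \<epsilon>. tprod n (\<lambda>i. Re (\<rho> $$ (i,i))) k y)"
      by (intro sum.cong) (auto simp: S_def Re_kpow_diag_entry[OF \<rho>])
    then have 2: "(\<Sum>y\<in>{..<n^k}-S. Re (kpow \<rho> k $$ (y,y))) \<le> \<eta>" using elim(2) by simp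
    have 3: "exp (k * (\<mu>d - \<epsilon>)) \<le> tprod n d k x \<and> tprod n d k x \<le> exp (k * (\<mu>d + \<epsilon>))" if "x \<in> A" for x
    proof -
      have x: "tprod n d k x > 0" "x < n^k" using that by (auto simp: A_def)
      then have "ln (tprod n d k x) = tsum n (\<lambda>i. ln (d i)) k x" using d(1) by (intro ln_tprod) auto
      then have "tprod n d k x = exp (tsum n (\<lambda>i. ln (d i)) k x)" using x by (metis exp_ln)
      then show ?thesis using that by (auto simp: A_def abs_le_iff algebra_simps)
    qed
    have 4: "exp (k * (\<mu>e - \<epsilon>)) \<le> tprod n e k y \<and> tprod n e k y \<le> exp (k * (\<mu>e + \<epsilon>))" if "y \<in> S" for y
    proof -
      have y: "tprod n e k y > 0" "y < n^k" using that tprod_pos[of n e y k] e by (auto simp: S_def)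
      then have "ln (tprod n e k y) = tsum n (\<lambda>i. ln (e i)) k y" using e by (intro ln_tprod) (auto intro: less_imp_le)
      then have "tprod n e k y = exp (tsum n (\<lambda>i. ln (e i)) k y)" using y by (metis exp_ln)
      then show ?thesis using that by (auto simp: S_def abs_le_iff algebra_simps)
    qed
    show ?case using 1 2 3 4 by (intro exI[of _ A] exI[of _ S]) (auto simp: A_def S_def)
  qed
qed

section \<open>Consequences of local monotonicity\<close>

locale monotone_functional =
  fixes f :: "complex mat \<Rightarrow> complex mat \<Rightarrow> real"
  assumes lm: "locally_monotonic f" and cont: "continuous_first f" and norm: "f (1\<^sub>m 1) (1\<^sub>m 1) = 0"
begin

lemma monotonicD:
  assumes "channel_F (n1*n2) (m1*m2) C" "fullrank_state n1 \<sigma>1" "fullrank_state n2 \<sigma>2"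
    "fullrank_state m1 \<sigma>1'" "fullrank_state m2 \<sigma>2'" "C (kron \<sigma>1 \<sigma>2) = kron \<sigma>1' \<sigma>2'"
    "density n1 \<rho>1" "density n2 \<rho>2"
  shows "f (ptrace2 m1 m2 (C (kron \<rho>1 \<rho>2))) \<sigma>1' + f (ptrace1 m1 m2 (C (kron \<rho>1 \<rho>2))) \<sigma>2'
    \<le> f \<rho>1 \<sigma>1 + f \<rho>2 \<sigma>2"
  using lm assms unfolding locally_monotonic_def by blast

text \<open>Both second systems are one-dimensional, and the normalisation makes their contributions
  vanish.\<close>

lemma data_processing:
  assumes C: "channel_F n m C" and \<sigma>: "fullrank_state n \<sigma>" and \<rho>: "density n \<rho>"
  shows "f (C \<rho>) (C \<sigma>) \<le> f \<rho> \<sigma>"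
proof -
  have c: "\<rho> \<in> carrier_mat n n" "\<sigma> \<in> carrier_mat n n"
    using \<rho> \<sigma> by (auto simp: fullrank_state_def density_carrier)
  have C': "C \<rho> \<in> carrier_mat m m" "C \<sigma> \<in> carrier_mat m m" "mtrace (C \<rho>) = 1"
    using C c \<rho> by (auto simp: channel_F_def channel_def density_def)
  have "fullrank_state m (C \<sigma>)" using C \<sigma> by (simp add: channel_F_def)
  then show ?thesis
    using monotonicD[of n 1 m 1 C \<sigma> "1\<^sub>m 1" "C \<sigma>" "1\<^sub>m 1" \<rho> "1\<^sub>m 1"] assms fullrank_one density_one norm c C'
    by (simp add: kron_one_right[of _ n] kron_one_right[of _ m] ptrace2_one ptrace1_one flip: One_nat_def)
qed

text \<open>Data processing under the map to dimension one, obtained as the preparation with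
  \<open>T = 0\<close>, for which the full-rank second outcome always occurs.\<close>

lemma nonneg:
  assumes \<sigma>: "fullrank_state n \<sigma>" and \<rho>: "density n \<rho>"
  shows "f \<rho> \<sigma> \<ge> 0"
proof -
  have z: "psd n (0\<^sub>m n n)" by (rule psd_gramI[where I="{}"]) auto
  have i: "psd n (1\<^sub>m n - 0\<^sub>m n n)"
    by (rule psd_gramI[where I="{..<n}" and u="\<lambda>l i. if l = i then 1 else 0"]) (auto simp: if_distrib cong: if_cong)
  have n: "mtrace (0\<^sub>m n n) \<noteq> of_nat n" using density_pos_dim[OF \<rho>] by (simp add: mtrace_def)
  let ?C = "meas_prep n (0\<^sub>m n n) (1\<^sub>m 1) (1\<^sub>m 1)"
  have v: "?C X = 1\<^sub>m 1" if "density n X" for X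
  proof -
    have X: "X \<in> carrier_mat n n" "mtrace X = 1" using that by (auto simp: density_def)
    have "1\<^sub>m n - 0\<^sub>m n n = (1\<^sub>m n :: complex mat)" by (rule eq_matI) auto
    moreover have "mtrace (0\<^sub>m n n) = 0" by (simp add: mtrace_def)
    ultimately show ?thesis unfolding meas_prep_def using X
      by (intro eq_matI) auto
  qed
  show ?thesis
    using data_processing[OF meas_prep_channel_F[OF z i n density_one fullrank_one] \<sigma> \<rho>]
      v[OF \<rho>] v[OF fullrank_density[OF \<sigma>]] norm by simp
qed

text \<open>The identity channel with input dimensions \<open>n*m\<close> and 1 and output
  dimensions \<open>n\<close> and \<open>m\<close>. \<open>R\<close> may be correlated; only the
  reference state has to be a product.\<close>

lemma superadditive:
  assumes R: "density (n*m) R" and \<sigma>: "fullrank_state n \<sigma>1" "fullrank_state m \<sigma>2" "fullrank_state (n*m) (kron \<sigma>1 \<sigma>2)"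
  shows "f (ptrace2 n m R) \<sigma>1 + f (ptrace1 n m R) \<sigma>2 \<le> f R (kron \<sigma>1 \<sigma>2)"
proof -
  have c: "R \<in> carrier_mat (n*m) (n*m)" "kron \<sigma>1 \<sigma>2 \<in> carrier_mat (n*m) (n*m)"
    using R \<sigma>(3) by (auto simp: fullrank_state_def density_carrier)
  have u: "unitary (n*m) (1\<^sub>m (n*m))" by (simp add: unitary_def)
  show ?thesis
    using monotonicD[of "n*m" 1 n m "\<lambda>X. 1\<^sub>m (n*m) * X * adj (1\<^sub>m (n*m))" "kron \<sigma>1 \<sigma>2" "1\<^sub>m 1" \<sigma>1 \<sigma>2 R "1\<^sub>m 1"]
      unitary_conj_channel_F[OF u] R \<sigma> fullrank_one density_one norm c
      left_mult_one_mat[OF c(1)] left_mult_one_mat[OF c(2)] right_mult_one_mat[OF c(1)] right_mult_one_mat[OF c(2)]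
    by (simp add: kron_one_right[of _ "n*m"] flip: One_nat_def)
qed

text \<open>The same identity channel with the grouping reversed: inputs \<open>n\<close> and
  \<open>m\<close>, outputs \<open>n*m\<close> and 1. Here both inputs are products.\<close>

lemma subadditive:
  assumes \<rho>: "density n \<rho>1" "density m \<rho>2"
    and \<sigma>: "fullrank_state n \<sigma>1" "fullrank_state m \<sigma>2" "fullrank_state (n*m) (kron \<sigma>1 \<sigma>2)"
  shows "f (kron \<rho>1 \<rho>2) (kron \<sigma>1 \<sigma>2) \<le> f \<rho>1 \<sigma>1 + f \<rho>2 \<sigma>2"
proof -
  have R: "density (n*m) (kron \<rho>1 \<rho>2)" using density_kron[OF \<rho>] .
  have c: "kron \<rho>1 \<rho>2 \<in> carrier_mat (n*m) (n*m)" "kron \<sigma>1 \<sigma>2 \<in> carrier_mat (n*m) (n*m)" "mtrace (kron \<rho>1 \<rho>2) = 1"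
    using R \<sigma>(3) by (auto simp: fullrank_state_def density_def)
  have u: "unitary (n*m) (1\<^sub>m (n*m))" by (simp add: unitary_def)
  show ?thesis
    using monotonicD[of n m "n*m" 1 "\<lambda>X. 1\<^sub>m (n*m) * X * adj (1\<^sub>m (n*m))" \<sigma>1 \<sigma>2 "kron \<sigma>1 \<sigma>2" "1\<^sub>m 1" \<rho>1 \<rho>2]
      unitary_conj_channel_F[OF u] \<rho> \<sigma> fullrank_one density_one norm c
      left_mult_one_mat[OF c(1)] left_mult_one_mat[OF c(2)] right_mult_one_mat[OF c(1)] right_mult_one_mat[OF c(2)]
    by (simp add: kron_one_right[of _ "n*m"] ptrace2_one ptrace1_one flip: One_nat_def)
qed

lemma kpow_additive:
  assumes e: "\<And>i. i < n \<Longrightarrow> e i > 0" "(\<Sum>i<n. e i) = 1" and \<rho>: "density n \<rho>"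
  shows "f (kpow \<rho> k) (kpow (dg n e) k) = k * f \<rho> (dg n e)"
proof (induction k)
  case 0
  then show ?case using norm by simp
next
  case (Suc k)
  note fr = fullrank_diag[OF e] fullrank_kpow_dg[OF e] fullrank_kpow_dg[OF e, where k="Suc k", simplified]
  have t: "mtrace \<rho> = 1" "mtrace (kpow \<rho> k) = 1" using \<rho> density_kpow[OF \<rho>] by (auto simp: density_def)
  note c = density_carrier[OF \<rho>] density_carrier[OF density_kpow[OF \<rho>]]
  have "f \<rho> (dg n e) + f (kpow \<rho> k) (kpow (dg n e) k) \<le> f (kron \<rho> (kpow \<rho> k)) (kron (dg n e) (kpow (dg n e) k))"
    using superadditive[OF density_kron[OF \<rho> density_kpow[OF \<rho>]] fr(1) fr(2) fr(3)]
    by (simp add: ptrace2_kron[OF c t(2)] ptrace1_kron[OF c t(1)])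
  moreover have "f (kron \<rho> (kpow \<rho> k)) (kron (dg n e) (kpow (dg n e) k)) \<le> f \<rho> (dg n e) + f (kpow \<rho> k) (kpow (dg n e) k)"
    by (rule subadditive[OF \<rho> density_kpow[OF \<rho>] fr(1) fr(2) fr(3)])
  ultimately show ?case using Suc by (simp add: algebra_simps)
qed

text \<open>The one-sided epsilon-delta form: a failure at every
  \<open>inverse (real (Suc k))\<close> would produce a sequence of states contradicting
  \<open>continuous_first\<close>.\<close>

lemma continuous_at:
  assumes \<sigma>: "fullrank_state n \<sigma>" and \<rho>: "density n \<rho>" and \<epsilon>: "\<epsilon> > 0"
  obtains \<delta> where "\<delta> > 0" "\<And>R. density n R \<Longrightarrow> (\<And>i j. i < n \<Longrightarrow> j < n \<Longrightarrow> cmod (R $$ (i,j) - \<rho> $$ (i,j)) < \<delta>)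
    \<Longrightarrow> f \<rho> \<sigma> - \<epsilon> \<le> f R \<sigma>"
proof -
  have "\<exists>\<delta>>0. \<forall>R. density n R \<longrightarrow> (\<forall>i<n. \<forall>j<n. cmod (R $$ (i,j) - \<rho> $$ (i,j)) < \<delta>) \<longrightarrow> f \<rho> \<sigma> - \<epsilon> \<le> f R \<sigma>"
  proof (rule ccontr)
    assume neg: "\<not> ?thesis"
    have "\<forall>k. \<exists>R. density n R \<and> (\<forall>i<n. \<forall>j<n. cmod (R $$ (i,j) - \<rho> $$ (i,j)) < inverse (real (Suc k))) \<and> f R \<sigma> < f \<rho> \<sigma> - \<epsilon>"
    proof
      fix k
      have "inverse (real (Suc k)) > 0" by simp
      then show "\<exists>R. density n R \<and> (\<forall>i<n. \<forall>j<n. cmod (R $$ (i,j) - \<rho> $$ (i,j)) < inverse (real (Suc k))) \<and> f R \<sigma> < f \<rho> \<sigma> - \<epsilon>"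
        using neg by (meson not_le)
    qed
    then obtain X where X: "\<And>k. density n (X k)"
      "\<And>k i j. i < n \<Longrightarrow> j < n \<Longrightarrow> cmod (X k $$ (i,j) - \<rho> $$ (i,j)) < inverse (real (Suc k))"
      "\<And>k. f (X k) \<sigma> < f \<rho> \<sigma> - \<epsilon>" by metis
    have "(\<lambda>k. X k $$ (i,j)) \<longlonglongrightarrow> \<rho> $$ (i,j)" if "i < n" "j < n" for i j
    proof -
      have "(\<lambda>k. cmod (X k $$ (i,j) - \<rho> $$ (i,j))) \<longlonglongrightarrow> 0"
        using X(2)[OF that]
        by (intro tendsto_sandwich[OF _ _ tendsto_const LIMSEQ_inverse_real_of_nat])
          (auto intro!: always_eventually less_imp_le)
      then show ?thesis by (simp only: tendsto_norm_zero_iff LIM_zero_iff)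
    qed
    then have "(\<lambda>k. f (X k) \<sigma>) \<longlonglongrightarrow> f \<rho> \<sigma>"
      using cont \<sigma> \<rho> X(1) unfolding continuous_first_def by blast
    then have "f \<rho> \<sigma> \<le> f \<rho> \<sigma> - \<epsilon>" using X(3) by (intro LIMSEQ_le_const2) (auto intro!: less_imp_le)
    then show False using \<epsilon> by simp
  qed
  then show ?thesis using that by blast
qed

text \<open>An entrywise bound of the form \<open>\<alpha> y + \<beta> y'\<close> is inherited by partial traces.\<close>
lemma superadditive_close:
  assumes e: "\<And>i. i < n \<Longrightarrow> e i > 0" "(\<Sum>i<n. e i) = 1" and \<rho>: "density n \<rho>"
    and loc: "\<And>R. density n R \<Longrightarrow> (\<And>i j. i < n \<Longrightarrow> j < n \<Longrightarrow> cmod (R $$ (i,j) - \<rho> $$ (i,j)) < \<delta>)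
      \<Longrightarrow> f \<rho> (dg n e) - \<epsilon> \<le> f R (dg n e)"
    and R: "density (n^k) R"
    and \<alpha>: "\<And>y. y < n^k \<Longrightarrow> \<alpha> y \<ge> 0" and \<beta>: "\<And>y. y < n^k \<Longrightarrow> \<beta> y \<ge> 0"
    and close: "\<And>y y'. y < n^k \<Longrightarrow> y' < n^k \<Longrightarrow> cmod (R $$ (y,y') - kpow \<rho> k $$ (y,y')) \<le> \<alpha> y + \<beta> y'"
    and total: "(\<Sum>y<n^k. \<alpha> y) + (\<Sum>y<n^k. \<beta> y) < \<delta>"
  shows "k * (f \<rho> (dg n e) - \<epsilon>) \<le> f R (kpow (dg n e) k)"
  using R \<alpha> \<beta> close total
proof (induction k arbitrary: R \<alpha> \<beta>)
  case 0
  then show ?case using nonneg[OF fullrank_one, of R] by simp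
next
  case (Suc k)
  let ?m = "n^k"
  note fr = fullrank_diag[OF e] fullrank_kpow_dg[OF e] fullrank_kpow_dg[OF e, where k="Suc k", simplified]
  note c = density_carrier[OF \<rho>] density_carrier[OF density_kpow[OF \<rho>]]
  have t: "mtrace \<rho> = 1" "mtrace (kpow \<rho> k) = 1" using \<rho> density_kpow[OF \<rho>] by (auto simp: density_def)
  have R: "density (n*?m) R" using Suc.prems(1) by simp
  have \<alpha>: "\<alpha> (i*?m+b) \<ge> 0" "\<beta> (i*?m+b) \<ge> 0" if "i < n" "b < ?m" for i b
    using Suc.prems(2,3)[of "i*?m+b"] mult_add_less[OF that] by auto
  have close: "cmod (R $$ (i*?m+b,j*?m+b') - kron \<rho> (kpow \<rho> k) $$ (i*?m+b,j*?m+b')) \<le> \<alpha> (i*?m+b) + \<beta> (j*?m+b')"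
    if "i < n" "b < ?m" "j < n" "b' < ?m" for i b j b'
    using Suc.prems(4)[of "i*?m+b" "j*?m+b'"] mult_add_less[OF that(1,2)] mult_add_less[OF that(3,4)] by simp
  have total: "(\<Sum>i<n. \<Sum>b<?m. \<alpha> (i*?m+b)) + (\<Sum>i<n. \<Sum>b<?m. \<beta> (i*?m+b)) < \<delta>"
    using Suc.prems(5) by (simp add: sum_split_mult)
  \<comment> \<open>The first marginal: tracing out the tail adds up errors at distinct indices, so
    each entry is off by less than \<delta>.\<close>
  have "f \<rho> (dg n e) - \<epsilon> \<le> f (ptrace2 n ?m R) (dg n e)"
  proof (rule loc[OF density_ptrace2[OF R]])
    fix i j assume ij: "i < n" "j < n"
    have "ptrace2 n ?m R $$ (i,j) - \<rho> $$ (i,j) = (\<Sum>b<?m. R $$ (i*?m+b,j*?m+b) - kron \<rho> (kpow \<rho> k) $$ (i*?m+b,j*?m+b))"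
      using ij by (subst (1) ptrace2_kron[OF c t(2), symmetric]) (simp add: ptrace2_def sum_subtractf)
    moreover have "cmod (\<Sum>b<?m. R $$ (i*?m+b,j*?m+b) - kron \<rho> (kpow \<rho> k) $$ (i*?m+b,j*?m+b))
        \<le> (\<Sum>b<?m. \<alpha> (i*?m+b) + \<beta> (j*?m+b))"
      using ij close by (intro sum_norm_le) auto
    ultimately have "cmod (ptrace2 n ?m R $$ (i,j) - \<rho> $$ (i,j)) \<le> (\<Sum>b<?m. \<alpha> (i*?m+b)) + (\<Sum>b<?m. \<beta> (j*?m+b))"
      by (simp only: sum.distrib)
    moreover have "(\<Sum>b<?m. \<alpha> (i*?m+b)) \<le> (\<Sum>i<n. \<Sum>b<?m. \<alpha> (i*?m+b))"
      using ij \<alpha> by (intro member_le_sum[of i "{..<n}" "\<lambda>i. \<Sum>b<?m. \<alpha> (i*?m+b)"]) (auto intro!: sum_nonneg)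
    moreover have "(\<Sum>b<?m. \<beta> (j*?m+b)) \<le> (\<Sum>i<n. \<Sum>b<?m. \<beta> (i*?m+b))"
      using ij \<alpha> by (intro member_le_sum[of j "{..<n}" "\<lambda>i. \<Sum>b<?m. \<beta> (i*?m+b)"]) (auto intro!: sum_nonneg)
    ultimately show "cmod (ptrace2 n ?m R $$ (i,j) - \<rho> $$ (i,j)) < \<delta>" using total by linarith
  qed
  \<comment> \<open>The tail inherits bounds of the same form, with \<alpha> and \<beta> summed over
    the first letter. Their totals are unchanged, so the same \<delta> serves at every stage of the
    induction.\<close>
  moreover have "k * (f \<rho> (dg n e) - \<epsilon>) \<le> f (ptrace1 n ?m R) (kpow (dg n e) k)"
  proof (rule Suc.IH[OF density_ptrace1[OF R]])
    show "(\<Sum>i<n. \<alpha> (i*?m+b)) \<ge> 0" "(\<Sum>i<n. \<beta> (i*?m+b)) \<ge> 0" if "b < ?m" for b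
      using that \<alpha> by (auto intro!: sum_nonneg)
    show "(\<Sum>b<?m. \<Sum>i<n. \<alpha> (i*?m+b)) + (\<Sum>b<?m. \<Sum>i<n. \<beta> (i*?m+b)) < \<delta>"
      using total by (simp only: sum.swap[of _ "{..<n}" "{..<?m}"])
    fix b b' assume b: "b < ?m" "b' < ?m"
    have "ptrace1 n ?m R $$ (b,b') - kpow \<rho> k $$ (b,b') = (\<Sum>i<n. R $$ (i*?m+b,i*?m+b') - kron \<rho> (kpow \<rho> k) $$ (i*?m+b,i*?m+b'))"
      using b by (subst (1) ptrace1_kron[OF c t(1), symmetric]) (simp add: ptrace1_def sum_subtractf)
    moreover have "cmod (\<Sum>i<n. R $$ (i*?m+b,i*?m+b') - kron \<rho> (kpow \<rho> k) $$ (i*?m+b,i*?m+b'))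
        \<le> (\<Sum>i<n. \<alpha> (i*?m+b) + \<beta> (i*?m+b'))"
      using b close by (intro sum_norm_le) auto
    ultimately show "cmod (ptrace1 n ?m R $$ (b,b') - kpow \<rho> k $$ (b,b')) \<le> (\<Sum>i<n. \<alpha> (i*?m+b)) + (\<Sum>i<n. \<beta> (i*?m+b'))"
      by (simp only: sum.distrib)
  qed
  moreover have "f (ptrace2 n ?m R) (dg n e) + f (ptrace1 n ?m R) (kpow (dg n e) k) \<le> f R (kron (dg n e) (kpow (dg n e) k))"
    by (rule superadditive[OF R fr(1) fr(2) fr(3)])
  ultimately show ?case by (simp add: algebra_simps)
qed

end

section \<open>Classical calibration\<close>

lemma mtrace_diag: "mtrace (dg n e) = complex_of_real (\<Sum>i<n. e i)"
  by (simp add: mtrace_def mat_diag_def)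

lemma one_minus_diag: "1\<^sub>m n - dg n e = dg n (\<lambda>i. 1 - e i)"
  by (rule eq_matI) (auto simp: mat_diag_def)

lemma psd_diag: "(\<And>i. i < n \<Longrightarrow> e i \<ge> 0) \<Longrightarrow> psd n (dg n e)"
  by (auto simp: qform_diag intro!: psdI sum_nonneg) (auto simp: mat_diag_def)

lemma psd_one_minus_diag: "(\<And>i. i < n \<Longrightarrow> e i \<le> 1) \<Longrightarrow> psd n (1\<^sub>m n - dg n e)"
  unfolding one_minus_diag by (rule psd_diag) simp

lemma kpow_1:
  assumes "A \<in> carrier_mat n n"
  shows "kpow A 1 = A"
  using kron_one_right[OF assms] by simp

definition pure_weights :: "nat \<Rightarrow> real" where
  "pure_weights i = (if i = 0 then 1 else 0)"

definition ref_weights :: "real \<Rightarrow> nat \<Rightarrow> real" where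
  "ref_weights l i = (if i = 0 then 1/l else 1 - 1/l)"

lemma pure_weights_le1: "0 \<le> pure_weights i" "pure_weights i \<le> 1" by (auto simp: pure_weights_def)

lemma sum_pure_weights: "0 < n \<Longrightarrow> (\<Sum>i<n. pure_weights i * g i) = g 0"
  by (subst sum.cong[OF refl, of _ _ "\<lambda>i. if i = 0 then g 0 else 0"]) (auto simp: pure_weights_def)

lemma density_pure: "0 < n \<Longrightarrow> density n (dg n pure_weights)"
  using sum_pure_weights[of n "\<lambda>_. 1"] pure_weights_le1 by (intro density_diag) auto

lemma ref_weights:
  assumes "l > 1"
  shows "ref_weights l i > 0" "(\<Sum>i<2. ref_weights l i) = 1"
  using assms by (auto simp: ref_weights_def numeral_2_eq_2)

lemma kpow_pure: "kpow (dg 2 pure_weights) k = dg (2^k) pure_weights"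
  unfolding kpow_dg
proof (rule eq_matI)
  fix i j assume "i < dim_row (dg (2^k) pure_weights)" "j < dim_col (dg (2^k) pure_weights)"
  then show "dg (2^k) (tprod 2 pure_weights k) $$ (i,j) = dg (2^k) pure_weights $$ (i,j)"
    using tprod_indicator[of j 2 k] by (auto simp: mat_diag_def pure_weights_def[abs_def])
qed (auto simp: mat_diag_def)

lemma tprod_ref_0: "tprod n (ref_weights l) k 0 = 1 / l^k"
  by (simp add: tprod_at_0 ref_weights_def power_one_over)

lemma mtrace_pure_mult: "0 < n \<Longrightarrow> mtrace (dg n pure_weights * dg n e) = complex_of_real (e 0)"
  by (simp add: mtrace_diag sum_pure_weights flip: of_real_mult del: of_real_sum)

lemma mtrace_compl_mult:
  assumes "T \<in> carrier_mat n n" "X \<in> carrier_mat n n"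
  shows "mtrace ((1\<^sub>m n - T) * X) = mtrace X - mtrace (T * X)"
proof -
  have "mtrace ((1\<^sub>m n - T) * X) + mtrace (T * X) = mtrace (((1\<^sub>m n - T) + T) * X)"
    using assms by (subst add_mult_distrib_mat[of _ n n _ _ n]) (auto intro!: mtrace_add[of _ n, symmetric])
  also have "(1\<^sub>m n - T) + T = 1\<^sub>m n" using assms by (intro eq_matI) auto
  finally show ?thesis using assms by (simp add: algebra_simps)
qed

context monotone_functional
begin

text \<open>The relative entropy of this pair is \<open>ln l\<close>, so the multiple of the
  logarithm found for \<open>calib\<close> is the constant of the final theorem.\<close>

definition calib :: "real \<Rightarrow> real" where
  "calib l = f (dg 2 pure_weights) (dg 2 (ref_weights l))"

text \<open>A state dominated by \<open>l0 \<sigma>\<close> is prepared, together with \<open>\<sigma>\<close>, from the classical pair in \<open>calib l\<close>.\<close>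
lemma reverse_test:
  assumes \<sigma>: "fullrank_state n \<sigma>" and R: "density n R"
    and dom: "\<And>z. Re (qform n R z) \<le> l0 * Re (qform n \<sigma> z)" and l: "l0 < l"
  shows "f R \<sigma> \<le> calib l"
proof -
  have d\<sigma>: "density n \<sigma>" using fullrank_density[OF \<sigma>] .
  have c: "R \<in> carrier_mat n n" "\<sigma> \<in> carrier_mat n n" using R d\<sigma> density_carrier by auto
  \<comment> \<open>Summing the domination over unit vectors compares traces, hence
    \<open>l0 \<ge> 1\<close>.\<close>
  have "1 = (\<Sum>i<n. Re (qform n R (\<lambda>j. if j = i then 1 else 0)))"
    using density_diag_entry(3)[OF R] by (simp add: qform_unit)
  also have "\<dots> \<le> (\<Sum>i<n. l0 * Re (qform n \<sigma> (\<lambda>j. if j = i then 1 else 0)))"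
    by (intro sum_mono dom)
  also have "\<dots> = l0" using density_diag_entry(3)[OF d\<sigma>] by (simp add: qform_unit flip: sum_distrib_left)
  finally have l1: "l > 1" using l by simp
  define q where "q = 1 - 1/l"
  have q: "q > 0" using l1 by (simp add: q_def)
  define B where "B = \<sigma> + complex_of_real (- 1/l) \<cdot>\<^sub>m R"
  \<comment> \<open>The remainder that makes sigma the mixture of \<open>R\<close> with weight
    \<open>1/l\<close> and \<open>\<tau>\<close> with weight \<open>q\<close>. The strict
    \<open>l0 < l\<close> leaves a positive multiple of sigma below \<open>\<tau>\<close>, so
    \<open>\<tau>\<close> is full rank.\<close>
  define \<tau> where "\<tau> = complex_of_real (1/q) \<cdot>\<^sub>m B"
  have Bc: "B \<in> carrier_mat n n" using c by (simp add: B_def)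
  have \<tau>c: "\<tau> \<in> carrier_mat n n" using Bc by (simp add: \<tau>_def)
  have q\<tau>: "Re (qform n \<tau> z) \<ge> 1/q * ((1 - l0/l) * Re (qform n \<sigma> z))" for z
  proof -
    have "Re (qform n \<tau> z) = 1/q * (Re (qform n \<sigma> z) - 1/l * Re (qform n R z))"
      using c Bc by (simp add: \<tau>_def B_def qform_smult qform_add del: of_real_divide)
    moreover have "1/l * Re (qform n R z) \<le> 1/l * (l0 * Re (qform n \<sigma> z))"
      using dom l1 by (intro mult_left_mono) auto
    ultimately have "1/q * (Re (qform n \<sigma> z) - 1/l * (l0 * Re (qform n \<sigma> z))) \<le> Re (qform n \<tau> z)"
      using q by (simp add: divide_right_mono)
    then show ?thesis by (simp add: left_diff_distrib)
  qed
  have ll: "1 - l0/l > 0" using l l1 by simp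
  have hs: "psd n \<sigma>" "psd n R" using d\<sigma> R by (auto simp: density_def)
  have "psd n \<tau>"
  proof (rule psdI[OF \<tau>c])
    show "cnj (\<tau> $$ (j,i)) = \<tau> $$ (i,j)" if "i < n" "j < n" for i j
      using that c psd_cnj[OF hs(1)] psd_cnj[OF hs(2)] by (simp add: \<tau>_def B_def)
    show "0 \<le> Re (qform n \<tau> z)" for z
      using q\<tau>[of z] q ll psd_qform_nonneg[OF hs(1), of z]
      by (smt (verit) divide_nonneg_pos mult_nonneg_nonneg)
  qed
  moreover have "mtrace \<tau> = 1"
  proof -
    have "mtrace \<tau> = complex_of_real (1/q) * (1 + complex_of_real (- 1/l))"
      using c Bc R d\<sigma> by (simp add: \<tau>_def B_def mtrace_smult[of _ n] mtrace_add[of _ n] density_def)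
    also have "1 + complex_of_real (- 1/l) = complex_of_real q" by (simp add: q_def)
    finally show ?thesis using q by simp
  qed
  ultimately have d\<tau>: "density n \<tau>" by (simp add: density_def)
  have \<tau>: "fullrank_state n \<tau>"
  proof (rule fullrank_stateI[OF d\<tau>])
    fix x :: "nat \<Rightarrow> complex" and i assume i: "i < n" "x i \<noteq> 0"
    have "1/q * ((1 - l0/l) * Re (qform n \<sigma> x)) > 0"
      using fullrank_qform_pos[where x=x, OF \<sigma> i] q ll by (intro mult_pos_pos) auto
    then show "Re (qform n \<tau> x) > 0" using q\<tau>[of x] by linarith
  qed
  let ?E = "dg 2 pure_weights" and ?Q = "dg 2 (ref_weights l)"
  have pE: "psd 2 ?E" "psd 2 (1\<^sub>m 2 - ?E)"
    using pure_weights_le1 by (auto intro!: psd_diag psd_one_minus_diag)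
  have mE: "mtrace ?E \<noteq> of_nat 2"
    using sum_pure_weights[of 2 "\<lambda>_. 1"] by (simp add: mtrace_diag del: of_real_sum)
  have v: "meas_prep 2 ?E R \<tau> (dg 2 g) = complex_of_real (g 0) \<cdot>\<^sub>m R + complex_of_real (g 1) \<cdot>\<^sub>m \<tau>" for g
  proof -
    have 1: "mtrace (?E * dg 2 g) = complex_of_real (g 0)" by (rule mtrace_pure_mult) simp
    have "mtrace ((1\<^sub>m 2 - ?E) * dg 2 g) = mtrace (dg 2 g) - mtrace (?E * dg 2 g)"
      by (rule mtrace_compl_mult) auto
    also have "\<dots> = complex_of_real (g 1)" unfolding 1 by (simp add: mtrace_diag numeral_2_eq_2)
    finally show ?thesis unfolding meas_prep_def 1 by simp
  qed
  have "meas_prep 2 ?E R \<tau> ?E = R"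
    unfolding v using c \<tau>c by (intro eq_matI) (auto simp: pure_weights_def)
  moreover have "meas_prep 2 ?E R \<tau> ?Q = \<sigma>"
  proof (rule eq_matI)
    fix i j assume "i < dim_row \<sigma>" "j < dim_col \<sigma>"
    then show "meas_prep 2 ?E R \<tau> ?Q $$ (i,j) = \<sigma> $$ (i,j)"
      unfolding v using c Bc \<tau>c q by (simp add: \<tau>_def B_def ref_weights_def q_def[symmetric] flip: of_real_mult)
  qed (use c \<tau>c in \<open>auto simp: v\<close>)
  moreover have "fullrank_state 2 ?Q" using ref_weights[OF l1] by (intro fullrank_diag) auto
  ultimately show ?thesis
    using data_processing[OF meas_prep_channel_F[OF pE mE R \<tau>] _ density_pure[of 2], of ?Q] by (simp add: calib_def)
qed

text \<open>Dually, a measurement separating \<open>\<rho>\<close> from \<open>\<sigma>\<close> is turned into a channel onto the pair in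
  \<open>calib\<close>, with \<open>j\<close> copies of the output.\<close>
lemma test_channel:
  assumes \<sigma>: "fullrank_state n \<sigma>" and \<rho>: "density n \<rho>" and T: "psd n T" "psd n (1\<^sub>m n - T)"
    and x: "x > 1" and s: "Re (mtrace (T * \<sigma>)) < 1 / x^j"
  shows "\<exists>h. density (2^j) (dg (2^j) h) \<and> h 0 \<ge> Re (mtrace (T * \<rho>)) \<and>
    f (dg (2^j) h) (kpow (dg 2 (ref_weights x)) j) \<le> f \<rho> \<sigma>"
proof -
  have d\<sigma>: "density n \<sigma>" using fullrank_density[OF \<sigma>] .
  have p: "psd n \<rho>" "psd n \<sigma>" using \<rho> d\<sigma> by (auto simp: density_def)
  have c: "\<rho> \<in> carrier_mat n n" "\<sigma> \<in> carrier_mat n n" "T \<in> carrier_mat n n" using p T by auto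
  define s' where "s' = Re (mtrace (T * \<sigma>))"
  define t where "t = Re (mtrace (T * \<rho>))"
  have s't: "mtrace (T * \<sigma>) = complex_of_real s'" "mtrace (T * \<rho>) = complex_of_real t"
    using mtrace_psd_mult(1)[OF T(1)] p by (auto simp: s'_def t_def)
  have xj: "x^j \<ge> 1" using x by simp
  then have "1/x^j \<le> 1" by simp
  then have s1: "s' < 1" and s0: "s' \<ge> 0" using s mtrace_psd_mult(2)[OF T(1) p(2)] by (auto simp: s'_def)
  have t0: "t \<ge> 0" using mtrace_psd_mult(2)[OF T(1) p(1)] by (auto simp: t_def)
  have comp: "mtrace ((1\<^sub>m n - T) * \<sigma>) = complex_of_real (1 - s')" "mtrace ((1\<^sub>m n - T) * \<rho>) = complex_of_real (1 - t)"
    using c \<rho> d\<sigma> s't by (auto simp: mtrace_compl_mult density_def)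
  have t1: "t \<le> 1" using mtrace_psd_mult(2)[OF T(2) p(1)] comp by simp
  have "mtrace (1\<^sub>m n - T) \<noteq> 0" by (rule mtrace_psd_zero[OF T(2) c(2)]) (use comp s1 in auto)
  moreover have "mtrace (1\<^sub>m n - T) = of_nat n - mtrace T"
    using c by (auto simp: mtrace_def sum_subtractf)
  ultimately have nz: "mtrace T \<noteq> of_nat n" by auto
  let ?N = "2^j :: nat"
  define b where "b i = (tprod 2 (ref_weights x) j i - s' * pure_weights i) / (1 - s')" for i
  have r: "tprod 2 (ref_weights x) j i > 0" if "i < ?N" for i
    using ref_weights[OF x] that by (intro tprod_pos) auto
  have b0: "b i > 0" if "i < ?N" for i
    using r[OF that] s s1 by (auto simp: b_def pure_weights_def tprod_ref_0 s'_def)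
  have b1: "(\<Sum>i<?N. b i) = 1"
    using s1 sum_tprod[of 2 "ref_weights x" j] ref_weights(2)[OF x] sum_pure_weights[of ?N "\<lambda>_. 1"]
    by (simp add: b_def sum_subtractf flip: sum_divide_distrib sum_distrib_left)
  have fb: "fullrank_state ?N (dg ?N b)" using b0 b1 by (intro fullrank_diag) auto
  have pN: "density ?N (dg ?N pure_weights)" by (rule density_pure) simp
  let ?C = "meas_prep n T (dg ?N pure_weights) (dg ?N b)"
  define h where "h i = t * pure_weights i + (1 - t) * b i" for i
  have "?C \<rho> = dg ?N h"
    unfolding meas_prep_def s't comp by (rule eq_matI) (auto simp: mat_diag_def h_def)
  moreover have "?C \<sigma> = kpow (dg 2 (ref_weights x)) j"
    unfolding meas_prep_def s't comp kpow_dg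
  proof (rule eq_matI)
    fix i k assume "i < dim_row (dg ?N (tprod 2 (ref_weights x) j))" "k < dim_col (dg ?N (tprod 2 (ref_weights x) j))"
    moreover have "complex_of_real s' * complex_of_real (pure_weights k) + complex_of_real (1 - s') * complex_of_real (b k)
        = complex_of_real (tprod 2 (ref_weights x) j k)"
      unfolding of_real_mult[symmetric] of_real_add[symmetric] of_real_eq_iff using s1 by (simp add: b_def)
    ultimately show "(complex_of_real s' \<cdot>\<^sub>m dg ?N pure_weights + complex_of_real (1 - s') \<cdot>\<^sub>m dg ?N b) $$ (i,k) =
      dg ?N (tprod 2 (ref_weights x) j) $$ (i,k)"
      by (auto simp: mat_diag_def simp del: of_real_diff)
  qed (auto simp: mat_diag_def)
  moreover have "f (?C \<rho>) (?C \<sigma>) \<le> f \<rho> \<sigma>"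
    by (rule data_processing[OF meas_prep_channel_F[OF T nz pN fb] \<sigma> \<rho>])
  moreover have "density ?N (dg ?N h)"
  proof (rule density_diag)
    show "h i \<ge> 0" if "i < ?N" for i
      unfolding h_def using t0 t1 b0[OF that] pure_weights_le1 by (intro add_nonneg_nonneg mult_nonneg_nonneg) auto
    show "(\<Sum>i<?N. h i) = 1"
      unfolding h_def sum.distrib sum_distrib_left[symmetric] b1
      using sum_pure_weights[of ?N "\<lambda>_. 1"] by simp
  qed
  moreover have "h 0 \<ge> t" unfolding h_def using t1 b0[of 0] by (simp add: pure_weights_def)
  ultimately show ?thesis unfolding t_def by metis
qed

section \<open>The logarithm law\<close>

lemma calib_nonneg: "l > 1 \<Longrightarrow> calib l \<ge> 0"
  unfolding calib_def using ref_weights[of l] by (intro nonneg[of 2] fullrank_diag density_pure) auto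

text \<open>The power of a point mass is a point mass, of reference weight \<open>1 / l^k\<close>.
  Testing for this point has error probability below \<open>1/y\<close> and no error on the first
  state, so \<open>test_channel\<close> with one output copy converts the k-fold pair into the pair
  for \<open>y\<close>.\<close>

lemma calib_le:
  assumes l: "l > 1" and y: "1 < y" "y < l^k"
  shows "calib y \<le> k * calib l"
proof -
  let ?N = "2^k :: nat" and ?Q = "kpow (dg 2 (ref_weights l)) k"
  have fQ: "fullrank_state ?N ?Q" by (rule fullrank_kpow_dg) (use ref_weights[OF l] in auto)
  have pE: "psd ?N (dg ?N pure_weights)" "psd ?N (1\<^sub>m ?N - dg ?N pure_weights)"
    using pure_weights_le1 by (auto intro!: psd_diag psd_one_minus_diag)
  have "Re (mtrace (dg ?N pure_weights * ?Q)) < 1 / y^1"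
    using mtrace_pure_mult[of ?N "tprod 2 (ref_weights l) k"] y l
    by (simp add: kpow_dg tprod_ref_0 frac_less2 del: mat_diag_diag)
  from test_channel[OF fQ density_pure pE y(1) this]
  obtain h where h: "density (2^1) (dg (2^1) h)" "h 0 \<ge> Re (mtrace (dg ?N pure_weights * dg ?N pure_weights))"
    "f (dg (2^1) h) (kpow (dg 2 (ref_weights y)) 1) \<le> f (dg ?N pure_weights) ?Q" by auto
  have "pure_weights 0 = 1" by (simp add: pure_weights_def)
  \<comment> \<open>The test succeeds with certainty, which forces the output law to be the point
    mass itself.\<close>
  then have "h 0 \<ge> 1" using h(2) mtrace_pure_mult[of ?N pure_weights] by (simp del: mat_diag_diag)
  moreover have "h 1 \<ge> 0" "h 0 + h 1 = 1"
    using density_diag_entry(2,3)[OF h(1)] by (auto simp: mat_diag_def numeral_2_eq_2)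
  ultimately have hh: "h 0 = 1" "h 1 = 0" by linarith+
  have "dg 2 h = dg 2 pure_weights"
    by (rule eq_matI) (auto simp: mat_diag_def less_2_cases_iff hh hh(2)[simplified] pure_weights_def)
  then have "calib y \<le> f (dg ?N pure_weights) ?Q"
    using h(3) by (simp only: calib_def kpow_1[of _ 2] mat_diag_dim power_one_right)
  also have "\<dots> = k * calib l"
    unfolding calib_def kpow_pure[symmetric]
    by (rule kpow_additive) (use ref_weights[OF l] density_pure in auto)
  finally show ?thesis .
qed

text \<open>The opposite conversion: the point mass is dominated by \<open>l^k\<close> times the
  product reference, so \<open>reverse_test\<close> prepares the k-fold pair from the pair for
  \<open>x\<close>.\<close>

lemma calib_ge:
  assumes l: "l > 1" and x: "l^k < x"
  shows "k * calib l \<le> calib x"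
proof -
  let ?N = "2^k :: nat" and ?Q = "kpow (dg 2 (ref_weights l)) k"
  have fQ: "fullrank_state ?N ?Q" by (rule fullrank_kpow_dg) (use ref_weights[OF l] in auto)
  have "Re (qform ?N (dg ?N pure_weights) z) \<le> l^k * Re (qform ?N ?Q z)" for z
    unfolding kpow_dg qform_diag Re_complex_of_real sum_distrib_left
  proof (intro sum_mono)
    fix i assume i: "i \<in> {..<?N}"
    have "pure_weights i \<le> l^k * tprod 2 (ref_weights l) k i"
      using tprod_pos[of 2 "ref_weights l" i k] ref_weights[OF l] i l
      by (auto simp: pure_weights_def tprod_ref_0)
    then have "pure_weights i * (cmod (z i))\<^sup>2 \<le> l^k * tprod 2 (ref_weights l) k i * (cmod (z i))\<^sup>2"
      by (rule mult_right_mono) simp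
    then show "pure_weights i * (cmod (z i))\<^sup>2 \<le> l^k * (tprod 2 (ref_weights l) k i * (cmod (z i))\<^sup>2)"
      by (simp only: mult.assoc)
  qed
  then have "f (dg ?N pure_weights) ?Q \<le> calib x"
    by (intro reverse_test[OF fQ density_pure _ x]) auto
  moreover have "f (dg ?N pure_weights) ?Q = k * calib l"
    unfolding calib_def kpow_pure[symmetric]
    by (rule kpow_additive) (use ref_weights[OF l] density_pure in auto)
  ultimately show ?thesis by simp
qed

text \<open>For \<open>m^j < y < l^k\<close> the two conversions compare \<open>j * calib m\<close>
  with \<open>k * calib l\<close> through \<open>calib y\<close>. Taking \<open>j\<close> close to
  \<open>k * ln l / ln m\<close> and \<open>k\<close> large gives the ratio of logarithms.\<close>

lemma calib_proportional:
  assumes l: "l > 1" and m: "m > 1"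
  shows "calib m * ln l \<le> calib l * ln m"
proof -
  define c where "c = ln l / ln m"
  have ln: "ln l > 0" "ln m > 0" using l m by auto
  have "k * (c * calib m - calib l) \<le> 2 * calib m" for k :: nat
  proof (cases "k * c - 2 \<ge> 0")
    case True
    \<comment> \<open>Staying a full unit below \<open>k * c\<close> leaves room for the exponent
      \<open>k * c - 1/2\<close> strictly between, so both conversions apply to \<open>y\<close>;
      rounding costs at most one more unit, whence the 2 in the bound.\<close>
    define j where "j = nat \<lfloor>k * c - 1\<rfloor>"
    have j: "real j \<le> k * c - 1" "real j \<ge> k * c - 2" using True unfolding j_def by linarith+
    have "c > 0" using ln by (simp add: c_def)
    define y where "y = exp ((k * c - 1/2) * ln m)"
    have "real j * ln m < (k * c - 1/2) * ln m" using j ln by (intro mult_strict_right_mono) auto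
    then have "exp (real j * ln m) < y" by (simp add: y_def)
    then have 1: "m^j < y" using m by (simp add: exp_of_nat_mult)
    have "(k * c - 1/2) * ln m < real k * ln l" using ln by (simp add: c_def field_simps)
    then have "y < exp (real k * ln l)" by (simp add: y_def)
    then have 2: "y < l^k" using l by (simp add: exp_of_nat_mult)
    have 3: "y > 1" using True ln by (simp add: y_def)
    have "j * calib m \<le> k * calib l"
      using calib_ge[OF m 1] calib_le[OF l 3 2] by linarith
    moreover have "(k * c - 2) * calib m \<le> j * calib m"
      using j calib_nonneg[OF m] by (intro mult_right_mono) auto
    ultimately show ?thesis by (simp add: algebra_simps)
  next
    case False
    then have "k * c * calib m \<le> 2 * calib m" using calib_nonneg[OF m] by (intro mult_right_mono) auto
    moreover have "k * calib l \<ge> 0" using calib_nonneg[OF l] by simp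
    ultimately show ?thesis by (simp add: algebra_simps)
  qed
  \<comment> \<open>A number whose multiples by all naturals are bounded above is not
    positive.\<close>
  then have "c * calib m - calib l \<le> 0"
    by (meson linorder_not_le reals_Archimedean3)
  then show ?thesis using ln by (simp add: c_def field_simps)
qed

lemma calib_ln: "\<exists>a\<ge>0. \<forall>l>1. calib l = a * ln l"
proof (intro exI[of _ "calib 2 / ln 2"] conjI allI impI)
  show "calib 2 / ln 2 \<ge> 0" using calib_nonneg[of 2] by simp
  fix l :: real assume "l > 1"
  then have "calib l * ln 2 = calib 2 * ln l"
    using calib_proportional[of l 2] calib_proportional[of 2 l] by simp
  then show "calib l = calib 2 / ln 2 * ln l" by (simp add: field_simps)
qed

end

section \<open>Comparison with the relative entropy\<close>

lemma Re_mtrace_conj_diag_mult: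
  assumes V: "V \<in> carrier_mat n n" and \<rho>: "\<rho> \<in> carrier_mat n n"
  shows "Re (mtrace (\<rho> * (V * dg n g * adj V))) = (\<Sum>i<n. Re ((adj V * \<rho> * V) $$ (i,i)) * g i)"
proof -
  have "mtrace (\<rho> * (V * dg n g * adj V)) = mtrace (adj V * (\<rho> * (V * dg n g)))"
    using V \<rho> by (subst mtrace_comm[of "adj V" n]) (auto simp: assoc_mult_mat[of _ n n _ n _ n])
  also have "adj V * (\<rho> * (V * dg n g)) = (adj V * \<rho> * V) * dg n g"
    using V \<rho> by (simp add: assoc_mult_mat[of _ n n _ n _ n])
  finally show ?thesis using V \<rho> by (simp add: mtrace_mult_diag[of _ n])
qed

text \<open>The decomposition chosen in \<open>mat_fun\<close> does not involve the function
  applied, so one pair \<open>U\<close>, \<open>d\<close> serves every \<open>g\<close>.\<close>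

lemma mat_fun_spectral:
  assumes "hermitian n A"
  obtains U d where "unitary n U" "A = U * dg n d * adj U"
    "\<And>g. mat_fun g A = U * dg n (\<lambda>i. g (d i)) * adj U"
proof -
  let ?P = "\<lambda>(U, d). unitary n U \<and> A = U * dg n d * adj U"
  obtain U d where Ud: "(U, d) = (SOME x. ?P x)" by (cases "SOME x. ?P x") simp
  have "\<exists>x. ?P x" using hermitian_spectral[OF assms] by auto
  then have "?P (U, d)" unfolding Ud by (rule someI_ex)
  moreover have n: "dim_row A = n" using assms by (auto simp: hermitian_def)
  have "mat_fun g A = U * dg n (\<lambda>i. g (d i)) * adj U" for g
    unfolding mat_fun_def Let_def n Ud[symmetric] by simp
  ultimately show ?thesis using that by auto
qed

context monotone_functional
begin

lemma relative_entropy_upper: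
  fixes e d :: "nat \<Rightarrow> real"
  assumes \<rho>: "density n \<rho>" and U: "unitary n U" "\<rho> = U * dg n d * adj U"
    and e: "\<And>i. i < n \<Longrightarrow> e i > 0" "(\<Sum>i<n. e i) = 1"
    and a: "a \<ge> 0" "\<And>l. l > 1 \<Longrightarrow> calib l = a * ln l"
  shows "f \<rho> (dg n e) \<le> a * ((\<Sum>i<n. d i * ln (d i)) - (\<Sum>i<n. Re (\<rho> $$ (i,i)) * ln (e i)))"
proof -
  have e': "\<forall>i<n. e i > 0" using e(1) by blast
  \<comment> \<open>\<open>\<mu>d\<close> and \<open>\<mu>e\<close> are Tr(rho log rho) and Tr(rho
    log sigma) for the diagonal sigma.\<close>
  define \<mu>d where "\<mu>d = (\<Sum>i<n. d i * ln (d i))"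
  define \<mu>e where "\<mu>e = (\<Sum>i<n. Re (\<rho> $$ (i,i)) * ln (e i))"
  \<comment> \<open>One \<epsilon> comes from continuity, one from the constant factor in the
    domination, and \<open>2 * a * \<epsilon>\<close> from the widths of the two typical
    sets.\<close>
  have bound: "f \<rho> (dg n e) \<le> a * (\<mu>d - \<mu>e) + (2 + 2 * a) * \<epsilon>" if \<epsilon>: "\<epsilon> > 0" for \<epsilon>
  proof -
    obtain \<delta> where \<delta>: "\<delta> > 0" and loc: "\<And>R. density n R \<Longrightarrow> (\<And>i j. i < n \<Longrightarrow> j < n \<Longrightarrow> cmod (R $$ (i,j) - \<rho> $$ (i,j)) < \<delta>)
      \<Longrightarrow> f \<rho> (dg n e) - \<epsilon> \<le> f R (dg n e)"
      using continuous_at[OF fullrank_diag[OF e] \<rho> \<epsilon>] by blast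
    \<comment> \<open>With \<open>\<eta> = t\<^sup>2\<close> the closeness bound of
      \<open>oneshot_state\<close> becomes \<open>3 * t\<^sup>2 + 2 * t\<close>, at most
      \<open>3.5 * t\<close> for \<open>t \<le> 1/2\<close>; the cap also gives
      \<open>1 - 2 * \<eta> \<ge> 1/2\<close>.\<close>
    define t where "t = min (1/2) (\<delta>/6)"
    have t: "t > 0" "t \<le> 1/2" "5 * t < \<delta>" using \<delta> by (auto simp: t_def min_def)
    define \<eta> where "\<eta> = t\<^sup>2"
    have \<eta>: "\<eta> > 0" "\<eta> \<le> 1/4" using t power_mono[of t "1/2" 2] by (auto simp: \<eta>_def power2_eq_square)
    have small: "3 * \<eta> + \<eta> / t + t < \<delta>"
    proof -
      have "\<eta> / t = t" using t by (simp add: \<eta>_def power2_eq_square)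
      moreover have "\<eta> \<le> t * (1/2)" unfolding \<eta>_def power2_eq_square using t by (intro mult_left_mono) auto
      ultimately show ?thesis using t by linarith
    qed
    \<comment> \<open>The factor 4 in the domination constant costs \<open>a * ln 4\<close> in
      total, which is negligible per copy.\<close>
    have "(\<lambda>k. (a * ln 4) / real k) \<longlonglongrightarrow> 0" by (rule lim_const_over_n)
    then have "\<forall>\<^sub>F k in sequentially. (a * ln 4) / real k < \<epsilon>" using \<epsilon> by (auto simp: order_tendsto_iff)
    then have "\<forall>\<^sub>F k in sequentially. f \<rho> (dg n e) \<le> a * (\<mu>d - \<mu>e) + (2 + 2 * a) * \<epsilon>"
      using typical_power[OF \<rho> U e' \<mu>d_def \<mu>e_def \<epsilon> \<eta>(1)] eventually_gt_at_top[of 0]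
    proof eventually_elim
      case (elim k)
      then obtain A S where A: "A \<subseteq> {..<n^k}" "(\<Sum>x\<in>{..<n^k}-A. tprod n d k x) \<le> \<eta>"
          "\<And>x. x \<in> A \<Longrightarrow> tprod n d k x \<le> exp (k * (\<mu>d + \<epsilon>))"
        and S: "S \<subseteq> {..<n^k}" "(\<Sum>y\<in>{..<n^k}-S. Re (kpow \<rho> k $$ (y,y))) \<le> \<eta>"
          "\<And>y. y \<in> S \<Longrightarrow> exp (k * (\<mu>e - \<epsilon>)) \<le> tprod n e k y"
        by auto
      have k: "real k > 0" using elim by simp
      have S3: "1 \<le> exp (- (k * (\<mu>e - \<epsilon>))) * tprod n e k y" if "y \<in> S" for y
      proof -
        have "exp (- (k * (\<mu>e - \<epsilon>))) * exp (k * (\<mu>e - \<epsilon>)) \<le> exp (- (k * (\<mu>e - \<epsilon>))) * tprod n e k y"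
          using S(3)[OF that] by (intro mult_left_mono) auto
        then show ?thesis by (simp flip: exp_add)
      qed
      note d = eigenvalues_distribution[OF \<rho> U]
      have p: "\<And>x. x < n^k \<Longrightarrow> tprod n d k x \<ge> 0" "(\<Sum>x<n^k. tprod n d k x) = 1"
        using d tprod_nonneg[of n d] sum_tprod[of n d k] by auto
      have M: "kpow \<rho> k = kpow U k * dg (n^k) (tprod n d k) * adj (kpow U k)"
        unfolding U(2) by (rule kpow_conj_diag[OF U(1)])
      have eN: "\<And>y. y < n^k \<Longrightarrow> tprod n e k y \<ge> 0" using tprod_pos[of n e] e(1) by (auto intro: less_imp_le)
      let ?P = "exp (k * (\<mu>d + \<epsilon>))" and ?L = "exp (- (k * (\<mu>e - \<epsilon>)))"
      have "\<eta> < 1/2" using \<eta> by simp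
      from oneshot_state[where e="tprod n e k", OF unitary_kpow[OF U(1)] p M A S(1,2) S3 eN _ _ this t(1)]
      obtain R \<alpha> where R: "density (n^k) R"
        "\<And>z. Re (qform (n^k) R z) \<le> ?P * ?L / (1 - 2*\<eta>) * Re (qform (n^k) (dg (n^k) (tprod n e k)) z)"
        "\<And>y. y < n^k \<Longrightarrow> \<alpha> y \<ge> 0"
        "\<And>y y'. y < n^k \<Longrightarrow> y' < n^k \<Longrightarrow> cmod (R $$ (y,y') - kpow \<rho> k $$ (y,y')) \<le> \<alpha> y + \<alpha> y'"
        "2 * (\<Sum>y<n^k. \<alpha> y) \<le> 3 * \<eta> + \<eta> / t + t"
        by (blast intro: exp_ge_zero)
      have lower: "k * (f \<rho> (dg n e) - \<epsilon>) \<le> f R (kpow (dg n e) k)"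
        by (rule superadditive_close[OF e \<rho> loc R(1) R(3) R(3) R(4)]) (use R(5) small in auto)
      let ?X = "exp (k * (\<mu>d - \<mu>e + 2 * \<epsilon>))"
      have PL: "?P * ?L = ?X" by (simp add: algebra_simps flip: exp_add)
      define l where "l = max 2 (4 * ?X)"
      \<comment> \<open>The normalisation costs at most a factor 2; a further factor 2 provides the
        strict inequality for \<open>reverse_test\<close>.\<close>
      have l4: "?P * ?L / (1 - 2*\<eta>) < 4 * ?X"
      proof -
        have "?X / (1 - 2*\<eta>) \<le> ?X / (1/2)" using \<eta> by (intro divide_left_mono) auto
        also have "\<dots> < 4 * ?X" by simp
        finally show ?thesis by (simp only: PL)
      qed
      have fk: "fullrank_state (n^k) (kpow (dg n e) k)" by (rule fullrank_kpow_dg[OF e])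
      have "f R (kpow (dg n e) k) \<le> calib (4 * ?X)"
        by (rule reverse_test[OF fk R(1) _ l4]) (use R(2) in \<open>simp add: kpow_dg\<close>)
      \<comment> \<open>The formula for \<open>calib\<close> is available above 1 only; comparing
        traces in the domination shows that its constant is at least 1.\<close>
      moreover have "4 * ?X > 1"
      proof -
        have "(1::real) = (\<Sum>i<n^k. Re (qform (n^k) R (\<lambda>j. if j = i then 1 else 0)))"
          using density_diag_entry(3)[OF R(1)] by (simp add: qform_unit)
        also have "\<dots> \<le> (\<Sum>i<n^k. ?P * ?L / (1 - 2*\<eta>) * Re (qform (n^k) (dg (n^k) (tprod n e k)) (\<lambda>j. if j = i then 1 else 0)))"
          by (intro sum_mono R(2))
        also have "\<dots> = ?P * ?L / (1 - 2*\<eta>)"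
          using density_diag_entry(3)[OF fullrank_density[OF fk]]
          by (simp only: sum_distrib_left[symmetric] kpow_dg) (simp add: qform_unit)
        finally show ?thesis using l4 by linarith
      qed
      ultimately have "f R (kpow (dg n e) k) \<le> a * ln (4 * ?X)" using a(2) by simp
      also have "ln (4 * ?X) = ln 4 + k * (\<mu>d - \<mu>e + 2 * \<epsilon>)" by (simp add: ln_mult)
      finally have "k * (f \<rho> (dg n e) - \<epsilon>) \<le> a * (ln 4 + k * (\<mu>d - \<mu>e + 2 * \<epsilon>))" using lower by simp
      then have "f \<rho> (dg n e) - \<epsilon> \<le> a * (ln 4 + k * (\<mu>d - \<mu>e + 2 * \<epsilon>)) / k"
        using k by (simp add: field_simps)
      also have "\<dots> = a * ln 4 / k + a * (\<mu>d - \<mu>e + 2 * \<epsilon>)" using k by (simp add: field_simps)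
      finally show ?case using elim(1) by (simp add: algebra_simps)
    qed
    then show ?thesis by (auto dest: eventually_happens)
  qed
  have "f \<rho> (dg n e) \<le> a * (\<mu>d - \<mu>e)"
  proof (rule field_le_epsilon)
    fix \<epsilon> :: real assume "\<epsilon> > 0"
    then have "\<epsilon> / (2 + 2 * a) > 0" using a(1) by simp
    from bound[OF this] show "f \<rho> (dg n e) \<le> a * (\<mu>d - \<mu>e) + \<epsilon>" using a(1) by simp
  qed
  then show ?thesis by (simp add: \<mu>d_def \<mu>e_def)
qed

lemma relative_entropy_lower:
  fixes e d :: "nat \<Rightarrow> real"
  assumes \<rho>: "density n \<rho>" and U: "unitary n U" "\<rho> = U * dg n d * adj U"
    and e: "\<And>i. i < n \<Longrightarrow> e i > 0" "(\<Sum>i<n. e i) = 1"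
    and a: "a \<ge> 0" "\<And>l. l > 1 \<Longrightarrow> calib l = a * ln l"
  shows "a * ((\<Sum>i<n. d i * ln (d i)) - (\<Sum>i<n. Re (\<rho> $$ (i,i)) * ln (e i))) \<le> f \<rho> (dg n e)"
proof -
  have e': "\<forall>i<n. e i > 0" using e(1) by blast
  define \<mu>d where "\<mu>d = (\<Sum>i<n. d i * ln (d i))"
  define \<mu>e where "\<mu>e = (\<Sum>i<n. Re (\<rho> $$ (i,i)) * ln (e i))"
  have bound: "a * (\<mu>d - \<mu>e) \<le> f \<rho> (dg n e) + (1 + 3 * a) * \<epsilon>" if \<epsilon>: "\<epsilon> > 0" for \<epsilon>
  proof (cases "\<mu>d - \<mu>e > 3 * \<epsilon>")
    \<comment> \<open>A two-point pair with parameter above 1 needs a positive exponent. Here the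
      exponent is at most \<open>3 * \<epsilon>\<close>, and nonnegativity of \<open>f\<close>
      already gives the bound.\<close>
    case False
    have "a * (\<mu>d - \<mu>e) \<le> a * (3 * \<epsilon>)" using False a(1) by (intro mult_left_mono) auto
    then show ?thesis using nonneg[OF fullrank_diag[OF e] \<rho>] \<epsilon> by (simp add: algebra_simps)
  next
    case True
    \<comment> \<open>Two \<epsilon> are the loss in the exponent of the test; the third makes its
      error strictly smaller than \<open>1 / x^k\<close>, as \<open>test_channel\<close>
      requires.\<close>
    define x where "x = exp (\<mu>d - \<mu>e - 3 * \<epsilon>)"
    have x: "x > 1" using True by (simp add: x_def)
    let ?E = "dg 2 pure_weights" and ?Q = "dg 2 (ref_weights x)"
    note rw = ref_weights[OF x]
    have dE: "density 2 ?E" by (rule density_pure) simp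
    obtain \<delta> where \<delta>: "\<delta> > 0" and loc: "\<And>R. density 2 R \<Longrightarrow> (\<And>i j. i < 2 \<Longrightarrow> j < 2 \<Longrightarrow> cmod (R $$ (i,j) - ?E $$ (i,j)) < \<delta>)
      \<Longrightarrow> f ?E ?Q - \<epsilon> \<le> f R ?Q"
      using continuous_at[OF fullrank_diag[OF rw] dE \<epsilon>] by blast
    \<comment> \<open>The test succeeds with probability at least \<open>1 - 4 * \<eta>\<close>,
      which puts the output law within \<open>2 * (1 - h 0) \<le> 8 * \<eta>\<close> of the point
      mass in l1 distance, and this is half of \<delta>.\<close>
    define \<eta> where "\<eta> = \<delta> / 16"
    have \<eta>: "\<eta> > 0" "8 * \<eta> < \<delta>" using \<delta> by (auto simp: \<eta>_def)
    have "\<forall>\<^sub>F k in sequentially. a * (\<mu>d - \<mu>e) \<le> f \<rho> (dg n e) + (1 + 3 * a) * \<epsilon>"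
      using typical_power[OF \<rho> U e' \<mu>d_def \<mu>e_def \<epsilon> \<eta>(1)] eventually_gt_at_top[of 0]
    proof eventually_elim
      case (elim k)
      then obtain A S where A: "A \<subseteq> {..<n^k}" "(\<Sum>x\<in>{..<n^k}-A. tprod n d k x) \<le> \<eta>"
          "\<And>x. x \<in> A \<Longrightarrow> exp (k * (\<mu>d - \<epsilon>)) \<le> tprod n d k x"
        and S: "S \<subseteq> {..<n^k}" "(\<Sum>y\<in>{..<n^k}-S. Re (kpow \<rho> k $$ (y,y))) \<le> \<eta>"
          "\<And>y. y \<in> S \<Longrightarrow> tprod n e k y \<le> exp (k * (\<mu>e + \<epsilon>))"
        by auto
      have k: "real k > 0" using elim by simp
      have A3: "1 \<le> exp (- (k * (\<mu>d - \<epsilon>))) * tprod n d k y" if "y \<in> A" for y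
      proof -
        have "exp (- (k * (\<mu>d - \<epsilon>))) * exp (k * (\<mu>d - \<epsilon>)) \<le> exp (- (k * (\<mu>d - \<epsilon>))) * tprod n d k y"
          using A(3)[OF that] by (intro mult_left_mono) auto
        then show ?thesis by (simp flip: exp_add)
      qed
      note d = eigenvalues_distribution[OF \<rho> U]
      have p: "\<And>x. x < n^k \<Longrightarrow> tprod n d k x \<ge> 0" "(\<Sum>x<n^k. tprod n d k x) = 1"
        using d tprod_nonneg[of n d] sum_tprod[of n d k] by auto
      have M: "kpow \<rho> k = kpow U k * dg (n^k) (tprod n d k) * adj (kpow U k)"
        unfolding U(2) by (rule kpow_conj_diag[OF U(1)])
      let ?P = "exp (- (k * (\<mu>d - \<epsilon>)))" and ?L = "exp (k * (\<mu>e + \<epsilon>))"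
      from oneshot_test[where e="tprod n e k", OF unitary_kpow[OF U(1)] p M A(1,2) A3 S]
      obtain T where T: "psd (n^k) T" "psd (n^k) (1\<^sub>m (n^k) - T)" "Re (mtrace (T * kpow \<rho> k)) \<ge> 1 - 4 * \<eta>"
        "Re (mtrace (T * kpow (dg n e) k)) \<le> ?P * ?L" by (auto simp: kpow_dg)
      have fk: "fullrank_state (n^k) (kpow (dg n e) k)" by (rule fullrank_kpow_dg[OF e])
      have "?P * ?L = exp (- (k * (\<mu>d - \<mu>e - 2 * \<epsilon>)))" by (simp add: algebra_simps flip: exp_add)
      also have "\<dots> < exp (- (k * (\<mu>d - \<mu>e - 3 * \<epsilon>)))" using k \<epsilon> by simp
      also have "\<dots> = 1 / x^k" by (simp add: x_def exp_minus inverse_eq_divide flip: exp_of_nat_mult)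
      finally have "Re (mtrace (T * kpow (dg n e) k)) < 1 / x^k" using T(4) by linarith
      from test_channel[OF fk density_kpow[OF \<rho>] T(1,2) x this]
      obtain h where h: "density (2^k) (dg (2^k) h)" "h 0 \<ge> 1 - 4 * \<eta>"
        "f (dg (2^k) h) (kpow ?Q k) \<le> f (kpow \<rho> k) (kpow (dg n e) k)"
        using T(3) by force
      have h0: "h i \<ge> 0" if "i < 2^k" for i
        using density_diag_entry(2)[OF h(1) that] that by (simp add: mat_diag_def)
      have hs: "(\<Sum>i<2^k. h i) = 1"
        using density_diag_entry(3)[OF h(1)] by (simp add: mat_diag_def)
      define \<alpha> where "\<alpha> i = \<bar>h i - pure_weights i\<bar>" for i
      have "(\<Sum>i<2^k. \<alpha> i) = (\<Sum>i<2^k. h i + pure_weights i * (1 - 2 * h i))"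
      proof (intro sum.cong refl)
        fix i :: nat assume "i \<in> {..<2^k}"
        moreover have "h 0 \<le> 1" using member_le_sum[of 0 "{..<2^k}" h] h0 hs by simp
        ultimately show "\<alpha> i = h i + pure_weights i * (1 - 2 * h i)"
          using h0[of i] by (auto simp: \<alpha>_def pure_weights_def)
      qed
      also have "\<dots> = 2 * (1 - h 0)"
        using sum_pure_weights[of "2^k" "\<lambda>i. 1 - 2 * h i"] hs by (simp add: sum.distrib)
      finally have "(\<Sum>i<2^k. \<alpha> i) = 2 * (1 - h 0)" .
      moreover have "2 * (1 - h 0) \<le> 8 * \<eta>" using h(2) by simp
      ultimately have \<alpha>s: "(\<Sum>i<2^k. \<alpha> i) < \<delta>" using \<eta>(2) by simp
      \<comment> \<open>Both matrices are diagonal, so the l1 distance alone controls all marginals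
        and the column bound can be zero.\<close>
      have "k * (f ?E ?Q - \<epsilon>) \<le> f (dg (2^k) h) (kpow ?Q k)"
      proof (rule superadditive_close[OF rw dE loc h(1), where \<alpha>=\<alpha> and \<beta>="\<lambda>_. 0"])
        show "cmod (dg (2^k) h $$ (y,y') - kpow ?E k $$ (y,y')) \<le> \<alpha> y + 0" if "y < 2^k" "y' < 2^k" for y y'
          unfolding kpow_pure using that by (auto simp: mat_diag_def \<alpha>_def simp flip: of_real_diff)
      qed (use \<alpha>s in \<open>auto simp: \<alpha>_def\<close>)
      also have "\<dots> \<le> f (kpow \<rho> k) (kpow (dg n e) k)" by (rule h(3))
      also have "\<dots> = k * f \<rho> (dg n e)" by (rule kpow_additive[OF e \<rho>])
      finally have "f ?E ?Q - \<epsilon> \<le> f \<rho> (dg n e)" using k by simp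
      moreover have "f ?E ?Q = a * (\<mu>d - \<mu>e - 3 * \<epsilon>)"
        using a(2)[OF x] by (simp add: calib_def x_def)
      ultimately show ?case by (simp add: algebra_simps)
    qed
    then show ?thesis by (auto dest: eventually_happens)
  qed
  have "a * (\<mu>d - \<mu>e) \<le> f \<rho> (dg n e)"
  proof (rule field_le_epsilon)
    fix \<epsilon> :: real assume "\<epsilon> > 0"
    then have "\<epsilon> / (1 + 3 * a) > 0" using a(1) by simp
    from bound[OF this] show "a * (\<mu>d - \<mu>e) \<le> f \<rho> (dg n e) + \<epsilon>" using a(1) by simp
  qed
  then show ?thesis by (simp add: \<mu>d_def \<mu>e_def)
qed

section \<open>Reduction to a diagonal second argument\<close>

lemma unitary_invariant:
  assumes V: "unitary n V" and \<sigma>: "fullrank_state n \<sigma>" and \<rho>: "density n \<rho>"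
  shows "f (adj V * \<rho> * V) (adj V * \<sigma> * V) = f \<rho> \<sigma>"
proof (rule antisym)
  have Vc: "V \<in> carrier_mat n n" using unitary_carrier[OF V] .
  let ?C = "\<lambda>X. adj V * X * adj (adj V)"
  have C: "channel_F n n ?C" using unitary_conj_channel_F[OF unitary_adj[OF V]] .
  show "f (adj V * \<rho> * V) (adj V * \<sigma> * V) \<le> f \<rho> \<sigma>" using data_processing[OF C \<sigma> \<rho>] by simp
  have conj_back: "V * (adj V * X * V) * adj V = X" if X: "X \<in> carrier_mat n n" for X
  proof -
    have "V * (adj V * X * V) * adj V = (V * adj V) * X * (V * adj V)"
      using Vc X by (simp add: assoc_mult_mat[of _ n n _ n _ n])
    then show ?thesis using X unitary_right[OF V] by simp
  qed
  have "fullrank_state n (adj V * \<sigma> * V)" using C \<sigma> by (simp add: channel_F_def)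
  moreover have "density n (adj V * \<rho> * V)"
    using C psd_conj[of "adj V" n \<rho>] Vc \<rho> by (auto simp: channel_F_def channel_def density_def)
  ultimately show "f \<rho> \<sigma> \<le> f (adj V * \<rho> * V) (adj V * \<sigma> * V)"
    using data_processing[OF unitary_conj_channel_F[OF V]] conj_back \<rho> \<sigma>
    by (metis density_carrier fullrank_density)
qed

theorem relative_entropy_unique:
  "\<exists>a. \<forall>n \<rho> \<sigma>. fullrank_state n \<sigma> \<and> density n \<rho> \<longrightarrow> f \<rho> \<sigma> = a * rel_entropy \<rho> \<sigma>"
proof -
  obtain a where a: "a \<ge> 0" "\<And>l. l > 1 \<Longrightarrow> calib l = a * ln l" using calib_ln by blast
  have "f \<rho> \<sigma> = a * rel_entropy \<rho> \<sigma>" if \<sigma>: "fullrank_state n \<sigma>" and \<rho>: "density n \<rho>" for n \<rho> \<sigma>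
  proof -
    have h: "hermitian n \<rho>" "hermitian n \<sigma>"
      using \<rho> \<sigma> by (auto simp: fullrank_state_def density_def psd_alt)
    obtain U d where U: "unitary n U" "\<rho> = U * dg n d * adj U"
      "\<And>g. mat_fun g \<rho> = U * dg n (\<lambda>i. g (d i)) * adj U" using mat_fun_spectral[OF h(1)] by blast
    obtain V e where V: "unitary n V" "\<sigma> = V * dg n e * adj V"
      "\<And>g. mat_fun g \<sigma> = V * dg n (\<lambda>i. g (e i)) * adj V" using mat_fun_spectral[OF h(2)] by blast
    have c: "U \<in> carrier_mat n n" "V \<in> carrier_mat n n" "\<rho> \<in> carrier_mat n n"
      using unitary_carrier[OF U(1)] unitary_carrier[OF V(1)] density_carrier[OF \<rho>] by auto
    define \<rho>' where "\<rho>' = adj V * \<rho> * V"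
    have \<sigma>': "adj V * \<sigma> * V = dg n e" using unitary_diagonalise[OF V(1,2)] .
    have C: "channel_F n n (\<lambda>X. adj V * X * adj (adj V))" using unitary_conj_channel_F[OF unitary_adj[OF V(1)]] .
    have f\<sigma>': "fullrank_state n (dg n e)" using C \<sigma> by (simp add: channel_F_def flip: \<sigma>')
    have \<rho>': "density n \<rho>'"
      using C psd_conj[of "adj V" n \<rho>] c \<rho> by (auto simp: channel_F_def channel_def density_def \<rho>'_def)
    have e: "e i > 0" if "i < n" for i
      using fullrank_qform_pos[OF f\<sigma>' that, of "\<lambda>j. if j = i then 1 else 0"] qform_unit[OF that] that
      by (simp add: mat_diag_def)
    have e1: "(\<Sum>i<n. e i) = 1"
      using density_diag_entry(3)[OF fullrank_density[OF f\<sigma>']] by (simp add: mat_diag_def)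
    \<comment> \<open>Passing to the eigenbasis of sigma changes the eigenvectors of rho but not the
      list \<open>d\<close>, so the entropy term computed from \<open>U\<close> is also that of
      \<open>\<rho>'\<close>.\<close>
    have U': "unitary n (adj V * U)" using unitary_mult[OF unitary_adj[OF V(1)] U(1)] .
    have "adj (adj V * U) = adj U * V" using c by (simp add: adj_mult[of _ n n _ n])
    then have \<rho>'U: "\<rho>' = (adj V * U) * dg n d * adj (adj V * U)"
      unfolding \<rho>'_def U(2) using c by (simp add: assoc_mult_mat[of _ n n _ n _ n])
    have "Re (mtrace (mat_fun (\<lambda>x. x * ln x) \<rho>)) = (\<Sum>i<n. d i * ln (d i))"
    proof -
      let ?X = "U * dg n (\<lambda>i. d i * ln (d i)) * adj U"
      \<comment> \<open>Inserting an identity factor makes the entropy term an instance of the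
        formula for Tr(rho log sigma).\<close>
      have "?X \<in> carrier_mat n n" using c by simp
      then have "Re (mtrace ?X) = Re (mtrace (1\<^sub>m n * ?X))" by (simp only: left_mult_one_mat)
      also have "\<dots> = (\<Sum>i<n. Re ((adj U * 1\<^sub>m n * U) $$ (i,i)) * (d i * ln (d i)))"
        by (rule Re_mtrace_conj_diag_mult[OF c(1)]) simp
      also have "adj U * 1\<^sub>m n * U = 1\<^sub>m n"
        using U(1) c right_mult_one_mat[of "adj U" n n] by (simp add: unitary_def)
      finally show ?thesis unfolding U(3) by simp
    qed
    moreover have "Re (mtrace (\<rho> * mat_fun ln \<sigma>)) = (\<Sum>i<n. Re (\<rho>' $$ (i,i)) * ln (e i))"
      unfolding V(3) \<rho>'_def by (rule Re_mtrace_conj_diag_mult[OF c(2,3)])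
    ultimately have "rel_entropy \<rho> \<sigma> = (\<Sum>i<n. d i * ln (d i)) - (\<Sum>i<n. Re (\<rho>' $$ (i,i)) * ln (e i))"
      by (simp add: rel_entropy_def)
    moreover have "f \<rho> \<sigma> = f \<rho>' (dg n e)"
      using unitary_invariant[OF V(1) \<sigma> \<rho>] by (simp add: \<sigma>' \<rho>'_def)
    ultimately show ?thesis
      using relative_entropy_upper[OF \<rho>' U' \<rho>'U e e1 a] relative_entropy_lower[OF \<rho>' U' \<rho>'U e e1 a] by simp
  qed
  then show ?thesis by blast
qed

end

theorem theorem15:
  fixes f :: "complex mat \<Rightarrow> complex mat \<Rightarrow> real"
  assumes "locally_monotonic f"
    and "continuous_first f"
  shows "\<exists>a b :: real. \<forall>n \<rho> \<sigma>. fullrank_state n \<sigma> \<and> density n \<rho> \<longrightarrow>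
           f \<rho> \<sigma> = a * rel_entropy \<rho> \<sigma> + b"
proof -
  define b where "b = f (1\<^sub>m 1) (1\<^sub>m 1)"
  \<comment> \<open>Each side of the monotonicity inequality has two terms, so subtracting a
    constant from \<open>f\<close> preserves it.\<close>
  interpret monotone_functional "\<lambda>\<rho> \<sigma>. f \<rho> \<sigma> - b"
  proof
    show "locally_monotonic (\<lambda>\<rho> \<sigma>. f \<rho> \<sigma> - b)"
      using assms(1) unfolding locally_monotonic_def by (fastforce simp: algebra_simps)
    show "continuous_first (\<lambda>\<rho> \<sigma>. f \<rho> \<sigma> - b)"
      using assms(2) unfolding continuous_first_def by (auto intro!: tendsto_diff)
  qed (simp add: b_def)
  obtain a where "\<And>n \<rho> \<sigma>. fullrank_state n \<sigma> \<and> density n \<rho> \<Longrightarrow> f \<rho> \<sigma> - b = a * rel_entropy \<rho> \<sigma>"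
    using relative_entropy_unique by blast
  then have "\<forall>n \<rho> \<sigma>. fullrank_state n \<sigma> \<and> density n \<rho> \<longrightarrow> f \<rho> \<sigma> = a * rel_entropy \<rho> \<sigma> + b"
    by (metis diff_eq_eq)
  then show ?thesis by blast
qed

end
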